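(* Let $U:\mathbb{R}^d\to\mathbb{R}$ be continuously differentiable, and let $L\ge 0$, $m>0$ be such that for all $x,y\in\mathbb{R}^d$, $\|\nabla U(x)-\nabla U(y)\|\le L\|x-y\|$ and $U(y)\ge U(x)+\langle\nabla U(x),y-x\rangle+(m/2)\|x-y\|^2$. Let $\gamma\in(0,1/(m+L)]$. Then $$\|\pi_\gamma-\pi\|_{\mathrm{TV}}\le2^{-3/2}L\left[d\gamma(1+\gamma)+2(L^2\gamma^3/3)(1+\gamma)\kappa^{-1}d\right]^{1/2}+(4\pi_0)^{-1/2}\left[\gamma\,\mathsf{D}_1(\gamma,d)+2d\gamma^2\,\mathsf{D}_2(\gamma)(\kappa m)^{-1}\right]^{1/2},$$ where $\pi_0=3.14159\ldots$ is the circle constant and $$\mathsf{D}_1(\gamma,d)=2L^2\kappa^{-1}(\kappa^{-1}+\gamma)(2d+L^2\gamma^2/6),\qquad\mathsf{D}_2(\gamma)=L^4(\kappa^{-1}+\gamma).$$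
   Context: Here $d\ge1$, $\kappa=2mL/(m+L)$, and $\pi$ is the probability measure on $\mathbb{R}^d$ with density proportional to $e^{-U}$. For $\gamma>0$, $R_\gamma$ is the Markov kernel on $\mathbb{R}^d$ such that $R_\gamma(x,\cdot)$ is the Gaussian distribution with mean $x-\gamma\nabla U(x)$ and covariance matrix $2\gamma I_d$; for $\gamma\le2/(m+L)$ it has a unique stationary distribution, denoted $\pi_\gamma$. $\|\mu-\nu\|_{\mathrm{TV}}=\sup_A|\mu(A)-\nu(A)|$ over Borel sets $A$. *)

theory Defs
  imports "HOL-Probability.Probability"
begin

definition multivariate_normal :: "real ^ 'n \<Rightarrow> real ^ 'n ^ 'n \<Rightarrow> (real ^ 'n) measure" where
  "multivariate_normal \<mu> \<Sigma> = density lborel (\<lambda>y. ennreal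
     (exp (- (1/2) * ((y - \<mu>) \<bullet> (matrix_inv \<Sigma> *v (y - \<mu>)))) / sqrt ((2 * pi) ^ CARD('n) * det \<Sigma>)))"

text \<open>The normalising constant is an extended nonnegative integral. If it is infinite the result
  is the null measure; this does not happen when \<open>U\<close> is strongly convex.\<close>

definition gibbs_measure :: "(real ^ 'n \<Rightarrow> real) \<Rightarrow> (real ^ 'n) measure" where
  "gibbs_measure U = density lborel
     (\<lambda>x. ennreal (exp (- U x)) / (\<integral>\<^sup>+ y. ennreal (exp (- U y)) \<partial>lborel))"

definition ula_kernel :: "(real ^ 'n \<Rightarrow> real ^ 'n) \<Rightarrow> real \<Rightarrow> real ^ 'n \<Rightarrow> (real ^ 'n) measure" where
  "ula_kernel gradU \<gamma> x = multivariate_normal (x - \<gamma> *\<^sub>R gradU x) ((2 * \<gamma>) *\<^sub>R mat 1)"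

definition stationary_distribution ::
    "('a :: topological_space \<Rightarrow> 'a measure) \<Rightarrow> 'a measure \<Rightarrow> bool" where
  "stationary_distribution K \<nu> \<longleftrightarrow>
     prob_space \<nu> \<and> sets \<nu> = sets borel \<and>
     (\<forall>A \<in> sets borel. (\<integral>\<^sup>+ x. emeasure (K x) A \<partial>\<nu>) = emeasure \<nu> A)"

text \<open>Supremum convention: the distance of two probability measures lies between 0 and 1.\<close>

definition tv_dist :: "'a :: topological_space measure \<Rightarrow> 'a measure \<Rightarrow> real" where
  "tv_dist \<mu> \<nu> = (SUP A \<in> sets borel. \<bar>measure \<mu> A - measure \<nu> A\<bar>)"

definition kappa :: "real \<Rightarrow> real \<Rightarrow> real" where
  "kappa m L = 2 * m * L / (m + L)"

definition D1 :: "real \<Rightarrow> real \<Rightarrow> real \<Rightarrow> nat \<Rightarrow> real" where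
  "D1 m L \<gamma> d = 2 * L\<^sup>2 * inverse (kappa m L) * (inverse (kappa m L) + \<gamma>) *
     (2 * real d + L\<^sup>2 * \<gamma>\<^sup>2 / 6)"

definition D2 :: "real \<Rightarrow> real \<Rightarrow> real \<Rightarrow> real" where
  "D2 m L \<gamma> = L ^ 4 * (inverse (kappa m L) + \<gamma>)"

end

theory Submission
  imports Defs
begin

text \<open>The relative entropy of \<open>\<pi>\<^sub>\<gamma>\<close> with respect to the Gibbs measure is bounded by a discrete
  Girsanov argument without any diffusion. One step of size \<open>\<gamma>\<close> is split into \<open>N\<close> substeps of size
  \<open>\<eta> = \<gamma> / N\<close> with frozen drift. They are compared with \<open>N\<close> genuine steps of size \<open>\<eta>\<close>, started from
  the Gibbs measure and steered towards the frozen chain so that both end at the same point; steering by \<open>h\<close>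
  costs relative entropy \<open>\<parallel>h\<parallel>\<^sup>2 / (4 * \<eta>)\<close>. Repeating this over many steps, strong convexity makes old
  errors decay geometrically. As \<open>\<eta> \<rightarrow> 0\<close> the Gibbs measure becomes
  invariant for the steps of size \<open>\<eta>\<close>, because one such step has bias \<open>O(\<eta> powr (3/2))\<close> on Lipschitz functions.
  Pinsker's inequality and AM-GM applied to the two terms of the bound finish the proof.\<close>

text \<open>Entropy is handled by duality alone: for bounded Lipschitz \<open>f\<close>, the chain
  of small steps enters only through the logarithm of its operator power applied to
  \<open>exp f\<close>. A Gaussian shift by \<open>h\<close> and Jensen's inequality turn steering
  into the loss |h|^2 / (4 \<eta>), so the comparison is a dynamic programming inequality, pointwise
  in the starting points of both chains, and no density of the stationary law is needed. The
  obstacle is that small steps do not preserve the Gibbs measure. With n blocks of N substeps the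
  biases add up to a multiple of n N \<eta> sqrt \<eta> = n \<gamma> sqrt \<eta>. So N tends to
  infinity while n is fixed; only then n tends to infinity, which removes the cost O(1 / n) of the
  initial gap between the independent starting points. The bias estimate is what confines
  \<open>f\<close> to Lipschitz functions. AM-GM fits because half the entropy is of order L^2
  \<gamma> d / \<kappa>: up to constants, the product of the leading parts L sqrt(\<gamma> d) and L
  sqrt(\<gamma> d) / \<kappa> of the two terms.\<close>

section \<open>The standard Gaussian measure\<close>

lemma nn_integral_lborel_affine:
  fixes f :: "'a::euclidean_space \<Rightarrow> ennreal"
  assumes [measurable]: "f \<in> borel_measurable borel" and "c \<noteq> 0"
  shows "(\<integral>\<^sup>+x. f x \<partial>lborel) = ennreal (\<bar>c\<bar> ^ DIM('a)) * (\<integral>\<^sup>+x. f (t + c *\<^sub>R x) \<partial>lborel)"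
  by (subst lborel_affine[OF \<open>c \<noteq> 0\<close>, of t])
     (simp add: nn_integral_density nn_integral_distr nn_integral_cmult)

definition gauss_density :: "'a::euclidean_space \<Rightarrow> real" where
  "gauss_density x = exp (- (norm x)\<^sup>2 / 2) / sqrt ((2 * pi) ^ DIM('a))"

definition std_gauss :: "'a::euclidean_space measure" where
  "std_gauss = density lborel (\<lambda>x. ennreal (gauss_density x))"

lemma gauss_density_pos: "gauss_density x > 0"
  by (simp add: gauss_density_def)

lemma gauss_density_measurable [measurable]: "gauss_density \<in> borel_measurable borel"
  unfolding gauss_density_def[abs_def] by measurable

lemma sets_std_gauss [simp, measurable_cong]: "sets std_gauss = sets borel"
  by (simp add: std_gauss_def)

lemma space_std_gauss [simp]: "space std_gauss = UNIV"
  by (simp add: std_gauss_def)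

lemma norm_sq_Basis: "(norm (x::'a::euclidean_space))\<^sup>2 = (\<Sum>b\<in>Basis. (x \<bullet> b)\<^sup>2)"
  unfolding power2_norm_eq_inner euclidean_inner[of x x] by (simp add: power2_eq_square)

lemma gauss_density_prod:
  "gauss_density (x::'a::euclidean_space) = (\<Prod>b\<in>Basis. std_normal_density (x \<bullet> b))"
  unfolding gauss_density_def std_normal_density_def norm_sq_Basis
  by (simp add: prod.distrib exp_sum[symmetric] sum_negf[symmetric] sum_divide_distrib
        real_sqrt_power[symmetric] prod_dividef power_divide power_mult_distrib)

lemma nn_integral_std_gauss:
  "f \<in> borel_measurable borel \<Longrightarrow>
     (\<integral>\<^sup>+w. f w \<partial>std_gauss) = (\<integral>\<^sup>+w. ennreal (gauss_density w) * f w \<partial>lborel)"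
  unfolding std_gauss_def by (subst nn_integral_density) auto

lemma nn_integral_std_normal_density:
  "(\<integral>\<^sup>+x. ennreal (std_normal_density x) \<partial>lborel) = 1"
  using prob_space.emeasure_space_1[OF prob_space_normal_density[of 1 0]]
  by (simp add: emeasure_density)

lemma prob_space_std_gauss: "prob_space (std_gauss :: 'a::euclidean_space measure)"
proof
  have "(\<integral>\<^sup>+x. ennreal (gauss_density x) \<partial>(lborel::'a measure)) =
      (\<integral>\<^sup>+x. (\<Prod>b\<in>Basis. ennreal (std_normal_density (x \<bullet> b))) \<partial>(lborel::'a measure))"
    by (simp add: gauss_density_prod prod_ennreal)
  also have "\<dots> = 1"
    by (subst nn_integral_lborel_prod) (auto simp: nn_integral_std_normal_density)
  finally show "emeasure (std_gauss :: 'a measure) (space std_gauss) = 1"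
    by (simp add: std_gauss_def emeasure_density)
qed

interpretation std_gauss: prob_space "std_gauss :: 'a::euclidean_space measure"
  by (rule prob_space_std_gauss)

lemma nn_integral_gauss_density:
  "(\<integral>\<^sup>+x. ennreal (gauss_density x) \<partial>(lborel::'a::euclidean_space measure)) = 1"
  using std_gauss.emeasure_space_1[where 'a='a] by (simp add: std_gauss_def emeasure_density)

lemma nn_integral_std_gauss_coord:
  assumes b: "b \<in> Basis"
  shows "(\<integral>\<^sup>+w. ennreal ((w \<bullet> b)\<^sup>2) \<partial>(std_gauss :: 'a::euclidean_space measure)) = 1"
proof -
  \<comment> \<open>The square sits in coordinate \<open>b\<close> alone, so the integral factorises
    into one-dimensional ones, each equal to 1.\<close>
  define f where "f c x = ennreal (std_normal_density x) * (if c = b then ennreal (x\<^sup>2) else 1)" for c :: 'a and x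
  have [measurable]: "f c \<in> borel_measurable borel" for c
    unfolding f_def by measurable
  have "(\<integral>\<^sup>+w. ennreal ((w \<bullet> b)\<^sup>2) \<partial>(std_gauss :: 'a measure)) =
     (\<integral>\<^sup>+w. (\<Prod>c\<in>Basis. f c (w \<bullet> c)) \<partial>lborel)"
    using b by (subst nn_integral_std_gauss)
      (auto simp: f_def prod.distrib gauss_density_prod prod_ennreal intro!: nn_integral_cong)
  also have "\<dots> = (\<Prod>c\<in>Basis. (\<integral>\<^sup>+x. f c x \<partial>lborel))"
    by (subst nn_integral_lborel_prod) auto
  also have "\<dots> = (\<Prod>c\<in>(Basis::'a set). 1)"
  proof (rule prod.cong)
    fix c :: 'a
    have "(\<integral>\<^sup>+x. ennreal (std_normal_density x * x\<^sup>2) \<partial>lborel) = 1"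
      using nn_integral_eq_integral[OF integrable.intros[OF normal_moment_even[of 1 0 1]]]
        integral_normal_moment_even[of 1 0 1] by (simp add: fact_numeral)
    then show "(\<integral>\<^sup>+x. f c x \<partial>lborel) = 1"
      by (cases "c = b") (simp_all add: f_def nn_integral_std_normal_density ennreal_mult)
  qed simp
  finally show ?thesis by simp
qed

lemma nn_integral_std_gauss_norm_sq:
  "(\<integral>\<^sup>+w. ennreal ((norm w)\<^sup>2) \<partial>(std_gauss :: 'a::euclidean_space measure)) = ennreal (real DIM('a))"
proof -
  have "(\<integral>\<^sup>+w. ennreal ((norm w)\<^sup>2) \<partial>(std_gauss :: 'a measure)) =
      (\<integral>\<^sup>+w. (\<Sum>b\<in>Basis. ennreal ((w \<bullet> b)\<^sup>2)) \<partial>(std_gauss :: 'a measure))"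
    by (intro nn_integral_cong) (simp add: norm_sq_Basis)
  also have "\<dots> = (\<Sum>b\<in>Basis. (\<integral>\<^sup>+w. ennreal ((w \<bullet> b)\<^sup>2) \<partial>(std_gauss :: 'a measure)))"
    by (intro nn_integral_sum) auto
  also have "\<dots> = ennreal (real DIM('a))"
    by (simp add: nn_integral_std_gauss_coord ennreal_of_nat_eq_real_of_nat)
  finally show ?thesis .
qed

lemma std_gauss_norm_sq:
  "integrable (std_gauss :: 'a::euclidean_space measure) (\<lambda>w. (norm w)\<^sup>2)"
  "(\<integral>w. (norm w)\<^sup>2 \<partial>(std_gauss :: 'a measure)) = real DIM('a)"
proof -
  show "integrable (std_gauss :: 'a measure) (\<lambda>w. (norm w)\<^sup>2)"
    by (rule integrableI_nonneg) (auto simp: nn_integral_std_gauss_norm_sq)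
  show "(\<integral>w. (norm w)\<^sup>2 \<partial>(std_gauss :: 'a measure)) = real DIM('a)"
    by (subst integral_eq_nn_integral) (auto simp: nn_integral_std_gauss_norm_sq)
qed

lemma nn_integral_exp_norm_sq_finite:
  assumes a: "a > 0"
  shows "(\<integral>\<^sup>+x. ennreal (exp (- a * (norm (x::'a::euclidean_space))\<^sup>2)) \<partial>lborel) < \<infinity>"
proof -
  \<comment> \<open>The scale that turns the exponent into that of the standard Gaussian.\<close>
  define c where "c = 1 / sqrt (2 * a)"
  have c: "c > 0" "a * c\<^sup>2 = 1 / 2" using a by (auto simp: c_def power_divide)
  have e: "exp (- (a * (norm (c *\<^sub>R x))\<^sup>2)) = sqrt ((2 * pi) ^ DIM('a)) * gauss_density x" for x :: 'a
    using c by (simp add: gauss_density_def power_mult_distrib mult.assoc[symmetric])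
  have "(\<integral>\<^sup>+x. ennreal (exp (- a * (norm (x::'a))\<^sup>2)) \<partial>lborel) =
     ennreal (\<bar>c\<bar> ^ DIM('a)) * (\<integral>\<^sup>+x. ennreal (exp (- a * (norm (0 + c *\<^sub>R (x::'a)))\<^sup>2)) \<partial>lborel)"
    using c by (intro nn_integral_lborel_affine) auto
  also have "\<dots> = ennreal (\<bar>c\<bar> ^ DIM('a)) * (ennreal (sqrt ((2 * pi) ^ DIM('a))) *
      (\<integral>\<^sup>+x. ennreal (gauss_density x) \<partial>(lborel::'a measure)))"
    by (subst nn_integral_cmult[symmetric])
       (auto simp: e ennreal_mult less_imp_le[OF gauss_density_pos] simp del: norm_scaleR)
  also have "\<dots> < \<infinity>"
    by (simp add: nn_integral_gauss_density ennreal_mult_less_top)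
  finally show ?thesis .
qed

lemma power_le_fact_exp:
  fixes t :: real assumes "t \<ge> 0" shows "t ^ k \<le> fact k * exp t"
proof -
  have "t ^ k /\<^sub>R fact k = (\<Sum>n\<in>{k}. t ^ n /\<^sub>R fact n)" by simp
  also have "\<dots> \<le> (\<Sum>n. t ^ n /\<^sub>R fact n)"
    using assms by (intro sum_le_suminf summable_exp_generic) auto
  also have "\<dots> = exp t" by (simp add: exp_def)
  finally show ?thesis by (simp add: field_simps)
qed

text \<open>Half of the Gaussian exponent pays for the polynomial: t^k <= k! exp t, and completing
  the square gives t - a t^2 <= 1 / (2 a) - (a / 2) t^2.\<close>

lemma integrable_norm_power_exp:
  assumes a: "a > 0"
  shows "integrable lborel (\<lambda>x::'a::euclidean_space. norm x ^ k * exp (- a * (norm x)\<^sup>2))"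
proof (rule Bochner_Integration.integrable_bound)
  show "integrable lborel (\<lambda>x::'a. fact k * exp (1 / (2 * a)) * exp (- (a / 2) * (norm x)\<^sup>2))"
    using nn_integral_exp_norm_sq_finite[of "a / 2", where 'a='a] a
    by (intro integrable_mult_right integrableI_nonneg) auto
  show "AE x::'a in lborel. norm (norm x ^ k * exp (- a * (norm x)\<^sup>2))
      \<le> norm (fact k * exp (1 / (2 * a)) * exp (- (a / 2) * (norm x)\<^sup>2))"
  proof (intro AE_I2)
    fix x :: 'a
    have "0 \<le> (a * norm x - 1)\<^sup>2 / (2 * a)" using a by simp
    also have "\<dots> = a / 2 * (norm x)\<^sup>2 - norm x + 1 / (2 * a)"
      using a by (simp add: field_simps power2_eq_square)
    finally have "norm x - a * (norm x)\<^sup>2 \<le> 1 / (2 * a) - (a / 2) * (norm x)\<^sup>2" by simp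
    then have "exp (norm x) * exp (- a * (norm x)\<^sup>2) \<le> exp (1 / (2 * a)) * exp (- (a / 2) * (norm x)\<^sup>2)"
      by (simp add: exp_add[symmetric])
    then have "fact k * (exp (norm x) * exp (- a * (norm x)\<^sup>2)) \<le>
        fact k * (exp (1 / (2 * a)) * exp (- (a / 2) * (norm x)\<^sup>2))"
      by (intro mult_left_mono) auto
    moreover have "norm x ^ k * exp (- a * (norm x)\<^sup>2) \<le> fact k * (exp (norm x) * exp (- a * (norm x)\<^sup>2))"
      unfolding mult.assoc[symmetric] by (intro mult_right_mono power_le_fact_exp) auto
    ultimately have "norm x ^ k * exp (- a * (norm x)\<^sup>2) \<le>
        fact k * (exp (1 / (2 * a)) * exp (- (a / 2) * (norm x)\<^sup>2))" by (rule order_trans[rotated])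
    from this show "norm (norm x ^ k * exp (- a * (norm x)\<^sup>2))
      \<le> norm (fact k * exp (1 / (2 * a)) * exp (- (a / 2) * (norm x)\<^sup>2))"
      by (simp add: abs_mult mult.assoc del: mult_le_cancel_left mult_le_cancel_left_pos)
  qed
qed measurable

lemma integrable_std_gauss_norm_power:
  "integrable (std_gauss :: 'a::euclidean_space measure) (\<lambda>w. norm w ^ k)"
proof -
  have "integrable lborel (\<lambda>x::'a. (1 / sqrt ((2 * pi) ^ DIM('a))) * (norm x ^ k * exp (- (1/2) * (norm x)\<^sup>2)))"
    by (intro integrable_mult_right integrable_norm_power_exp) simp
  then show ?thesis
    unfolding std_gauss_def
    by (subst integrable_density)
       (auto simp: less_imp_le[OF gauss_density_pos] gauss_density_def mult.commute)
qed

lemma std_gauss_uminus: "distr std_gauss borel uminus = (std_gauss :: 'a::euclidean_space measure)"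
proof (rule measure_eqI)
  fix A assume "A \<in> sets (distr std_gauss borel uminus :: 'a measure)"
  then have [measurable]: "A \<in> sets borel" by simp
  have "emeasure (distr std_gauss borel uminus) A = (\<integral>\<^sup>+w. indicator A (- w) \<partial>(std_gauss :: 'a measure))"
    by (subst nn_integral_indicator[symmetric], simp, subst nn_integral_distr) auto
  also have "\<dots> = (\<integral>\<^sup>+w. ennreal (gauss_density w) * indicator A (- w) \<partial>lborel)"
    by (subst nn_integral_std_gauss) auto
  also have "\<dots> = (\<integral>\<^sup>+w. ennreal (gauss_density w) * indicator A w \<partial>lborel)"
    by (subst nn_integral_lborel_affine[of _ "-1" 0]) (auto simp: gauss_density_def)
  also have "\<dots> = emeasure std_gauss A"
    by (subst nn_integral_std_gauss[symmetric]) auto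
  finally show "emeasure (distr std_gauss borel uminus) A = emeasure std_gauss A" .
qed simp

lemma std_gauss_inner:
  "integrable (std_gauss :: 'a::euclidean_space measure) (\<lambda>w. w \<bullet> a)"
  "(\<integral>w. w \<bullet> a \<partial>(std_gauss :: 'a measure)) = 0"
proof -
  show "integrable (std_gauss :: 'a measure) (\<lambda>w. w \<bullet> a)"
  proof (rule Bochner_Integration.integrable_bound)
    show "integrable (std_gauss :: 'a measure) (\<lambda>w. norm w ^ 1 * norm a)"
      by (intro integrable_mult_left integrable_std_gauss_norm_power)
    show "AE w in std_gauss. norm (w \<bullet> a) \<le> norm (norm w ^ 1 * norm a)"
      using Cauchy_Schwarz_ineq2 by (intro AE_I2) auto
  qed measurable
  have "(\<integral>w. w \<bullet> a \<partial>(std_gauss :: 'a measure)) = (\<integral>w. w \<bullet> a \<partial>(distr std_gauss borel uminus :: 'a measure))"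
    by (simp add: std_gauss_uminus)
  also have "\<dots> = - (\<integral>w. w \<bullet> a \<partial>(std_gauss :: 'a measure))"
    by (subst integral_distr) auto
  finally show "(\<integral>w. w \<bullet> a \<partial>(std_gauss :: 'a measure)) = 0" by simp
qed

text \<open>For independent standard Gaussians w, w' and y = \<sigma> w + \<tau> w', both sides are,
  up to normalisation, the joint density of (w, y): on the left the law of w times that of y given
  w, on the right the law of y, with standard deviation \<rho>, times that of w given y, with mean
  (\<sigma> / \<rho>^2) y and standard deviation \<tau> / \<rho>.\<close>

lemma gauss_density_complete_square:
  fixes w y :: "'a::euclidean_space"
  assumes "\<tau> \<noteq> 0" and r: "\<rho> \<noteq> 0" "\<rho>\<^sup>2 = \<sigma>\<^sup>2 + \<tau>\<^sup>2"
  shows "gauss_density w * gauss_density ((1 / \<tau>) *\<^sub>R (y - \<sigma> *\<^sub>R w)) =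
    gauss_density ((1 / \<rho>) *\<^sub>R y) * gauss_density ((\<rho> / \<tau>) *\<^sub>R (w - (\<sigma> / \<rho>\<^sup>2) *\<^sub>R y))"
proof -
  have n: "(norm (a - b))\<^sup>2 = (norm a)\<^sup>2 - 2 * (a \<bullet> b) + (norm b)\<^sup>2" for a b :: 'a
    by (simp add: dot_square_norm[symmetric] inner_diff inner_commute)
  have rr: "\<sigma>\<^sup>2 = \<rho>\<^sup>2 - \<tau>\<^sup>2" using r by simp
  have "(norm w)\<^sup>2 + (norm ((1 / \<tau>) *\<^sub>R (y - \<sigma> *\<^sub>R w)))\<^sup>2 =
      (norm w)\<^sup>2 + (1 / \<tau>)\<^sup>2 * ((norm y)\<^sup>2 - 2 * \<sigma> * (w \<bullet> y) + \<sigma>\<^sup>2 * (norm w)\<^sup>2)"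
    by (simp add: n power_mult_distrib power_divide inner_commute)
  also have "\<dots> = (1 / \<rho>)\<^sup>2 * (norm y)\<^sup>2 +
      (\<rho> / \<tau>)\<^sup>2 * ((norm w)\<^sup>2 - 2 * (\<sigma> / \<rho>\<^sup>2) * (w \<bullet> y) + (\<sigma> / \<rho>\<^sup>2)\<^sup>2 * (norm y)\<^sup>2)"
  proof -
    have "a + 1 / T * (b - 2 * \<sigma> * c + S * a) = 1 / R * b + R / T * (a - 2 * (\<sigma> / R) * c + S / R\<^sup>2 * b)"
      if "T \<noteq> 0" "R \<noteq> 0" "R = S + T" for a b c S T R :: real
    proof -
      have e1: "a + 1 / T * (b - 2 * \<sigma> * c + S * a) = a * ((S + T) / T) + b / T - 2 * \<sigma> * c / T"
        using that(1) by (simp add: field_simps)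
      have e2: "1 / R * b + R / T * (a - 2 * (\<sigma> / R) * c + S / R\<^sup>2 * b)
         = a * (R / T) + b * ((T + S) / (R * T)) - 2 * \<sigma> * c / T"
        using that(1,2) by (simp add: field_simps power2_eq_square)
      have "(T + S) / (R * T) = 1 / T" using that by (simp add: add.commute)
      then show ?thesis unfolding e1 e2 using that(3) by simp
    qed
    from this[of "\<tau>\<^sup>2" "\<rho>\<^sup>2" "\<sigma>\<^sup>2"] show ?thesis
      using assms by (simp add: power_divide)
  qed
  also have "\<dots> = (norm ((1 / \<rho>) *\<^sub>R y))\<^sup>2 + (norm ((\<rho> / \<tau>) *\<^sub>R (w - (\<sigma> / \<rho>\<^sup>2) *\<^sub>R y)))\<^sup>2"
    by (simp add: n power_mult_distrib power_divide)
  finally have "- (norm w)\<^sup>2 / 2 + - (norm ((1 / \<tau>) *\<^sub>R (y - \<sigma> *\<^sub>R w)))\<^sup>2 / 2 =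
     - (norm ((1 / \<rho>) *\<^sub>R y))\<^sup>2 / 2 + - (norm ((\<rho> / \<tau>) *\<^sub>R (w - (\<sigma> / \<rho>\<^sup>2) *\<^sub>R y)))\<^sup>2 / 2"
    by (simp add: field_simps)
  then show ?thesis
    unfolding gauss_density_def times_divide_times_eq exp_add[symmetric] by simp
qed

lemma nn_integral_gauss_density_affine:
  fixes t :: "'a::euclidean_space"
  assumes "c > 0"
  shows "(\<integral>\<^sup>+w. ennreal (gauss_density (c *\<^sub>R (w - t))) \<partial>lborel) = ennreal ((1 / c) ^ DIM('a))"
  by (subst nn_integral_lborel_affine[of _ "1 / c" t])
     (use assms in \<open>auto simp: nn_integral_gauss_density\<close>)

lemma nn_integral_std_gauss_scaled:
  fixes f :: "'a::euclidean_space \<Rightarrow> ennreal"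
  assumes [measurable]: "f \<in> borel_measurable borel" and "\<sigma> > 0"
  shows "(\<integral>\<^sup>+w. f (t + \<sigma> *\<^sub>R w) \<partial>std_gauss) =
    ennreal ((1 / \<sigma>) ^ DIM('a)) * (\<integral>\<^sup>+y. ennreal (gauss_density ((1 / \<sigma>) *\<^sub>R (y - t))) * f y \<partial>lborel)"
proof -
  have "(\<integral>\<^sup>+w. f (t + \<sigma> *\<^sub>R w) \<partial>std_gauss) = (\<integral>\<^sup>+w. ennreal (gauss_density w) * f (t + \<sigma> *\<^sub>R w) \<partial>lborel)"
    by (subst nn_integral_std_gauss) auto
  also have "\<dots> = ennreal ((1 / \<sigma>) ^ DIM('a)) * (\<integral>\<^sup>+y. ennreal (gauss_density ((1 / \<sigma>) *\<^sub>R (y - t))) * f y \<partial>lborel)"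
    using assms(2)
    by (subst nn_integral_lborel_affine[of _ "1 / \<sigma>" "- (1 / \<sigma>) *\<^sub>R t"])
       (auto simp: scaleR_add_right scaleR_diff_right algebra_simps)
  finally show ?thesis .
qed

text \<open>After Fubini the completed square separates \<open>w\<close> from \<open>y\<close>.
  Integrating \<open>w\<close> out leaves (\<tau> / \<rho>)^d, which turns the prefactor (1 /
  \<tau>)^d into (1 / \<rho>)^d.\<close>

lemma nn_integral_std_gauss_convolution:
  fixes f :: "'a::euclidean_space \<Rightarrow> ennreal"
  assumes [measurable]: "f \<in> borel_measurable borel" and pos: "\<sigma> > 0" "\<tau> > 0"
  shows "(\<integral>\<^sup>+w. \<integral>\<^sup>+w'. f (t + \<sigma> *\<^sub>R w + \<tau> *\<^sub>R w') \<partial>std_gauss \<partial>std_gauss) =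
    (\<integral>\<^sup>+w. f (t + sqrt (\<sigma>\<^sup>2 + \<tau>\<^sup>2) *\<^sub>R w) \<partial>std_gauss)"
proof -
  define \<rho> where "\<rho> = sqrt (\<sigma>\<^sup>2 + \<tau>\<^sup>2)"
  have r: "\<rho> > 0" "\<rho>\<^sup>2 = \<sigma>\<^sup>2 + \<tau>\<^sup>2" using pos by (auto simp: \<rho>_def add_pos_pos)
  have "(\<integral>\<^sup>+w. \<integral>\<^sup>+w'. f (t + \<sigma> *\<^sub>R w + \<tau> *\<^sub>R w') \<partial>std_gauss \<partial>std_gauss) =
    (\<integral>\<^sup>+w. ennreal ((1 / \<tau>) ^ DIM('a)) *
       (\<integral>\<^sup>+y. ennreal (gauss_density ((1 / \<tau>) *\<^sub>R (y - (t + \<sigma> *\<^sub>R w)))) * f y \<partial>lborel) \<partial>std_gauss)"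
    using pos by (subst nn_integral_std_gauss_scaled) auto
  also have "\<dots> = ennreal ((1 / \<tau>) ^ DIM('a)) * (\<integral>\<^sup>+w. \<integral>\<^sup>+y. ennreal (gauss_density w) *
       (ennreal (gauss_density ((1 / \<tau>) *\<^sub>R (y - (t + \<sigma> *\<^sub>R w)))) * f y) \<partial>lborel \<partial>lborel)"
    by (subst nn_integral_cmult, simp, subst nn_integral_std_gauss) (auto simp: nn_integral_cmult)
  also have "\<dots> = ennreal ((1 / \<tau>) ^ DIM('a)) * (\<integral>\<^sup>+y. \<integral>\<^sup>+w. ennreal (gauss_density w) *
       (ennreal (gauss_density ((1 / \<tau>) *\<^sub>R (y - (t + \<sigma> *\<^sub>R w)))) * f y) \<partial>lborel \<partial>lborel)"
    by (subst lborel_pair.Fubini') auto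
  also have "(\<lambda>y. \<integral>\<^sup>+w. ennreal (gauss_density w) *
       (ennreal (gauss_density ((1 / \<tau>) *\<^sub>R (y - (t + \<sigma> *\<^sub>R w)))) * f y) \<partial>lborel) =
     (\<lambda>y. (ennreal (gauss_density ((1 / \<rho>) *\<^sub>R (y - t))) * f y) * ennreal ((\<tau> / \<rho>) ^ DIM('a)))"
  proof
    fix y :: 'a
    have "gauss_density w * gauss_density ((1 / \<tau>) *\<^sub>R (y - (t + \<sigma> *\<^sub>R w))) =
       gauss_density ((1 / \<rho>) *\<^sub>R (y - t)) * gauss_density ((\<rho> / \<tau>) *\<^sub>R (w - (\<sigma> / \<rho>\<^sup>2) *\<^sub>R (y - t)))" for w
      using gauss_density_complete_square[of \<tau> \<rho> \<sigma> w "y - t"] pos r by (simp add: diff_diff_eq)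
    then have "ennreal (gauss_density w) * (ennreal (gauss_density ((1 / \<tau>) *\<^sub>R (y - (t + \<sigma> *\<^sub>R w)))) * f y) =
       (ennreal (gauss_density ((1 / \<rho>) *\<^sub>R (y - t))) * f y) *
       ennreal (gauss_density ((\<rho> / \<tau>) *\<^sub>R (w - (\<sigma> / \<rho>\<^sup>2) *\<^sub>R (y - t))))" for w
      by (simp add: mult.assoc[symmetric] ennreal_mult'[symmetric] less_imp_le[OF gauss_density_pos])
         (simp add: ennreal_mult'' less_imp_le[OF gauss_density_pos] ac_simps)
    then show "(\<integral>\<^sup>+w. ennreal (gauss_density w) *
       (ennreal (gauss_density ((1 / \<tau>) *\<^sub>R (y - (t + \<sigma> *\<^sub>R w)))) * f y) \<partial>lborel) =
       (ennreal (gauss_density ((1 / \<rho>) *\<^sub>R (y - t))) * f y) * ennreal ((\<tau> / \<rho>) ^ DIM('a))"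
      using pos r by (simp add: nn_integral_cmult nn_integral_gauss_density_affine)
  qed
  also have "ennreal ((1 / \<tau>) ^ DIM('a)) * (\<integral>\<^sup>+y. (ennreal (gauss_density ((1 / \<rho>) *\<^sub>R (y - t))) * f y) *
      ennreal ((\<tau> / \<rho>) ^ DIM('a)) \<partial>lborel) =
     ennreal ((1 / \<rho>) ^ DIM('a)) * (\<integral>\<^sup>+y. ennreal (gauss_density ((1 / \<rho>) *\<^sub>R (y - t))) * f y \<partial>lborel)"
    using pos r by (subst nn_integral_multc, simp)
      (simp add: ac_simps ennreal_mult''[symmetric] mult.assoc[symmetric] power_mult_distrib[symmetric])
  also have "\<dots> = (\<integral>\<^sup>+w. f (t + \<rho> *\<^sub>R w) \<partial>std_gauss)"
    using r by (subst nn_integral_std_gauss_scaled) auto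
  finally show ?thesis unfolding \<rho>_def .
qed

text \<open>Cameron-Martin formula: the exponential is the ratio of the Gaussian densities at
  \<open>w + a\<close> and \<open>w\<close>.\<close>

lemma nn_integral_std_gauss_translate:
  fixes f :: "'a::euclidean_space \<Rightarrow> ennreal"
  assumes [measurable]: "f \<in> borel_measurable borel"
  shows "(\<integral>\<^sup>+w. f w \<partial>std_gauss) =
    (\<integral>\<^sup>+w. ennreal (exp (- (w \<bullet> a) - (norm a)\<^sup>2 / 2)) * f (w + a) \<partial>std_gauss)"
proof -
  have n: "gauss_density (w + a) = gauss_density w * exp (- (w \<bullet> a) - (norm a)\<^sup>2 / 2)" for w
  proof -
    have "- (norm (w + a))\<^sup>2 / 2 = - (norm w)\<^sup>2 / 2 + (- (w \<bullet> a) - (norm a)\<^sup>2 / 2)"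
      by (simp add: power2_norm_eq_inner inner_add inner_commute field_simps)
    then show ?thesis unfolding gauss_density_def by (simp only: exp_add) simp
  qed
  have "(\<integral>\<^sup>+w. f w \<partial>std_gauss) = (\<integral>\<^sup>+w. ennreal (gauss_density w) * f w \<partial>lborel)"
    by (subst nn_integral_std_gauss) auto
  also have "\<dots> = (\<integral>\<^sup>+w. ennreal (gauss_density w) * (ennreal (exp (- (w \<bullet> a) - (norm a)\<^sup>2 / 2)) * f (w + a)) \<partial>lborel)"
    by (subst nn_integral_lborel_affine[of _ 1 a])
       (auto simp: n ennreal_mult less_imp_le[OF gauss_density_pos] mult.assoc add.commute[of a])
  also have "\<dots> = (\<integral>\<^sup>+w. ennreal (exp (- (w \<bullet> a) - (norm a)\<^sup>2 / 2)) * f (w + a) \<partial>std_gauss)"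
    by (subst nn_integral_std_gauss) auto
  finally show ?thesis .
qed

section \<open>The heat semigroup\<close>

text \<open>Time \<open>s\<close> means covariance 2 s I, as in the kernel, so that a Langevin step
  of size \<gamma> is a gradient step followed by \<open>heat \<gamma>\<close>.\<close>

definition heat :: "real \<Rightarrow> ('a::euclidean_space \<Rightarrow> real) \<Rightarrow> 'a \<Rightarrow> real" where
  "heat s \<phi> y = (\<integral>w. \<phi> (y + sqrt (2 * s) *\<^sub>R w) \<partial>std_gauss)"

text \<open>One class of test functions settles all integrability questions: it contains
  \<open>U\<close> and the squared norm of \<open>gradU\<close>, is stable under \<open>heat\<close>
  and under Langevin steps, and its members are integrable against Gaussians and, by the Lyapunov
  argument below, against the stationary law.\<close>

definition quad_growth :: "('a::euclidean_space \<Rightarrow> real) \<Rightarrow> bool" where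
  "quad_growth \<phi> \<longleftrightarrow> \<phi> \<in> borel_measurable borel \<and> (\<exists>C. \<forall>x. \<bar>\<phi> x\<bar> \<le> C * (1 + (norm x)\<^sup>2))"

lemma quad_growthI:
  assumes "\<phi> \<in> borel_measurable borel" "\<And>x. \<bar>\<phi> x\<bar> \<le> C * (1 + (norm x)\<^sup>2)"
  shows "quad_growth \<phi>"
  using assms unfolding quad_growth_def by blast

lemma quad_growthE:
  assumes "quad_growth \<phi>"
  obtains C where "\<phi> \<in> borel_measurable borel" "C \<ge> 0" "\<And>x. \<bar>\<phi> x\<bar> \<le> C * (1 + (norm x)\<^sup>2)"
proof -
  from assms obtain C where C: "\<phi> \<in> borel_measurable borel" "\<forall>x. \<bar>\<phi> x\<bar> \<le> C * (1 + (norm x)\<^sup>2)"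
    unfolding quad_growth_def by blast
  from C(2)[rule_format, of 0] have "C \<ge> 0" by simp
  with C that show ?thesis by blast
qed

lemma quad_growth_measurable: "quad_growth \<phi> \<Longrightarrow> \<phi> \<in> borel_measurable borel"
  by (simp add: quad_growth_def)

lemma quad_growth_add:
  assumes "quad_growth f" "quad_growth g"
  shows "quad_growth (\<lambda>x. f x + g x)"
proof -
  obtain C where C: "f \<in> borel_measurable borel" "\<And>x. \<bar>f x\<bar> \<le> C * (1 + (norm x)\<^sup>2)"
    using assms(1) by (rule quad_growthE) blast
  obtain D where D: "g \<in> borel_measurable borel" "\<And>x. \<bar>g x\<bar> \<le> D * (1 + (norm x)\<^sup>2)"
    using assms(2) by (rule quad_growthE) blast
  show ?thesis
  proof (rule quad_growthI[of _ "C + D"])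
    show "\<bar>f x + g x\<bar> \<le> (C + D) * (1 + (norm x)\<^sup>2)" for x
      using C(2)[of x] D(2)[of x] by (simp add: distrib_right abs_le_iff)
  qed (use C(1) D(1) in measurable)
qed

lemma quad_growth_cmult:
  assumes "quad_growth f"
  shows "quad_growth (\<lambda>x. c * f x)"
proof -
  obtain C where C: "f \<in> borel_measurable borel" "\<And>x. \<bar>f x\<bar> \<le> C * (1 + (norm x)\<^sup>2)"
    using assms(1) by (rule quad_growthE) blast
  show ?thesis
  proof (rule quad_growthI[of _ "\<bar>c\<bar> * C"])
    show "\<bar>c * f x\<bar> \<le> \<bar>c\<bar> * C * (1 + (norm x)\<^sup>2)" for x
      using C(2)[of x] by (simp add: abs_mult mult.assoc mult_left_mono)
  qed (use C(1) in measurable)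
qed

lemma quad_growth_diff: "quad_growth f \<Longrightarrow> quad_growth g \<Longrightarrow> quad_growth (\<lambda>x. f x - g x)"
  using quad_growth_add[of f "\<lambda>x. (-1) * g x"] quad_growth_cmult[of g "-1"] by simp

lemma quad_growth_sum: "(\<And>i. i \<in> I \<Longrightarrow> quad_growth (f i)) \<Longrightarrow> quad_growth (\<lambda>x. \<Sum>i\<in>I. f i x)"
proof (induction I rule: infinite_finite_induct)
  case (insert i I)
  then show ?case by (auto intro: quad_growth_add)
qed (auto intro: quad_growthI[of _ 0])

lemma quad_growth_norm_sq: "quad_growth (\<lambda>x. (norm x)\<^sup>2)"
  by (rule quad_growthI[of _ 1]) auto

lemma quad_growth_bounded: "f \<in> borel_measurable borel \<Longrightarrow> (\<And>x. \<bar>f x\<bar> \<le> B) \<Longrightarrow> quad_growth f"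
proof (rule quad_growthI[of _ B])
  fix x assume *: "\<And>x. \<bar>f x\<bar> \<le> B"
  have "B \<ge> 0" using *[of x] by linarith
  then show "\<bar>f x\<bar> \<le> B * (1 + (norm x)\<^sup>2)"
    using *[of x] mult_left_mono[of 1 "1 + (norm x)\<^sup>2" B] by auto
qed

lemma quad_growth_const: "quad_growth (\<lambda>x. c)"
  by (rule quad_growth_bounded[of _ "\<bar>c\<bar>"]) auto

lemma quad_growth_dominated:
  assumes "f \<in> borel_measurable borel" "quad_growth g" "\<And>x. \<bar>f x\<bar> \<le> g x"
  shows "quad_growth f"
proof -
  obtain C where C: "\<And>x. \<bar>g x\<bar> \<le> C * (1 + (norm x)\<^sup>2)"
    using assms(2) by (rule quad_growthE) blast
  show ?thesis
    using assms(1,3) C by (intro quad_growthI[of _ C]) (auto intro: order_trans[OF _ order_trans[OF abs_ge_self]])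
qed

lemma power2_norm_add_le: "(norm (a + b))\<^sup>2 \<le> 2 * (norm a)\<^sup>2 + 2 * (norm (b::'a::real_inner))\<^sup>2"
proof -
  have "0 \<le> (norm (a - b))\<^sup>2" by simp
  then show ?thesis
    by (simp add: power2_norm_eq_inner inner_add inner_diff inner_commute)
qed

lemma quad_growth_compose:
  assumes "quad_growth \<phi>" "A \<in> borel_measurable borel" "\<And>x. norm (A x) \<le> c * (1 + norm x)"
  shows "quad_growth (\<lambda>x. \<phi> (A x))"
proof -
  obtain C where C: "\<phi> \<in> borel_measurable borel" "C \<ge> 0" "\<And>x. \<bar>\<phi> x\<bar> \<le> C * (1 + (norm x)\<^sup>2)"
    using assms(1) by (rule quad_growthE) blast
  show ?thesis
  proof (rule quad_growth_dominated)
    show "quad_growth (\<lambda>x. C * (1 + c\<^sup>2 * (2 * 1 + 2 * (norm x)\<^sup>2)))"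
      by (intro quad_growth_add quad_growth_cmult quad_growth_const quad_growth_norm_sq)
    fix x
    have "(norm (A x))\<^sup>2 \<le> (c * (1 + norm x))\<^sup>2"
      using assms(3) by (intro power_mono) auto
    also have "(1 + norm x)\<^sup>2 \<le> 2 * 1 + 2 * (norm x)\<^sup>2"
      using power2_norm_add_le[of 1 "norm x"] by simp
    then have "(c * (1 + norm x))\<^sup>2 \<le> c\<^sup>2 * (2 * 1 + 2 * (norm x)\<^sup>2)"
      by (simp add: power_mult_distrib mult_left_mono)
    finally have "C * (1 + (norm (A x))\<^sup>2) \<le> C * (1 + c\<^sup>2 * (2 * 1 + 2 * (norm x)\<^sup>2))"
      using C(2) by (intro mult_left_mono) auto
    with C(3)[of "A x"] show "\<bar>\<phi> (A x)\<bar> \<le> C * (1 + c\<^sup>2 * (2 * 1 + 2 * (norm x)\<^sup>2))" by linarith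
  qed (use C(1) assms(2) in measurable)
qed

lemma quad_growth_shift:
  assumes "quad_growth \<phi>"
  shows "quad_growth (\<lambda>x. \<phi> (x + c))"
proof (rule quad_growth_compose[OF assms, where c = "1 + norm c"])
  show "norm (x + c) \<le> (1 + norm c) * (1 + norm x)" for x
    using norm_triangle_ineq[of x c] mult_nonneg_nonneg[OF norm_ge_zero[of c] norm_ge_zero[of x]]
    unfolding distrib_left distrib_right by (simp only: mult_1 mult_1_right norm_scaleR)
qed auto

lemma quad_growth_shift': "quad_growth \<phi> \<Longrightarrow> quad_growth (\<lambda>x. \<phi> (x - c))"
  using quad_growth_shift[of \<phi> "- c"] by simp

lemma quad_growth_integrable:
  assumes "quad_growth \<phi>"
  shows "integrable std_gauss (\<lambda>w. \<phi> (y + c *\<^sub>R w))"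
proof -
  have "quad_growth (\<lambda>w. \<phi> (y + c *\<^sub>R w))"
  proof (rule quad_growth_compose[OF assms, where c = "\<bar>c\<bar> + norm y"])
    show "norm (y + c *\<^sub>R x) \<le> (\<bar>c\<bar> + norm y) * (1 + norm x)" for x
      using norm_triangle_ineq[of y "c *\<^sub>R x"] mult_nonneg_nonneg[OF norm_ge_zero[of y] norm_ge_zero[of x]]
        abs_ge_zero[of c]
      unfolding distrib_left distrib_right by (simp only: mult_1 mult_1_right norm_scaleR)
  qed auto
  then obtain C where C: "(\<lambda>w. \<phi> (y + c *\<^sub>R w)) \<in> borel_measurable borel"
      "\<And>w. \<bar>\<phi> (y + c *\<^sub>R w)\<bar> \<le> C * (1 + (norm w)\<^sup>2)"
    by (rule quad_growthE) blast
  have "integrable std_gauss (\<lambda>w::'a. C * (1 + (norm w)\<^sup>2))"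
    by (intro integrable_mult_right Bochner_Integration.integrable_add std_gauss_norm_sq(1)) simp
  then show ?thesis
    by (rule Bochner_Integration.integrable_bound)
       (use C in \<open>auto intro!: AE_I2 intro: order_trans[OF _ abs_ge_self]\<close>)
qed

lemma heat_measurable [measurable]:
  assumes [measurable]: "\<phi> \<in> borel_measurable borel"
  shows "heat s \<phi> \<in> borel_measurable borel"
  unfolding heat_def[abs_def] by measurable

lemma heat_mono:
  assumes "quad_growth \<phi>" "quad_growth \<psi>" "\<And>x. \<phi> x \<le> \<psi> x"
  shows "heat s \<phi> y \<le> heat s \<psi> y"
  unfolding heat_def using assms by (intro integral_mono quad_growth_integrable) auto

lemma heat_add:
  assumes "quad_growth \<phi>" "quad_growth \<psi>"
  shows "heat s (\<lambda>x. \<phi> x + \<psi> x) y = heat s \<phi> y + heat s \<psi> y"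
  unfolding heat_def using assms by (intro Bochner_Integration.integral_add quad_growth_integrable)

lemma heat_diff:
  assumes "quad_growth \<phi>" "quad_growth \<psi>"
  shows "heat s (\<lambda>x. \<phi> x - \<psi> x) y = heat s \<phi> y - heat s \<psi> y"
  unfolding heat_def using assms by (intro Bochner_Integration.integral_diff quad_growth_integrable)

lemma heat_cmult: "heat s (\<lambda>x. c * \<phi> x) y = c * heat s \<phi> y"
  unfolding heat_def by simp

lemma heat_sum:
  assumes "\<And>i. i \<in> I \<Longrightarrow> quad_growth (\<phi> i)"
  shows "heat s (\<lambda>x. \<Sum>i\<in>I. \<phi> i x) y = (\<Sum>i\<in>I. heat s (\<phi> i) y)"
  unfolding heat_def using assms by (intro Bochner_Integration.integral_sum quad_growth_integrable) auto

lemma measure_std_gauss_UNIV [simp]: "measure (std_gauss :: 'a::euclidean_space measure) UNIV = 1"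
  using std_gauss.prob_space[where 'a='a] by simp

lemma heat_const: "heat s (\<lambda>x. c) y = c"
  unfolding heat_def by simp

lemma heat_0: "heat 0 \<phi> y = \<phi> y"
  unfolding heat_def by simp

lemma heat_shift: "heat s (\<lambda>x. \<phi> (x + c)) y = heat s \<phi> (y + c)"
  unfolding heat_def by (simp add: ac_simps)

lemma heat_norm_sq:
  assumes "s \<ge> 0"
  shows "heat s (\<lambda>x. (norm (x - c))\<^sup>2) (y::'a::euclidean_space) = (norm (y - c))\<^sup>2 + 2 * s * real DIM('a)"
proof -
  have e: "(norm (y + sqrt (2 * s) *\<^sub>R w - c))\<^sup>2 =
      (norm (y - c))\<^sup>2 + 2 * sqrt (2 * s) * (w \<bullet> (y - c)) + 2 * s * (norm w)\<^sup>2" for w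
  proof -
    have "(norm (a + r *\<^sub>R w))\<^sup>2 = (norm a)\<^sup>2 + 2 * r * (w \<bullet> a) + r\<^sup>2 * (norm w)\<^sup>2" for a :: 'a and r
      unfolding power2_norm_eq_inner by (simp add: inner_add inner_commute power2_eq_square)
    from this[of "y - c" "sqrt (2 * s)"]
    have "(norm ((y - c) + sqrt (2 * s) *\<^sub>R w))\<^sup>2 =
      (norm (y - c))\<^sup>2 + 2 * sqrt (2 * s) * (w \<bullet> (y - c)) + 2 * s * (norm w)\<^sup>2"
      using assms by simp
    moreover have "(y - c) + sqrt (2 * s) *\<^sub>R w = y + sqrt (2 * s) *\<^sub>R w - c" by simp
    ultimately show ?thesis by (simp only:)
  qed
  show ?thesis
    unfolding heat_def e
    by (simp add: Bochner_Integration.integral_add Bochner_Integration.integrable_add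
        std_gauss_inner std_gauss_norm_sq)
qed

lemma quad_growth_heat:
  assumes "quad_growth \<phi>" "s \<ge> 0"
  shows "quad_growth (heat s (\<phi> :: 'a::euclidean_space \<Rightarrow> real))"
proof -
  obtain C where C: "\<phi> \<in> borel_measurable borel" "C \<ge> 0" "\<And>x. \<bar>\<phi> x\<bar> \<le> C * (1 + (norm x)\<^sup>2)"
    using assms(1) by (rule quad_growthE) blast
  note [measurable] = C(1)
  show ?thesis
  proof (rule quad_growth_dominated)
    show "quad_growth (\<lambda>x::'a. C * (1 + ((norm x)\<^sup>2 + 2 * s * real DIM('a))))"
      by (intro quad_growth_add quad_growth_cmult quad_growth_const quad_growth_norm_sq)
    fix x
    have qn: "quad_growth (\<lambda>x::'a. C * (1 + (norm x)\<^sup>2))"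
      by (intro quad_growth_add quad_growth_cmult quad_growth_const quad_growth_norm_sq)
    have qa: "quad_growth (\<lambda>x. \<bar>\<phi> x\<bar>)"
      by (rule quad_growth_dominated[OF _ qn]) (use C(3) in auto)
    have "\<bar>heat s \<phi> x\<bar> \<le> heat s (\<lambda>x. \<bar>\<phi> x\<bar>) x"
      unfolding heat_def by (rule integral_abs_bound)
    also have "\<dots> \<le> heat s (\<lambda>x. C * (1 + (norm x)\<^sup>2)) x"
      by (rule heat_mono[OF qa qn C(3)])
    also have "\<dots> = C * (1 + ((norm x)\<^sup>2 + 2 * s * real DIM('a)))"
      using heat_norm_sq[OF assms(2), of 0 x]
      by (simp add: heat_cmult heat_add[OF quad_growth_const quad_growth_norm_sq] heat_const)
    finally show "\<bar>heat s \<phi> x\<bar> \<le> C * (1 + ((norm x)\<^sup>2 + 2 * s * real DIM('a)))" .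
  qed measurable
qed

text \<open>As an identity of image measures, the convolution formula transports integrability as
  well as Bochner integrals; the semigroup law needs both, since its functions are
  unbounded.\<close>

lemma distr_std_gauss_convolution:
  fixes t :: "'a::euclidean_space"
  assumes "\<sigma> > 0" "\<tau> > 0"
  shows "distr (std_gauss \<Otimes>\<^sub>M std_gauss) borel (\<lambda>(w, w'). t + \<sigma> *\<^sub>R w + \<tau> *\<^sub>R w') =
    distr std_gauss borel (\<lambda>w. t + sqrt (\<sigma>\<^sup>2 + \<tau>\<^sup>2) *\<^sub>R w)" (is "?L = ?R")
proof (rule measure_eqI)
  fix A assume "A \<in> sets ?L"
  then have [measurable]: "A \<in> sets borel" by simp
  have "emeasure ?L A = (\<integral>\<^sup>+p. indicator A (t + \<sigma> *\<^sub>R fst p + \<tau> *\<^sub>R snd p) \<partial>(std_gauss \<Otimes>\<^sub>M std_gauss))"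
    by (subst nn_integral_indicator[symmetric], simp, subst nn_integral_distr) (auto simp: case_prod_unfold)
  also have "\<dots> = (\<integral>\<^sup>+w. \<integral>\<^sup>+w'. indicator A (t + \<sigma> *\<^sub>R w + \<tau> *\<^sub>R w') \<partial>std_gauss \<partial>std_gauss)"
    by (subst std_gauss.nn_integral_fst[symmetric]) auto
  also have "\<dots> = (\<integral>\<^sup>+w. indicator A (t + sqrt (\<sigma>\<^sup>2 + \<tau>\<^sup>2) *\<^sub>R w) \<partial>std_gauss)"
    using assms by (intro nn_integral_std_gauss_convolution) auto
  also have "\<dots> = emeasure ?R A"
    by (subst nn_integral_indicator[symmetric], simp, subst nn_integral_distr) auto
  finally show "emeasure ?L A = emeasure ?R A" .
qed simp

lemma heat_heat:
  fixes \<phi> :: "'a::euclidean_space \<Rightarrow> real"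
  assumes \<phi>: "quad_growth \<phi>" and st: "s \<ge> 0" "t \<ge> 0"
  shows "heat s (heat t \<phi>) y = heat (s + t) \<phi> y"
proof (cases "s = 0 \<or> t = 0")
  case True
  then show ?thesis
  proof
    assume "t = 0"
    moreover have "heat 0 \<phi> = \<phi>" by (rule ext) (rule heat_0)
    ultimately show ?thesis by simp
  qed (simp add: heat_0)
next
  case False
  let ?\<sigma> = "sqrt (2 * s)" and ?\<tau> = "sqrt (2 * t)"
  have pos: "?\<sigma> > 0" "?\<tau> > 0" and sq: "?\<sigma>\<^sup>2 + ?\<tau>\<^sup>2 = 2 * (s + t)" using False st by auto
  note [measurable] = quad_growth_measurable[OF \<phi>]
  interpret pair_prob_space "std_gauss :: 'a measure" "std_gauss :: 'a measure" ..
  let ?M = "std_gauss \<Otimes>\<^sub>M std_gauss :: ('a \<times> 'a) measure"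
  have D: "distr ?M borel (\<lambda>(w, w'). y + ?\<sigma> *\<^sub>R w + ?\<tau> *\<^sub>R w') =
    distr std_gauss borel (\<lambda>w. y + sqrt (2 * (s + t)) *\<^sub>R w)"
    using distr_std_gauss_convolution[OF pos, of y] unfolding sq .
  have "integrable (distr std_gauss borel (\<lambda>w. y + sqrt (2 * (s + t)) *\<^sub>R w)) \<phi>"
    by (subst integrable_distr_eq) (auto intro: quad_growth_integrable[OF \<phi>])
  then have "integrable (distr ?M borel (\<lambda>(w, w'). y + ?\<sigma> *\<^sub>R w + ?\<tau> *\<^sub>R w')) \<phi>"
    unfolding D .
  then have int: "integrable ?M (\<lambda>(w, w'). \<phi> (y + ?\<sigma> *\<^sub>R w + ?\<tau> *\<^sub>R w'))"
    by (subst (asm) integrable_distr_eq) (auto simp: case_prod_unfold)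
  have "heat s (heat t \<phi>) y = (\<integral>w. \<integral>w'. \<phi> (y + ?\<sigma> *\<^sub>R w + ?\<tau> *\<^sub>R w') \<partial>std_gauss \<partial>std_gauss)"
    by (simp add: heat_def)
  also have "\<dots> = (\<integral>p. \<phi> (y + ?\<sigma> *\<^sub>R fst p + ?\<tau> *\<^sub>R snd p) \<partial>?M)"
    using integral_fst'[OF int[unfolded case_prod_unfold]] by simp
  also have "\<dots> = integral\<^sup>L (distr ?M borel (\<lambda>(w, w'). y + ?\<sigma> *\<^sub>R w + ?\<tau> *\<^sub>R w')) \<phi>"
    by (subst integral_distr) (auto simp: case_prod_unfold)
  also have "\<dots> = heat (s + t) \<phi> y"
    unfolding D heat_def by (subst integral_distr) auto
  finally show ?thesis .
qed

text \<open>The Gibbs variational inequality for two Gaussians of covariance 2 \<eta> I centred at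
  \<open>y\<close> and \<open>y + h\<close>, whose relative entropy is |h|^2 / (4 \<eta>). This is
  where steering is paid for.\<close>

lemma ln_heat_exp_ge:
  fixes V :: "'a::euclidean_space \<Rightarrow> real"
  assumes V [measurable]: "V \<in> borel_measurable borel" and B: "\<And>x. \<bar>V x\<bar> \<le> B" and \<eta>: "\<eta> > 0"
  shows "heat \<eta> V (y + h) - (norm h)\<^sup>2 / (4 * \<eta>) \<le> ln (heat \<eta> (\<lambda>x. exp (V x)) y)"
proof -
  define \<sigma> where "\<sigma> = sqrt (2 * \<eta>)"
  have \<sigma>: "\<sigma> > 0" "\<sigma>\<^sup>2 = 2 * \<eta>" using \<eta> by (auto simp: \<sigma>_def)
  define a where "a = (1 / \<sigma>) *\<^sub>R h"
  have sa: "\<sigma> *\<^sub>R a = h" "(norm a)\<^sup>2 = (norm h)\<^sup>2 / (2 * \<eta>)" using \<sigma> by (auto simp: a_def power_divide)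
  \<comment> \<open>The shifted \<open>V\<close> plus the logarithm of the Cameron-Martin density:
    the exponential moment of \<open>X\<close> is that of the unshifted \<open>V\<close>, and its
    mean is the left side of the claim.\<close>
  define X where "X w = V (y + h + \<sigma> *\<^sub>R w) - (w \<bullet> a) - (norm a)\<^sup>2 / 2" for w
  have [measurable]: "X \<in> borel_measurable borel" unfolding X_def by measurable
  have VI: "integrable std_gauss (\<lambda>w. V (y + h + \<sigma> *\<^sub>R w))"
    by (rule quad_growth_integrable[OF quad_growth_bounded[OF V B]])
  have XI: "integrable std_gauss X" unfolding X_def
    by (intro Bochner_Integration.integrable_diff VI std_gauss_inner) simp
  have EI: "integrable std_gauss (\<lambda>w. exp (V (y + \<sigma> *\<^sub>R w)))"
    by (intro quad_growth_integrable[of "\<lambda>x. exp (V x)"] quad_growth_bounded[of _ "exp B"])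
       (use B in \<open>auto simp: abs_le_iff\<close>)
  have eq: "(\<integral>\<^sup>+w. ennreal (exp (X w)) \<partial>std_gauss) = (\<integral>\<^sup>+w. ennreal (exp (V (y + \<sigma> *\<^sub>R w))) \<partial>std_gauss)"
  proof -
    have "exp (X w) = exp (- (w \<bullet> a) - (norm a)\<^sup>2 / 2) * exp (V (y + \<sigma> *\<^sub>R (w + a)))" for w
      by (simp add: X_def exp_add[symmetric] scaleR_add_right sa) (simp add: ac_simps)
    then show ?thesis
      by (subst (2) nn_integral_std_gauss_translate[of _ a]) (auto simp: ennreal_mult)
  qed
  have EXI: "integrable std_gauss (\<lambda>w. exp (X w))"
    using nn_integral_eq_integral[OF EI] by (intro integrableI_nonneg) (auto simp: eq)
  have "exp (\<integral>w. X w \<partial>std_gauss) \<le> (\<integral>w. exp (X w) \<partial>std_gauss)"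
    by (rule std_gauss.jensens_inequality[where I = UNIV])
       (use XI EXI in \<open>auto simp: exp_convex\<close>)
  also have "\<dots> = heat \<eta> (\<lambda>x. exp (V x)) y"
    unfolding heat_def \<sigma>_def[symmetric]
    by (simp add: integral_eq_nn_integral eq)
  finally have "(\<integral>w. X w \<partial>std_gauss) \<le> ln (heat \<eta> (\<lambda>x. exp (V x)) y)"
    by (metis exp_gt_zero exp_le_cancel_iff exp_ln less_le_trans)
  moreover have "(\<integral>w. X w \<partial>std_gauss) = heat \<eta> V (y + h) - (norm h)\<^sup>2 / (4 * \<eta>)"
    unfolding X_def heat_def \<sigma>_def[symmetric]
    by (simp add: Bochner_Integration.integral_diff Bochner_Integration.integrable_diff VI
        std_gauss_inner sa)
  ultimately show ?thesis by simp
qed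

section \<open>The Gaussian kernel as an image of the standard Gaussian\<close>

lemma matrix_inv_scaleR_mat:
  assumes "c \<noteq> 0"
  shows "matrix_inv (c *\<^sub>R mat 1 :: real^'n^'n) = (1 / c) *\<^sub>R mat 1"
proof -
  have l: "(c *\<^sub>R mat 1) ** X = c *\<^sub>R X" and r: "X ** (c *\<^sub>R mat 1) = c *\<^sub>R X" for X :: "real^'n^'n"
    by (simp_all only: scalar_matrix_assoc[symmetric] matrix_scalar_ac matrix_mul_lid matrix_mul_rid)
  show ?thesis
    unfolding matrix_inv_def l r
  proof (rule some_equality)
    fix X :: "real^'n^'n" assume "c *\<^sub>R X = mat 1 \<and> c *\<^sub>R X = mat 1"
    then have "(1 / c) *\<^sub>R (c *\<^sub>R X) = (1 / c) *\<^sub>R mat 1" by simp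
    then show "X = (1 / c) *\<^sub>R mat 1" using assms by simp
  qed (use assms in simp)
qed

lemma det_scaleR_mat: "det (c *\<^sub>R mat 1 :: real^'n^'n) = c ^ CARD('n)"
  by (subst det_diagonal) (auto simp: mat_def)

lemma ula_kernel_eq_distr:
  fixes gradU :: "real^'n \<Rightarrow> real^'n"
  assumes \<gamma>: "\<gamma> > 0"
  shows "ula_kernel gradU \<gamma> x = distr std_gauss borel (\<lambda>w. x - \<gamma> *\<^sub>R gradU x + sqrt (2 * \<gamma>) *\<^sub>R w)"
    (is "?L = ?R")
proof (rule measure_eqI)
  show "sets ?L = sets ?R" by (simp add: ula_kernel_def multivariate_normal_def)
  fix A assume "A \<in> sets ?L"
  then have [measurable]: "A \<in> sets borel" by (simp add: ula_kernel_def multivariate_normal_def)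
  define \<mu> where "\<mu> = x - \<gamma> *\<^sub>R gradU x"
  define \<sigma> where "\<sigma> = sqrt (2 * \<gamma>)"
  have \<sigma>: "\<sigma> > 0" "\<sigma>\<^sup>2 = 2 * \<gamma>" using \<gamma> by (auto simp: \<sigma>_def)
  have dens: "exp (- (1/2) * ((y - \<mu>) \<bullet> (matrix_inv ((2 * \<gamma>) *\<^sub>R mat 1) *v (y - \<mu>)))) /
      sqrt ((2 * pi) ^ CARD('n) * det ((2 * \<gamma>) *\<^sub>R mat 1 :: real^'n^'n)) =
      (1 / \<sigma>) ^ CARD('n) * gauss_density ((1 / \<sigma>) *\<^sub>R (y - \<mu>))" for y
  proof -
    have "sqrt ((2 * \<gamma>) ^ CARD('n)) = \<sigma> ^ CARD('n)"
      by (simp add: \<sigma>_def real_sqrt_power[symmetric] del: power_mult_distrib)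
    then have "sqrt ((2 * pi) ^ CARD('n) * det ((2 * \<gamma>) *\<^sub>R mat 1 :: real^'n^'n)) =
        sqrt ((2 * pi) ^ CARD('n)) * \<sigma> ^ CARD('n)"
      by (simp only: det_scaleR_mat real_sqrt_mult)
    moreover have "(y - \<mu>) \<bullet> (matrix_inv ((2 * \<gamma>) *\<^sub>R mat 1) *v (y - \<mu>)) = (norm ((1 / \<sigma>) *\<^sub>R (y - \<mu>)))\<^sup>2"
      using \<gamma> \<sigma> by (simp add: matrix_inv_scaleR_mat scaleR_matrix_vector_assoc[symmetric]
           power_divide power2_norm_eq_inner[symmetric])
    ultimately show ?thesis
      by (simp add: gauss_density_def power_divide mult.commute)
  qed
  have "emeasure ?L A = (\<integral>\<^sup>+y. ennreal ((1 / \<sigma>) ^ DIM(real^'n)) * (ennreal (gauss_density ((1 / \<sigma>) *\<^sub>R (y - \<mu>))) *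
      indicator A y) \<partial>lborel)"
    unfolding ula_kernel_def multivariate_normal_def \<mu>_def[symmetric] dens using \<sigma>
    by (subst emeasure_density) (auto simp: ennreal_mult less_imp_le[OF gauss_density_pos] mult.assoc)
  also have "\<dots> = (\<integral>\<^sup>+w. indicator A (\<mu> + \<sigma> *\<^sub>R w) \<partial>std_gauss)"
    using \<sigma> by (subst nn_integral_std_gauss_scaled) (auto simp: nn_integral_cmult)
  also have "\<dots> = emeasure ?R A"
    unfolding \<mu>_def[symmetric] \<sigma>_def[symmetric]
    by (subst nn_integral_indicator[symmetric], simp, subst nn_integral_distr) auto
  finally show "emeasure ?L A = emeasure ?R A" .
qed

section \<open>Strongly convex potentials\<close>

locale strongly_convex_potential =
  fixes U :: "'a::euclidean_space \<Rightarrow> real" and gradU :: "'a \<Rightarrow> 'a" and L m :: real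
  assumes gderiv: "GDERIV U x :> gradU x"
    and m_pos: "m > 0"
    and lipschitz: "norm (gradU x - gradU y) \<le> L * norm (x - y)"
    and strong_convex: "U y \<ge> U x + gradU x \<bullet> (y - x) + (m / 2) * (norm (x - y))\<^sup>2"
begin

lemma strongly_monotone: "m * (norm (x - y))\<^sup>2 \<le> (gradU x - gradU y) \<bullet> (x - y)"
proof -
  have "gradU x \<bullet> (y - x) = - (gradU x \<bullet> (x - y))" by (simp add: inner_diff)
  then show ?thesis
    using strong_convex[of x y] strong_convex[of y x]
    by (simp add: inner_diff_left norm_minus_commute[of y x])
qed

lemma m_le_L: "m \<le> L"
proof -
  obtain b :: 'a where b: "b \<in> Basis" using nonempty_Basis by blast
  have "m \<le> (gradU b - gradU 0) \<bullet> b" using strongly_monotone[of b 0] b by simp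
  also have "\<dots> \<le> norm (gradU b - gradU 0) * norm b" by (rule norm_cauchy_schwarz)
  also have "\<dots> \<le> L" using lipschitz[of b 0] b by simp
  finally show ?thesis .
qed

lemma L_pos: "L > 0"
  using m_pos m_le_L by simp

lemma continuous_gradU: "continuous_on UNIV gradU"
proof (rule continuous_onI)
  fix x e assume "e > (0::real)"
  then show "\<exists>d>0. \<forall>x'\<in>UNIV. dist x' x < d \<longrightarrow> dist (gradU x') (gradU x) \<le> e"
    using L_pos lipschitz
    by (intro exI[of _ "e / L"]) (auto simp: dist_norm field_simps intro: order_trans[OF lipschitz])
qed

lemma continuous_U: "continuous_on UNIV U"
  using gderiv by (auto simp: continuous_on_eq_continuous_at gderiv_def intro: has_derivative_continuous)

lemma measurable_gradU [measurable]: "gradU \<in> borel_measurable borel"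
  by (rule borel_measurable_continuous_onI[OF continuous_gradU])

lemma measurable_U [measurable]: "U \<in> borel_measurable borel"
  by (rule borel_measurable_continuous_onI[OF continuous_U])

lemma norm_gradU_le: "norm (gradU x) \<le> norm (gradU 0) + L * norm x"
  using norm_triangle_ineq2[of "gradU x" "gradU 0"] lipschitz[of x 0] by simp

lemma step_contraction:
  assumes "\<eta> \<ge> 0"
  shows "(norm (x - y - \<eta> *\<^sub>R (gradU x - gradU y)))\<^sup>2 \<le> (1 - 2 * \<eta> * m + \<eta>\<^sup>2 * L\<^sup>2) * (norm (x - y))\<^sup>2"
proof -
  define D g where "D = x - y" and "g = gradU x - gradU y"
  have "(norm g)\<^sup>2 \<le> (L * norm D)\<^sup>2"
    using lipschitz by (intro power_mono) (auto simp: D_def g_def)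
  then have "\<eta>\<^sup>2 * (norm g)\<^sup>2 \<le> \<eta>\<^sup>2 * (L\<^sup>2 * (norm D)\<^sup>2)"
    by (intro mult_left_mono) (auto simp: power_mult_distrib)
  moreover have "2 * \<eta> * (m * (norm D)\<^sup>2) \<le> 2 * \<eta> * (g \<bullet> D)"
    using strongly_monotone assms by (intro mult_left_mono) (auto simp: D_def g_def)
  moreover have "(norm (D - \<eta> *\<^sub>R g))\<^sup>2 = (norm D)\<^sup>2 - 2 * \<eta> * (g \<bullet> D) + \<eta>\<^sup>2 * (norm g)\<^sup>2"
    unfolding power2_norm_eq_inner by (simp add: inner_diff inner_commute power2_eq_square)
  ultimately show ?thesis unfolding D_def g_def by (simp add: algebra_simps)
qed

text \<open>The transition operator of the kernel on functions. The step size is a parameter because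
  steps of size \<gamma> and substeps of size \<eta> both occur.\<close>

definition ula_op :: "real \<Rightarrow> ('a \<Rightarrow> real) \<Rightarrow> 'a \<Rightarrow> real" where
  "ula_op \<eta> \<phi> x = heat \<eta> \<phi> (x - \<eta> *\<^sub>R gradU x)"

lemma ula_op_measurable [measurable]:
  assumes [measurable]: "\<phi> \<in> borel_measurable borel"
  shows "ula_op \<eta> \<phi> \<in> borel_measurable borel"
  unfolding ula_op_def[abs_def] by measurable

lemma quad_growth_step:
  assumes "quad_growth \<phi>"
  shows "quad_growth (\<lambda>x. \<phi> (x - \<eta> *\<^sub>R gradU x))"
proof (rule quad_growth_compose[OF assms, where c = "1 + \<bar>\<eta>\<bar> * (norm (gradU 0) + L)"])
  show "norm (x - \<eta> *\<^sub>R gradU x) \<le> (1 + \<bar>\<eta>\<bar> * (norm (gradU 0) + L)) * (1 + norm x)" for x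
  proof -
    have "norm (x - \<eta> *\<^sub>R gradU x) \<le> norm x + \<bar>\<eta>\<bar> * norm (gradU x)"
      using norm_triangle_ineq4[of x "\<eta> *\<^sub>R gradU x"] by simp
    also have "\<dots> \<le> norm x + \<bar>\<eta>\<bar> * (norm (gradU 0) + L * norm x)"
      by (intro add_left_mono mult_left_mono norm_gradU_le) simp
    also have "\<dots> \<le> (1 + \<bar>\<eta>\<bar> * (norm (gradU 0) + L)) * (1 + norm x)"
      using L_pos by (simp add: algebra_simps)
    finally show ?thesis .
  qed
qed measurable

lemma quad_growth_ula_op:
  assumes "quad_growth \<phi>" "\<eta> \<ge> 0"
  shows "quad_growth (ula_op \<eta> \<phi>)"
  unfolding ula_op_def[abs_def] by (intro quad_growth_step quad_growth_heat assms)

lemma quad_growth_gradU: "quad_growth (\<lambda>x. (norm (gradU x - v))\<^sup>2)"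
proof (rule quad_growth_compose[OF quad_growth_norm_sq, where c = "norm (gradU 0) + L + norm v"])
  show "norm (gradU x - v) \<le> (norm (gradU 0) + L + norm v) * (1 + norm x)" for x
  proof -
    have "norm (gradU x - v) \<le> norm (gradU 0) + L * norm x + norm v"
      using norm_triangle_ineq4[of "gradU x" v] norm_gradU_le[of x] by simp
    also have "\<dots> \<le> (norm (gradU 0) + L + norm v) * (1 + norm x)"
      using L_pos by (simp add: algebra_simps)
    finally show ?thesis .
  qed
qed measurable

end

section \<open>Coupling by steering\<close>

text \<open>The value function of the steering problem: forcing two chains at distance \<open>D\<close> to meet in \<open>j\<close> steps,
  each contracting by \<open>l\<close>, costs \<open>D\<^sup>2 / penalty \<eta> l j\<close>. For \<open>j = 0\<close> the penalty is 0, the cost is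
  infinite unless \<open>D = 0\<close>, and division by 0 gives 0; hence the premise \<open>penalty \<eta> l j = 0 \<Longrightarrow> x = z\<close> below.\<close>

definition penalty :: "real \<Rightarrow> real \<Rightarrow> nat \<Rightarrow> real" where
  "penalty \<eta> l j = 4 * \<eta> * (inverse l ^ j - 1) / (1 - l\<^sup>2)"

lemma penalty_nonneg:
  assumes "\<eta> > 0" "0 < l" "l < 1"
  shows "penalty \<eta> l j \<ge> 0"
proof -
  have "inverse l ^ j \<ge> 1" using assms by (intro one_le_power) (simp add: one_le_inverse)
  moreover have "l\<^sup>2 < 1" using assms by (simp add: power_less_one_iff)
  ultimately show ?thesis using assms by (simp add: penalty_def)
qed

lemma penalty_Suc_pos:
  assumes "\<eta> > 0" "0 < l" "l < 1"
  shows "penalty \<eta> l (Suc j) > 0"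
proof -
  have "inverse l ^ Suc j > 1" using assms by (intro power_gt1) (simp add: one_less_inverse)
  moreover have "l\<^sup>2 < 1" using assms by (simp add: power_less_one_iff)
  ultimately show ?thesis using assms by (simp add: penalty_def)
qed

lemma square_add_div_le:
  fixes a b s t :: real
  assumes "s > 0" "t > 0"
  shows "(a + b)\<^sup>2 / (s + t) \<le> a\<^sup>2 / s + b\<^sup>2 / t"
proof -
  have "(a\<^sup>2 / s + b\<^sup>2 / t) * (s + t) - (a + b)\<^sup>2 = (a * t - b * s)\<^sup>2 / (s * t)"
    using assms by (simp add: field_simps power2_eq_square)
  also have "\<dots> \<ge> 0" using assms by simp
  finally show ?thesis using assms by (simp add: pos_divide_le_eq)
qed

text \<open>Steering without drift error would allow the recursion p(j+1) l^2 = 4 \<eta> + p(j),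
  solved by the exponent 2 j in place of the j in \<open>penalty\<close>. The exponent j leaves the
  slack \<open>t\<close>, which the inequality (u + v)^2 / (s + t) <= u^2 / s + v^2 / t spends on
  the drift error \<open>b\<close>. Since \<open>t\<close> is proportional to l^(-j), an error with
  j steps still to go costs only a multiple of l^j.\<close>

lemma penalty_step:
  assumes "\<eta> > 0" "0 < l" "l < 1" "a \<ge> 0" "b \<ge> 0" "0 \<le> c" "c \<le> l * a + \<eta> * b"
  shows "c\<^sup>2 / (4 * \<eta> + penalty \<eta> l j) \<le> a\<^sup>2 / penalty \<eta> l (Suc j) + l ^ j / 2 * \<eta> * b\<^sup>2"
proof -
  define s where "s = penalty \<eta> l (Suc j) * l\<^sup>2"
  define t where "t = 4 * \<eta> * inverse l ^ j / (1 + l)"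
  have pos: "s > 0" "t > 0" using assms penalty_Suc_pos[OF assms(1-3), of j] by (auto simp: s_def t_def)
  have l2: "1 - l\<^sup>2 \<noteq> 0" using assms(2,3) by (simp add: power2_eq_1_iff)
  have l2': "1 - l\<^sup>2 = (1 - l) * (1 + l)" by (simp add: algebra_simps power2_eq_square)
  have "s = 4 * \<eta> * (inverse l ^ j * l - l\<^sup>2) / (1 - l\<^sup>2)"
    using assms(2) by (simp add: s_def penalty_def power2_eq_square algebra_simps)
  moreover have "t = 4 * \<eta> * (inverse l ^ j * (1 - l)) / (1 - l\<^sup>2)"
    using assms(2,3) by (simp add: t_def l2')
  ultimately have "s + t = 4 * \<eta> * (inverse l ^ j - l\<^sup>2) / (1 - l\<^sup>2)"
    by (simp add: add_divide_distrib[symmetric] algebra_simps)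
  also have "\<dots> = 4 * \<eta> + penalty \<eta> l j"
    using l2 by (simp add: penalty_def field_simps)
  finally have st: "s + t = 4 * \<eta> + penalty \<eta> l j" .
  have "c\<^sup>2 / (s + t) \<le> (l * a + \<eta> * b)\<^sup>2 / (s + t)"
    using assms pos by (intro divide_right_mono power_mono) auto
  also have "\<dots> \<le> (l * a)\<^sup>2 / s + (\<eta> * b)\<^sup>2 / t"
    by (rule square_add_div_le[OF pos])
  also have "(l * a)\<^sup>2 / s = a\<^sup>2 / penalty \<eta> l (Suc j)"
    using assms(2) by (simp add: s_def power_mult_distrib)
  also have "(\<eta> * b)\<^sup>2 / t = (1 + l) / 2 * (l ^ j / 2 * \<eta> * b\<^sup>2)"
    using assms(1,2) by (simp add: t_def power2_eq_square power_inverse field_simps)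
  also have "\<dots> \<le> 1 * (l ^ j / 2 * \<eta> * b\<^sup>2)"
    using assms by (intro mult_right_mono) auto
  finally show ?thesis unfolding st by simp
qed

context strongly_convex_potential
begin

text \<open>Both chains receive the same Gaussian increment, and \<open>h\<close> steers the true
  chain across part of the gap \<open>X\<close> left by the two drifts. The cost is |h|^2 / (4
  \<eta>) now and the square of the remaining gap divided by the penalty later; the gap is split so
  as to minimise the sum. Using \<open>v\<close> instead of \<open>gradU x\<close> is the drift
  error charged by \<open>penalty_step\<close>.\<close>

lemma coupling_substep:
  assumes \<eta>: "\<eta> > 0" and l: "0 < l" "l < 1"
    and contr: "\<And>x y. norm (x - y - \<eta> *\<^sub>R (gradU x - gradU y)) \<le> l * norm (x - y)"
    and V: "V \<in> borel_measurable borel" "\<And>x. \<bar>V x\<bar> \<le> B"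
    and \<Psi>: "quad_growth \<Psi>"
    and lower: "\<And>x z. (penalty \<eta> l j = 0 \<Longrightarrow> x = z) \<Longrightarrow> \<Psi> x - (norm (x - z))\<^sup>2 / penalty \<eta> l j \<le> V z"
  shows "heat \<eta> \<Psi> (x - \<eta> *\<^sub>R v) - l ^ j / 2 * \<eta> * (norm (gradU x - v))\<^sup>2
      - (norm (x - z))\<^sup>2 / penalty \<eta> l (Suc j) \<le> ln (ula_op \<eta> (\<lambda>x. exp (V x)) z)"
proof -
  define p where "p = penalty \<eta> l j"
  have p: "p \<ge> 0" unfolding p_def by (rule penalty_nonneg[OF \<eta> l])
  \<comment> \<open>The fraction of the gap that is kept: it minimises \<theta>^2 / p + (1 -
    \<theta>)^2 / (4 \<eta>), with minimum 1 / (4 \<eta> + p). For \<open>p = 0\<close> it is 0, so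
    the final step closes the gap completely.\<close>
  define \<theta> where "\<theta> = p / (4 * \<eta> + p)"
  define X where "X = (x - \<eta> *\<^sub>R v) - (z - \<eta> *\<^sub>R gradU z)"
  define h where "h = (1 - \<theta>) *\<^sub>R X"
  have VI: "quad_growth V" by (rule quad_growth_bounded[OF V])
  have th: "1 - \<theta> = 4 * \<eta> / (4 * \<eta> + p)"
    using \<eta> p by (simp add: \<theta>_def field_simps)
  have D: "(x - \<eta> *\<^sub>R v) - (z - \<eta> *\<^sub>R gradU z + h) = \<theta> *\<^sub>R X"
    unfolding h_def X_def by (simp add: algebra_simps)
  \<comment> \<open>The variable \<open>y\<close> is the common Gaussian increment, so the gap
    between the two arguments is the constant \<open>\<theta> *\<^sub>R X\<close>.\<close>
  have "heat \<eta> (\<lambda>y. \<Psi> (y + (x - \<eta> *\<^sub>R v)) - (norm (\<theta> *\<^sub>R X))\<^sup>2 / p) 0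
      \<le> heat \<eta> (\<lambda>y. V (y + (z - \<eta> *\<^sub>R gradU z + h))) 0"
  proof (rule heat_mono)
    fix y
    have "penalty \<eta> l j = 0 \<Longrightarrow> y + (x - \<eta> *\<^sub>R v) = y + (z - \<eta> *\<^sub>R gradU z + h)"
      using D by (simp add: \<theta>_def p_def)
    from lower[OF this] D show "\<Psi> (y + (x - \<eta> *\<^sub>R v)) - (norm (\<theta> *\<^sub>R X))\<^sup>2 / p
        \<le> V (y + (z - \<eta> *\<^sub>R gradU z + h))"
      by (simp add: p_def[symmetric])
  qed (intro quad_growth_diff quad_growth_const quad_growth_shift \<Psi> VI)+
  then have "heat \<eta> \<Psi> (x - \<eta> *\<^sub>R v) - (norm (\<theta> *\<^sub>R X))\<^sup>2 / p \<le> heat \<eta> V (z - \<eta> *\<^sub>R gradU z + h)"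
    by (simp add: heat_diff[OF quad_growth_shift[OF \<Psi>] quad_growth_const] heat_shift heat_const)
  also have "\<dots> \<le> ln (ula_op \<eta> (\<lambda>x. exp (V x)) z) + (norm h)\<^sup>2 / (4 * \<eta>)"
    using ln_heat_exp_ge[OF V \<eta>, of "z - \<eta> *\<^sub>R gradU z" h] by (simp add: ula_op_def)
  finally have 1: "heat \<eta> \<Psi> (x - \<eta> *\<^sub>R v) - ((norm (\<theta> *\<^sub>R X))\<^sup>2 / p + (norm h)\<^sup>2 / (4 * \<eta>))
      \<le> ln (ula_op \<eta> (\<lambda>x. exp (V x)) z)" by simp
  have "(norm (\<theta> *\<^sub>R X))\<^sup>2 / p + (norm h)\<^sup>2 / (4 * \<eta>) = (\<theta>\<^sup>2 / p + (1 - \<theta>)\<^sup>2 / (4 * \<eta>)) * (norm X)\<^sup>2"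
  proof -
    have sq: "(norm (c *\<^sub>R X))\<^sup>2 = c\<^sup>2 * (norm X)\<^sup>2" for c by (simp add: power_mult_distrib)
    show ?thesis unfolding h_def sq by (simp add: distrib_right)
  qed
  also have "\<theta>\<^sup>2 / p + (1 - \<theta>)\<^sup>2 / (4 * \<eta>) = 1 / (4 * \<eta> + p)"
  proof (cases "p = 0")
    case False
    then have "p > 0" using p by simp
    have div_sq: "(c / q)\<^sup>2 / c = c / q\<^sup>2" if "c \<noteq> 0" for c q :: real
      using that by (simp add: power_divide power2_eq_square)
    have "\<theta>\<^sup>2 / p = p / (4 * \<eta> + p)\<^sup>2"
      using \<open>p > 0\<close> by (simp add: \<theta>_def power_divide power2_eq_square)
    moreover have "(1 - \<theta>)\<^sup>2 / (4 * \<eta>) = 4 * \<eta> / (4 * \<eta> + p)\<^sup>2"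
      unfolding th using div_sq[of "4 * \<eta>" "4 * \<eta> + p"] \<eta> by simp
    ultimately have "\<theta>\<^sup>2 / p + (1 - \<theta>)\<^sup>2 / (4 * \<eta>) = (4 * \<eta> + p) / (4 * \<eta> + p)\<^sup>2"
      by (simp add: add_divide_distrib)
    then show ?thesis by (simp add: power2_eq_square)
  qed (simp add: \<theta>_def)
  also have "1 / (4 * \<eta> + p) * (norm X)\<^sup>2 = (norm X)\<^sup>2 / (4 * \<eta> + p)" by simp
  also have "\<dots> \<le> (norm (x - z))\<^sup>2 / penalty \<eta> l (Suc j) + l ^ j / 2 * \<eta> * (norm (gradU x - v))\<^sup>2"
    unfolding p_def
  proof (rule penalty_step[OF \<eta> l])
    have "X = (x - z - \<eta> *\<^sub>R (gradU x - gradU z)) + \<eta> *\<^sub>R (gradU x - v)"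
      unfolding X_def by (simp add: algebra_simps)
    then have "norm X \<le> norm (x - z - \<eta> *\<^sub>R (gradU x - gradU z)) + norm (\<eta> *\<^sub>R (gradU x - v))"
      using norm_triangle_ineq by metis
    then show "norm X \<le> l * norm (x - z) + \<eta> * norm (gradU x - v)"
      using contr[of x z] \<eta> by simp
  qed auto
  finally show ?thesis using 1 by linarith
qed

text \<open>By duality this is the supremum, over probability measures Q, of the Q-mean of
  \<open>f\<close> minus the entropy of Q relative to the law of the chain after \<open>j\<close>
  steps from \<open>z\<close>. Every steering strategy bounds it from below.\<close>

definition log_op :: "real \<Rightarrow> ('a \<Rightarrow> real) \<Rightarrow> nat \<Rightarrow> 'a \<Rightarrow> real" where
  "log_op \<eta> f j z = ln ((ula_op \<eta> ^^ j) (\<lambda>x. exp (f x)) z)"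

lemma ula_op_power_bounds:
  assumes g: "g \<in> borel_measurable borel" "\<And>x. a \<le> g x" "\<And>x. g x \<le> b"
  shows "(ula_op \<eta> ^^ j) g \<in> borel_measurable borel \<and> (\<forall>x. a \<le> (ula_op \<eta> ^^ j) g x \<and> (ula_op \<eta> ^^ j) g x \<le> b)"
proof (induction j)
  case (Suc j)
  let ?h = "(ula_op \<eta> ^^ j) g"
  have [measurable]: "?h \<in> borel_measurable borel" using Suc by simp
  have qh: "quad_growth ?h"
  proof (rule quad_growth_bounded)
    show "\<bar>?h x\<bar> \<le> \<bar>a\<bar> + \<bar>b\<bar>" for x using Suc[THEN conjunct2, rule_format, of x] by linarith
  qed measurable
  have "a \<le> ula_op \<eta> ?h x \<and> ula_op \<eta> ?h x \<le> b" for x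
    using heat_mono[OF quad_growth_const qh, of a \<eta> "x - \<eta> *\<^sub>R gradU x"]
      heat_mono[OF qh quad_growth_const, of b \<eta> "x - \<eta> *\<^sub>R gradU x"] Suc
    by (simp add: ula_op_def heat_const)
  then show ?case by simp
qed (use g in simp)

lemma log_op:
  assumes f: "f \<in> borel_measurable borel" "\<And>x. \<bar>f x\<bar> \<le> B"
  shows "log_op \<eta> f j \<in> borel_measurable borel" "\<bar>log_op \<eta> f j x\<bar> \<le> B"
    "exp (log_op \<eta> f j x) = (ula_op \<eta> ^^ j) (\<lambda>x. exp (f x)) x"
proof -
  have fb: "- B \<le> f x" "f x \<le> B" for x using f(2)[of x] by linarith+
  have *: "(ula_op \<eta> ^^ j) (\<lambda>x. exp (f x)) \<in> borel_measurable borel"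
    "\<And>x. exp (- B) \<le> (ula_op \<eta> ^^ j) (\<lambda>x. exp (f x)) x"
    "\<And>x. (ula_op \<eta> ^^ j) (\<lambda>x. exp (f x)) x \<le> exp B"
    using ula_op_power_bounds[where g = "\<lambda>x. exp (f x)" and a = "exp (- B)" and b = "exp B" and \<eta> = \<eta> and j = j]
      f(1) fb by auto
  have pos: "(ula_op \<eta> ^^ j) (\<lambda>x. exp (f x)) x > 0" for x
    using *(2)[of x] exp_gt_zero[of "- B"] by linarith
  show "log_op \<eta> f j \<in> borel_measurable borel"
    unfolding log_op_def[abs_def] using *(1) by measurable
  show e: "exp (log_op \<eta> f j x) = (ula_op \<eta> ^^ j) (\<lambda>x. exp (f x)) x"
    unfolding log_op_def using pos by simp
  have "exp (- B) \<le> exp (log_op \<eta> f j x)" "exp (log_op \<eta> f j x) \<le> exp B"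
    unfolding e using * by auto
  then show "\<bar>log_op \<eta> f j x\<bar> \<le> B" by simp
qed

lemma log_op_Suc:
  assumes f: "f \<in> borel_measurable borel" "\<And>x. \<bar>f x\<bar> \<le> B"
  shows "log_op \<eta> f (Suc j) z = ln (ula_op \<eta> (\<lambda>x. exp (log_op \<eta> f j x)) z)"
  using log_op(3)[OF f] by (simp add: log_op_def[of \<eta> f "Suc j"])

text \<open>The drift \<open>v\<close> stays fixed while \<open>x\<close> and \<open>z\<close> vary
  in the induction; the choice \<open>v = gradU x\<close> is made only for a whole block. The
  substep errors carry weights from l^J to l^(J + k - 1), all bounded by the largest, l^J.\<close>

lemma coupling_frozen_steps:
  assumes \<eta>: "\<eta> > 0" and l: "0 < l" "l < 1"
    and contr: "\<And>x y. norm (x - y - \<eta> *\<^sub>R (gradU x - gradU y)) \<le> l * norm (x - y)"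
    and f: "f \<in> borel_measurable borel" "\<And>x. \<bar>f x\<bar> \<le> B"
    and \<Psi>: "quad_growth \<Psi>"
    and lower: "\<And>x z. (penalty \<eta> l J = 0 \<Longrightarrow> x = z) \<Longrightarrow>
      \<Psi> x - (norm (x - z))\<^sup>2 / penalty \<eta> l J \<le> log_op \<eta> f J z"
  shows "(penalty \<eta> l (J + k) = 0 \<Longrightarrow> x = z) \<Longrightarrow>
    heat (real k * \<eta>) \<Psi> (x - (real k * \<eta>) *\<^sub>R v)
    - l ^ J / 2 * \<eta> * (\<Sum>i<k. heat (real i * \<eta>) (\<lambda>y. (norm (gradU y - v))\<^sup>2) (x - (real i * \<eta>) *\<^sub>R v))
    - (norm (x - z))\<^sup>2 / penalty \<eta> l (J + k) \<le> log_op \<eta> f (J + k) z"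
proof (induction k arbitrary: x z)
  case 0
  then show ?case using lower[of x z] by (simp add: heat_0)
next
  case (Suc k)
  define E where "E y = (norm (gradU y - v))\<^sup>2" for y
  have qE: "quad_growth E" unfolding E_def by (rule quad_growth_gradU)
  define \<Psi>k where "\<Psi>k x = heat (real k * \<eta>) \<Psi> (x - (real k * \<eta>) *\<^sub>R v)
    - l ^ J / 2 * \<eta> * (\<Sum>i<k. heat (real i * \<eta>) E (x - (real i * \<eta>) *\<^sub>R v))" for x
  have q1: "quad_growth (\<lambda>x. heat (real k * \<eta>) \<Psi> (x - c))" for c
    using \<eta> by (intro quad_growth_shift' quad_growth_heat \<Psi>) simp
  have q2: "quad_growth (\<lambda>x. heat (real i * \<eta>) E (x - c))" for i c
    using \<eta> by (intro quad_growth_shift' quad_growth_heat qE) simp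
  have q\<Psi>k: "quad_growth \<Psi>k" unfolding \<Psi>k_def
    by (intro quad_growth_diff quad_growth_cmult quad_growth_sum q1 q2)
  \<comment> \<open>A frozen drift is a constant translation, so the semigroup law merges the new
    substep with the later ones.\<close>
  have hh: "heat \<eta> (\<lambda>x. heat (real i * \<eta>) \<phi> (x - (real i * \<eta>) *\<^sub>R v)) (x - \<eta> *\<^sub>R v)
      = heat (real (Suc i) * \<eta>) \<phi> (x - (real (Suc i) * \<eta>) *\<^sub>R v)"
    if "quad_growth \<phi>" for i \<phi>
  proof -
    have "heat \<eta> (\<lambda>x. heat (real i * \<eta>) \<phi> (x - (real i * \<eta>) *\<^sub>R v)) (x - \<eta> *\<^sub>R v) =
        heat \<eta> (heat (real i * \<eta>) \<phi>) (x - \<eta> *\<^sub>R v - (real i * \<eta>) *\<^sub>R v)"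
      using heat_shift[of \<eta> "heat (real i * \<eta>) \<phi>" "- ((real i * \<eta>) *\<^sub>R v)"] by simp
    also have "\<dots> = heat (\<eta> + real i * \<eta>) \<phi> (x - \<eta> *\<^sub>R v - (real i * \<eta>) *\<^sub>R v)"
      using \<eta> by (intro heat_heat that) auto
    finally show ?thesis by (simp add: algebra_simps)
  qed
  have "heat \<eta> \<Psi>k (x - \<eta> *\<^sub>R v) - l ^ (J + k) / 2 * \<eta> * (norm (gradU x - v))\<^sup>2
      - (norm (x - z))\<^sup>2 / penalty \<eta> l (Suc (J + k)) \<le>
      ln (ula_op \<eta> (\<lambda>x. exp (log_op \<eta> f (J + k) x)) z)"
    by (rule coupling_substep[OF \<eta> l contr log_op(1)[OF f] log_op(2)[OF f] q\<Psi>k])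
       (use Suc.IH[folded E_def] in \<open>simp only: \<Psi>k_def\<close>)
  moreover have "heat \<eta> \<Psi>k (x - \<eta> *\<^sub>R v) = heat (real (Suc k) * \<eta>) \<Psi> (x - (real (Suc k) * \<eta>) *\<^sub>R v)
     - l ^ J / 2 * \<eta> * (\<Sum>i<k. heat (real (Suc i) * \<eta>) E (x - (real (Suc i) * \<eta>) *\<^sub>R v))"
    unfolding \<Psi>k_def
    by (simp only: heat_diff[OF q1 quad_growth_cmult[OF quad_growth_sum[OF q2]]] heat_cmult
        heat_sum[OF q2] hh[OF \<Psi>] hh[OF qE])
  moreover have "l ^ (J + k) / 2 * \<eta> * E x \<le> l ^ J / 2 * \<eta> * E x"
    using l \<eta> by (intro mult_right_mono divide_right_mono power_decreasing) (auto simp: E_def)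
  moreover have "(\<Sum>i<Suc k. heat (real i * \<eta>) E (x - (real i * \<eta>) *\<^sub>R v)) =
     E x + (\<Sum>i<k. heat (real (Suc i) * \<eta>) E (x - (real (Suc i) * \<eta>) *\<^sub>R v))"
    by (subst sum.lessThan_Suc_shift) (simp add: heat_0)
  ultimately show ?case
    unfolding log_op_Suc[OF f, symmetric] add_Suc_right E_def[symmetric]
    by (simp only: distrib_left)
qed

lemma sum_frozen_error_le:
  assumes \<eta>: "\<eta> > 0"
  shows "\<eta> * (\<Sum>i<N. heat (real i * \<eta>) (\<lambda>y. (norm (gradU y - gradU x))\<^sup>2) (x - (real i * \<eta>) *\<^sub>R gradU x))
    \<le> L\<^sup>2 * ((real N * \<eta>) ^ 3 / 3 * (norm (gradU x))\<^sup>2 + (real N * \<eta>)\<^sup>2 * real DIM('a))"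
proof -
  have "heat (real i * \<eta>) (\<lambda>y. (norm (gradU y - gradU x))\<^sup>2) (x - (real i * \<eta>) *\<^sub>R gradU x) \<le>
      L\<^sup>2 * ((real i * \<eta>)\<^sup>2 * (norm (gradU x))\<^sup>2 + 2 * (real i * \<eta>) * real DIM('a))" for i
  proof -
    have q: "quad_growth (\<lambda>y. (norm (y - x))\<^sup>2)" by (intro quad_growth_shift' quad_growth_norm_sq)
    have "heat (real i * \<eta>) (\<lambda>y. (norm (gradU y - gradU x))\<^sup>2) (x - (real i * \<eta>) *\<^sub>R gradU x)
      \<le> heat (real i * \<eta>) (\<lambda>y. L\<^sup>2 * (norm (y - x))\<^sup>2) (x - (real i * \<eta>) *\<^sub>R gradU x)"
    proof (intro heat_mono quad_growth_gradU quad_growth_cmult q)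
      show "(norm (gradU y - gradU x))\<^sup>2 \<le> L\<^sup>2 * (norm (y - x))\<^sup>2" for y
        using power_mono[OF lipschitz[of y x] norm_ge_zero, of 2] by (simp add: power_mult_distrib)
    qed
    also have "\<dots> = L\<^sup>2 * ((real i * \<eta>)\<^sup>2 * (norm (gradU x))\<^sup>2 + 2 * (real i * \<eta>) * real DIM('a))"
      using \<eta> by (simp add: heat_cmult heat_norm_sq power_mult_distrib)
    finally show ?thesis .
  qed
  then have "\<eta> * (\<Sum>i<N. heat (real i * \<eta>) (\<lambda>y. (norm (gradU y - gradU x))\<^sup>2) (x - (real i * \<eta>) *\<^sub>R gradU x))
     \<le> \<eta> * (\<Sum>i<N. L\<^sup>2 * ((real i * \<eta>)\<^sup>2 * (norm (gradU x))\<^sup>2 + 2 * (real i * \<eta>) * real DIM('a)))"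
    using \<eta> by (intro mult_left_mono sum_mono) auto
  also have "\<dots> = L\<^sup>2 * (\<eta> ^ 3 * (\<Sum>i<N. (real i)\<^sup>2) * (norm (gradU x))\<^sup>2 + \<eta>\<^sup>2 * (\<Sum>i<N. 2 * real i) * real DIM('a))"
    by (simp add: sum_distrib_left sum_distrib_right sum.distrib power_mult_distrib algebra_simps
        power2_eq_square power3_eq_cube)
  also have "\<dots> \<le> L\<^sup>2 * (\<eta> ^ 3 * (real N ^ 3 / 3) * (norm (gradU x))\<^sup>2 + \<eta>\<^sup>2 * (real N)\<^sup>2 * real DIM('a))"
  proof -
    have "(\<Sum>i<N. (real i)\<^sup>2) \<le> real N ^ 3 / 3"
      by (induction N) (auto simp: power2_eq_square power3_eq_cube field_simps)
    moreover have "(\<Sum>i<N. 2 * real i) \<le> (real N)\<^sup>2"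
      by (induction N) (auto simp: power2_eq_square field_simps)
    ultimately show ?thesis using \<eta>
      by (intro mult_left_mono add_mono mult_right_mono) auto
  qed
  finally show ?thesis by (simp add: power_mult_distrib mult_ac)
qed

end

section \<open>Growth of the potential and its drift along one step\<close>

lemma quad_growth_inner: "quad_growth (\<lambda>x. a \<bullet> x)"
proof (rule quad_growthI[of _ "norm a"])
  show "\<bar>a \<bullet> x\<bar> \<le> norm a * (1 + (norm x)\<^sup>2)" for x
  proof -
    have "0 \<le> (norm x - 1)\<^sup>2" by simp
    then have "2 * norm x \<le> 1 + (norm x)\<^sup>2" by (simp add: power2_eq_square algebra_simps)
    then have "norm x \<le> 1 + (norm x)\<^sup>2" using norm_ge_zero[of x] by linarith
    then have "norm a * norm x \<le> norm a * (1 + (norm x)\<^sup>2)" by (intro mult_left_mono) auto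
    then show ?thesis using Cauchy_Schwarz_ineq2[of a x] by linarith
  qed
qed measurable

lemma heat_inner: "heat s (\<lambda>x. a \<bullet> x) y = a \<bullet> y"
  unfolding heat_def by (simp add: inner_commute[of a] inner_add_left std_gauss_inner)

context strongly_convex_potential
begin

lemma descent: "U (x + h) \<le> U x + gradU x \<bullet> h + L / 2 * (norm h)\<^sup>2"
proof -
  define \<phi> where "\<phi> t = U (x + t *\<^sub>R h) - t * (gradU x \<bullet> h) - L / 2 * t\<^sup>2 * (norm h)\<^sup>2" for t :: real
  have "\<phi> 1 \<le> \<phi> 0"
  proof (rule DERIV_nonpos_imp_nonincreasing[of 0 1 \<phi>])
    fix t :: real assume t: "0 \<le> t" "t \<le> 1"
    have "((\<lambda>t. U (x + t *\<^sub>R h)) has_derivative (\<lambda>s. (s *\<^sub>R h) \<bullet> gradU (x + t *\<^sub>R h))) (at t)"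
      by (rule has_derivative_compose[where f = "\<lambda>t. x + t *\<^sub>R h" and g = U])
         (use gderiv in \<open>auto simp: gderiv_def intro!: derivative_eq_intros\<close>)
    then have "((\<lambda>t. U (x + t *\<^sub>R h)) has_real_derivative (gradU (x + t *\<^sub>R h) \<bullet> h)) (at t)"
      by (rule has_derivative_imp_has_field_derivative) (simp add: inner_commute)
    then have "(\<phi> has_real_derivative (gradU (x + t *\<^sub>R h) \<bullet> h - gradU x \<bullet> h - L * t * (norm h)\<^sup>2)) (at t)"
      unfolding \<phi>_def by (auto intro!: derivative_eq_intros)
    moreover have "(gradU (x + t *\<^sub>R h) - gradU x) \<bullet> h \<le> norm (gradU (x + t *\<^sub>R h) - gradU x) * norm h"
      by (rule norm_cauchy_schwarz)
    moreover have "norm (gradU (x + t *\<^sub>R h) - gradU x) * norm h \<le> (L * (t * norm h)) * norm h"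
      using lipschitz[of "x + t *\<^sub>R h" x] t by (intro mult_right_mono) auto
    ultimately show "\<exists>y. (\<phi> has_real_derivative y) (at t) \<and> y \<le> 0"
      by (intro exI conjI) (auto simp: inner_diff_left power2_eq_square mult_ac)
  qed simp
  then show ?thesis by (simp add: \<phi>_def)
qed

text \<open>Young's inequality absorbs the linear term of strong convexity at 0 into half of the
  quadratic one.\<close>

lemma U_lower: "(m / 4) * (norm x)\<^sup>2 + U 0 - (norm (gradU 0))\<^sup>2 / m \<le> U x"
proof -
  have "0 \<le> (m / 2 * norm x - norm (gradU 0))\<^sup>2 / m" using m_pos by simp
  also have "\<dots> = (m / 4) * (norm x)\<^sup>2 - norm (gradU 0) * norm x + (norm (gradU 0))\<^sup>2 / m"
    using m_pos by (simp add: field_simps power2_eq_square)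
  finally have "norm (gradU 0) * norm x \<le> (m / 4) * (norm x)\<^sup>2 + (norm (gradU 0))\<^sup>2 / m" by simp
  moreover have "- (norm (gradU 0) * norm x) \<le> gradU 0 \<bullet> x"
    using Cauchy_Schwarz_ineq2[of "gradU 0" x] by linarith
  ultimately show ?thesis using strong_convex[of 0 x] by simp
qed

text \<open>The point \<open>y\<close> is arbitrary rather than the minimiser: the Lyapunov estimate
  takes \<open>y = 0\<close>, and no minimiser has to be produced.\<close>

lemma polyak_lojasiewicz: "2 * m * (U x - U y) \<le> (norm (gradU x))\<^sup>2"
proof -
  have "0 \<le> (norm (gradU x + m *\<^sub>R (y - x)))\<^sup>2" by simp
  also have "\<dots> = (norm (gradU x))\<^sup>2 + 2 * m * (gradU x \<bullet> (y - x)) + m\<^sup>2 * (norm (x - y))\<^sup>2"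
    unfolding power2_norm_eq_inner by (simp add: inner_add inner_diff inner_commute power2_eq_square algebra_simps)
  also have "\<dots> = (norm (gradU x))\<^sup>2 + 2 * m * (gradU x \<bullet> (y - x) + m / 2 * (norm (x - y))\<^sup>2)"
    by (simp add: power2_eq_square algebra_simps)
  also have "\<dots> \<le> (norm (gradU x))\<^sup>2 + 2 * m * (U y - U x)"
    using strong_convex[of x y] m_pos by (intro add_left_mono mult_left_mono) auto
  finally show ?thesis by (simp add: algebra_simps)
qed

lemma quad_growth_U: "quad_growth U"
proof (rule quad_growth_dominated)
  show "quad_growth (\<lambda>x. \<bar>U 0\<bar> + norm (gradU 0) * (1 + 1 * (norm x)\<^sup>2) + L / 2 * (norm x)\<^sup>2)"
    by (intro quad_growth_add quad_growth_cmult quad_growth_const quad_growth_norm_sq)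
  fix x :: 'a
  have "0 \<le> (norm x - 1)\<^sup>2" by simp
  then have "2 * norm x \<le> 1 + (norm x)\<^sup>2" by (simp add: power2_eq_square algebra_simps)
  then have "norm x \<le> 1 + (norm x)\<^sup>2" using norm_ge_zero[of x] by linarith
  then have "norm (gradU 0) * norm x \<le> norm (gradU 0) * (1 + 1 * (norm x)\<^sup>2)" by (intro mult_left_mono) auto
  moreover have "\<bar>gradU 0 \<bullet> x\<bar> \<le> norm (gradU 0) * norm x" by (rule Cauchy_Schwarz_ineq2)
  moreover have "0 \<le> (m / 2) * (norm x)\<^sup>2" "0 \<le> L / 2 * (norm x)\<^sup>2" using m_pos L_pos by auto
  ultimately show "\<bar>U x\<bar> \<le> \<bar>U 0\<bar> + norm (gradU 0) * (1 + 1 * (norm x)\<^sup>2) + L / 2 * (norm x)\<^sup>2"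
    using strong_convex[of 0 x] descent[of 0 x] by simp
qed measurable

lemma ula_op_U_le:
  assumes "\<gamma> \<ge> 0"
  shows "ula_op \<gamma> U x \<le> U x - \<gamma> * (1 - \<gamma> * L / 2) * (norm (gradU x))\<^sup>2 + L * \<gamma> * real DIM('a)"
proof -
  have q: "quad_growth (\<lambda>y. (norm (y - x))\<^sup>2)" by (intro quad_growth_shift' quad_growth_norm_sq)
  have "ula_op \<gamma> U x \<le> heat \<gamma> (\<lambda>y. (U x - gradU x \<bullet> x) + gradU x \<bullet> y + L / 2 * (norm (y - x))\<^sup>2) (x - \<gamma> *\<^sub>R gradU x)"
    unfolding ula_op_def
  proof (intro heat_mono quad_growth_U quad_growth_add quad_growth_const quad_growth_inner quad_growth_cmult q)
    show "U y \<le> (U x - gradU x \<bullet> x) + gradU x \<bullet> y + L / 2 * (norm (y - x))\<^sup>2" for y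
      using descent[of x "y - x"] by (simp add: inner_diff_right)
  qed
  also have "\<dots> = (U x - gradU x \<bullet> x) + gradU x \<bullet> (x - \<gamma> *\<^sub>R gradU x)
      + L / 2 * ((norm (x - \<gamma> *\<^sub>R gradU x - x))\<^sup>2 + 2 * \<gamma> * real DIM('a))"
    by (simp only: heat_add[OF quad_growth_add[OF quad_growth_const quad_growth_inner] quad_growth_cmult[OF q]]
        heat_add[OF quad_growth_const quad_growth_inner]
        heat_const heat_inner heat_cmult heat_norm_sq[OF assms])
  also have "\<dots> = U x - \<gamma> * (1 - \<gamma> * L / 2) * (norm (gradU x))\<^sup>2 + L * \<gamma> * real DIM('a)"
    by (simp add: inner_diff_right power2_norm_eq_inner[symmetric] power_mult_distrib power2_eq_square algebra_simps)
  finally show ?thesis .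
qed

end

section \<open>The stationary Langevin chain\<close>

text \<open>Stationarity is recorded as an identity of image measures, so that Fubini and a change
  of variables extend it from sets to all integrable functions.\<close>

locale stationary_ula = strongly_convex_potential U gradU L m
  for U :: "'a::euclidean_space \<Rightarrow> real" and gradU L m +
  fixes \<gamma> :: real and \<nu> :: "'a measure"
  assumes \<gamma>_pos: "\<gamma> > 0" and \<gamma>_le: "\<gamma> * L \<le> 1"
    and prob_\<nu>: "prob_space \<nu>" and sets_\<nu> [measurable_cong]: "sets \<nu> = sets borel"
    and invariant: "distr (\<nu> \<Otimes>\<^sub>M std_gauss) borel
      (\<lambda>(x, w). x - \<gamma> *\<^sub>R gradU x + sqrt (2 * \<gamma>) *\<^sub>R w) = \<nu>"
begin

sublocale \<nu>: prob_space \<nu> by (rule prob_\<nu>)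

sublocale pair: pair_prob_space \<nu> "std_gauss :: 'a measure" ..

lemma space_\<nu> [simp]: "space \<nu> = UNIV"
  using sets_eq_imp_space_eq[OF sets_\<nu>] by simp

lemma integral_ula_op:
  assumes \<phi>: "integrable \<nu> \<phi>"
  shows "integrable \<nu> (ula_op \<gamma> \<phi>)" "(\<integral>x. ula_op \<gamma> \<phi> x \<partial>\<nu>) = (\<integral>x. \<phi> x \<partial>\<nu>)"
proof -
  let ?T = "\<lambda>(x, w). x - \<gamma> *\<^sub>R gradU x + sqrt (2 * \<gamma>) *\<^sub>R w"
  have [measurable]: "\<phi> \<in> borel_measurable borel"
    using borel_measurable_integrable[OF \<phi>] by (simp cong: measurable_cong_sets[OF sets_\<nu>])
  have int: "integrable (\<nu> \<Otimes>\<^sub>M std_gauss) (\<lambda>p. \<phi> (?T p))"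
    using \<phi> by (subst (asm) invariant[symmetric], subst (asm) integrable_distr_eq) auto
  have *: "ula_op \<gamma> \<phi> x = (\<integral>w. \<phi> (?T (x, w)) \<partial>std_gauss)" for x
    by (simp add: ula_op_def heat_def)
  show "integrable \<nu> (ula_op \<gamma> \<phi>)"
    unfolding *[abs_def] by (rule pair.integrable_fst'[OF int])
  have "(\<integral>x. ula_op \<gamma> \<phi> x \<partial>\<nu>) = integral\<^sup>L (\<nu> \<Otimes>\<^sub>M std_gauss) (\<lambda>p. \<phi> (?T p))"
    unfolding * by (rule pair.integral_fst'[OF int])
  also have "\<dots> = (\<integral>x. \<phi> x \<partial>\<nu>)"
    by (subst (2) invariant[symmetric], subst integral_distr) auto
  finally show "(\<integral>x. ula_op \<gamma> \<phi> x \<partial>\<nu>) = (\<integral>x. \<phi> x \<partial>\<nu>)" .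
qed

text \<open>The energy \<open>U\<close> is a Lyapunov function: truncating it at height \<open>M\<close> makes stationarity
  applicable, and the drift then bounds its mean uniformly in \<open>M\<close>.\<close>

lemma integrable_U: "integrable \<nu> U"
proof -
  define c where "c = U 0 - (norm (gradU 0))\<^sup>2 / m"
  define w where "w x = U x - c" for x
  have w0: "w x \<ge> 0" for x
    using U_lower[of x] m_pos by (simp add: w_def c_def) (smt (verit) mult_nonneg_nonneg zero_le_power2 divide_nonneg_pos)
  define \<delta> where "\<delta> = \<gamma> * m"
  define b where "b = \<bar>L * \<gamma> * real DIM('a) + \<delta> * (U 0 - c)\<bar>"
  have "\<gamma> * m \<le> \<gamma> * L" using \<gamma>_pos by (intro mult_left_mono m_le_L) simp
  then have "\<delta> \<le> 1" unfolding \<delta>_def using \<gamma>_le by linarith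
  moreover have "\<delta> > 0" using \<gamma>_pos m_pos by (simp add: \<delta>_def)
  ultimately have \<delta>: "\<delta> > 0" "\<delta> \<le> 1" by auto
  have b: "b \<ge> 0" by (simp add: b_def)
  have qw: "quad_growth w" unfolding w_def by (intro quad_growth_diff quad_growth_U quad_growth_const)
  note [measurable] = quad_growth_measurable[OF qw]
  have drift: "ula_op \<gamma> w x \<le> (1 - \<delta>) * w x + b" for x
  proof -
    have "\<delta> * (U x - U 0) \<le> \<gamma> * (1 - \<gamma> * L / 2) * (norm (gradU x))\<^sup>2"
    proof -
      have "\<delta> * (U x - U 0) = \<gamma> * (1 / 2) * (2 * m * (U x - U 0))" by (simp add: \<delta>_def)
      also have "\<dots> \<le> \<gamma> * (1 / 2) * (norm (gradU x))\<^sup>2"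
        using \<gamma>_pos by (intro mult_left_mono polyak_lojasiewicz) auto
      also have "\<dots> \<le> \<gamma> * (1 - \<gamma> * L / 2) * (norm (gradU x))\<^sup>2"
        using \<gamma>_pos \<gamma>_le by (intro mult_right_mono mult_left_mono) auto
      finally show ?thesis .
    qed
    moreover have "ula_op \<gamma> w x = ula_op \<gamma> U x - c"
      unfolding ula_op_def w_def by (simp add: heat_diff quad_growth_U quad_growth_const heat_const)
    ultimately show ?thesis
      using ula_op_U_le[of \<gamma> x] \<gamma>_pos by (simp add: w_def b_def algebra_simps)
  qed
  \<comment> \<open>Large values are replaced by 0 instead of being capped. Where \<open>w\<close>
    exceeds \<open>n\<close>, the right side of the pointwise comparison below can be as small as 0,
    and a capped function would contribute \<delta> n - b, which is positive for large n.\<close>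
  define trunc where "trunc n x = (if w x \<le> real n then w x else 0)" for n x
  have [measurable]: "trunc n \<in> borel_measurable borel" for n unfolding trunc_def by measurable
  have trunc_bd: "0 \<le> trunc n x" "trunc n x \<le> real n" for n x using w0 by (auto simp: trunc_def)
  have int_bd: "integrable \<nu> f" if "f \<in> borel_measurable borel" "\<And>x. \<bar>f x\<bar> \<le> B" for f :: "'a \<Rightarrow> real" and B
    by (rule \<nu>.integrable_const_bound[of _ B]) (use that in auto)
  have mean: "(\<integral>x. trunc n x \<partial>\<nu>) \<le> b / \<delta>" for n
  proof -
    let ?M = "real n"
    have i1: "integrable \<nu> (\<lambda>x. min (w x) ?M)" by (rule int_bd[of _ ?M]) (use w0 in auto)
    have i2: "integrable \<nu> (\<lambda>x. min ((1 - \<delta>) * w x + b) ?M)"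
      by (rule int_bd[of _ ?M]) (use w0 b \<delta> in \<open>auto simp: add_nonneg_nonneg\<close>)
    have i3: "integrable \<nu> (trunc n)" by (rule int_bd[of _ ?M]) (use trunc_bd in auto)
    have "(\<integral>x. min (w x) ?M \<partial>\<nu>) = (\<integral>x. ula_op \<gamma> (\<lambda>x. min (w x) ?M) x \<partial>\<nu>)"
      by (rule integral_ula_op(2)[OF i1, symmetric])
    also have "\<dots> \<le> (\<integral>x. min ((1 - \<delta>) * w x + b) ?M \<partial>\<nu>)"
    proof (rule integral_mono[OF integral_ula_op(1)[OF i1] i2])
      fix x
      have qm: "quad_growth (\<lambda>x. min (w x) ?M)" by (rule quad_growth_bounded[of _ ?M]) (use w0 in auto)
      have "ula_op \<gamma> (\<lambda>x. min (w x) ?M) x \<le> ula_op \<gamma> w x"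
        unfolding ula_op_def by (intro heat_mono qm qw) simp
      moreover have "ula_op \<gamma> (\<lambda>x. min (w x) ?M) x \<le> ?M"
        unfolding ula_op_def using heat_mono[OF qm quad_growth_const[of ?M]] by (simp add: heat_const)
      ultimately show "ula_op \<gamma> (\<lambda>x. min (w x) ?M) x \<le> min ((1 - \<delta>) * w x + b) ?M"
        using drift[of x] by simp
    qed
    finally have "(\<integral>x. min (w x) ?M \<partial>\<nu>) - (\<integral>x. min ((1 - \<delta>) * w x + b) ?M \<partial>\<nu>) \<le> 0" by simp
    moreover have "\<delta> * (\<integral>x. trunc n x \<partial>\<nu>) - b = (\<integral>x. \<delta> * trunc n x - b \<partial>\<nu>)"
      using i3 \<nu>.prob_space by simp
    moreover have "\<dots> \<le> (\<integral>x. min (w x) ?M - min ((1 - \<delta>) * w x + b) ?M \<partial>\<nu>)"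
      using i1 i2 i3
    proof (intro integral_mono)
      fix x
      show "\<delta> * trunc n x - b \<le> min (w x) ?M - min ((1 - \<delta>) * w x + b) ?M"
        using b by (auto simp: trunc_def min_def algebra_simps)
    qed auto
    ultimately have "\<delta> * (\<integral>x. trunc n x \<partial>\<nu>) \<le> b" using i1 i2 by simp
    then show ?thesis using \<delta> by (simp add: pos_le_divide_eq mult.commute)
  qed
  have "(\<integral>\<^sup>+x. ennreal (w x) \<partial>\<nu>) \<le> (\<integral>\<^sup>+x. (SUP n. ennreal (trunc n x)) \<partial>\<nu>)"
  proof (rule nn_integral_mono)
    fix x
    obtain n :: nat where "w x \<le> real n" using real_arch_simple by blast
    then have "ennreal (w x) = ennreal (trunc n x)" by (simp add: trunc_def)
    then show "ennreal (w x) \<le> (SUP n. ennreal (trunc n x))" by (auto intro: SUP_upper)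
  qed
  also have "\<dots> = (SUP n. \<integral>\<^sup>+x. ennreal (trunc n x) \<partial>\<nu>)"
    by (rule nn_integral_monotone_convergence_SUP)
       (auto simp: incseq_def le_fun_def trunc_def w0 intro!: ennreal_leI)
  also have "\<dots> \<le> ennreal (b / \<delta>)"
  proof (rule SUP_least)
    fix n
    have "(\<integral>\<^sup>+x. ennreal (trunc n x) \<partial>\<nu>) = ennreal (\<integral>x. trunc n x \<partial>\<nu>)"
      by (rule nn_integral_eq_integral) (use trunc_bd in \<open>auto intro!: int_bd[of _ "real n"]\<close>)
    also have "\<dots> \<le> ennreal (b / \<delta>)" by (intro ennreal_leI mean)
    finally show "(\<integral>\<^sup>+x. ennreal (trunc n x) \<partial>\<nu>) \<le> ennreal (b / \<delta>)" .
  qed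
  finally have "integrable \<nu> w"
    by (intro integrableI_nonneg) (auto simp: w0 le_less_trans)
  then have "integrable \<nu> (\<lambda>x. w x + c)" by simp
  then show ?thesis by (simp add: w_def)
qed

lemma integrable_norm_sq: "integrable \<nu> (\<lambda>x. (norm x)\<^sup>2)"
proof (rule Bochner_Integration.integrable_bound)
  show "integrable \<nu> (\<lambda>x. (4 / m) * (U x - U 0 + (norm (gradU 0))\<^sup>2 / m))"
    using integrable_U by simp
  show "AE x in \<nu>. norm ((norm x)\<^sup>2) \<le> norm ((4 / m) * (U x - U 0 + (norm (gradU 0))\<^sup>2 / m))"
  proof (intro AE_I2)
    fix x
    have "(norm x)\<^sup>2 \<le> (4 / m) * (U x - U 0 + (norm (gradU 0))\<^sup>2 / m)"
      using U_lower[of x] m_pos by (simp add: field_simps)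
    then show "norm ((norm x)\<^sup>2) \<le> norm ((4 / m) * (U x - U 0 + (norm (gradU 0))\<^sup>2 / m))"
      by (simp only: real_norm_def abs_power2)
  qed
qed measurable

lemma quad_growth_integrable_stationary:
  assumes "quad_growth \<phi>" shows "integrable \<nu> \<phi>"
proof -
  obtain C where C: "\<phi> \<in> borel_measurable borel" "C \<ge> 0" "\<And>x. \<bar>\<phi> x\<bar> \<le> C * (1 + (norm x)\<^sup>2)"
    using assms by (rule quad_growthE) blast
  note [measurable] = C(1)
  have "integrable \<nu> (\<lambda>x. C * (1 + (norm x)\<^sup>2))" using integrable_norm_sq by simp
  then show ?thesis
    by (rule Bochner_Integration.integrable_bound)
       (use C(2,3) in \<open>auto intro!: AE_I2 intro: order_trans[OF _ abs_ge_self]\<close>)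
qed

lemma gradU_sq_integrable: "integrable \<nu> (\<lambda>x. (norm (gradU x))\<^sup>2)"
  using quad_growth_integrable_stationary[OF quad_growth_gradU[of 0]] by simp

text \<open>Integrating the one-step estimate for \<open>U\<close> against the stationary law, the
  mean of \<open>U\<close> cancels, and what is left bounds the mean squared gradient.\<close>

lemma gradU_sq_mean: "(1 - \<gamma> * L / 2) * (\<integral>x. (norm (gradU x))\<^sup>2 \<partial>\<nu>) \<le> L * real DIM('a)"
proof -
  have "(\<integral>x. U x \<partial>\<nu>) = (\<integral>x. ula_op \<gamma> U x \<partial>\<nu>)"
    by (rule integral_ula_op(2)[OF integrable_U, symmetric])
  also have "\<dots> \<le> (\<integral>x. U x - \<gamma> * (1 - \<gamma> * L / 2) * (norm (gradU x))\<^sup>2 + L * \<gamma> * real DIM('a) \<partial>\<nu>)"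
    by (intro integral_mono integral_ula_op(1) integrable_U ula_op_U_le)
       (use \<gamma>_pos integrable_U gradU_sq_integrable in auto)
  also have "\<dots> = (\<integral>x. U x \<partial>\<nu>) - \<gamma> * (1 - \<gamma> * L / 2) * (\<integral>x. (norm (gradU x))\<^sup>2 \<partial>\<nu>) + L * \<gamma> * real DIM('a)"
    using integrable_U gradU_sq_integrable \<nu>.prob_space by simp
  finally have "\<gamma> * ((1 - \<gamma> * L / 2) * (\<integral>x. (norm (gradU x))\<^sup>2 \<partial>\<nu>)) \<le> \<gamma> * (L * real DIM('a))"
    by (simp add: mult_ac)
  then show ?thesis using \<gamma>_pos by simp
qed

section \<open>Blocks of frozen drift and their accumulated error\<close>

text \<open>Half of the bound in \<open>sum_frozen_error_le\<close> for N \<eta> = \<gamma>; the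
  half is the one in the error term of \<open>penalty_step\<close>.\<close>

definition block_error :: "'a \<Rightarrow> real" where
  "block_error x = L\<^sup>2 / 2 * (\<gamma> ^ 3 / 3 * (norm (gradU x))\<^sup>2 + \<gamma>\<^sup>2 * real DIM('a))"

text \<open>The factor \<open>r\<close> stands for the contraction over one block of length
  \<gamma>, so the error of a block with \<open>n\<close> further blocks to go is discounted by
  \<open>r ^ n\<close>.\<close>

primrec lower_value :: "real \<Rightarrow> ('a \<Rightarrow> real) \<Rightarrow> nat \<Rightarrow> 'a \<Rightarrow> real" where
  "lower_value r f 0 = f"
| "lower_value r f (Suc n) = (\<lambda>x. ula_op \<gamma> (lower_value r f n) x - r ^ n * block_error x)"

lemma quad_growth_block_error: "quad_growth block_error"
  unfolding block_error_def[abs_def] using quad_growth_gradU[of 0]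
  by (intro quad_growth_cmult quad_growth_add quad_growth_const) simp_all

lemma block_error_nonneg: "block_error x \<ge> 0"
  using \<gamma>_pos by (simp add: block_error_def)

lemma quad_growth_lower_value:
  assumes "quad_growth f"
  shows "quad_growth (lower_value r f n)"
  using assms \<gamma>_pos
  by (induction n) (auto intro!: quad_growth_diff quad_growth_ula_op quad_growth_cmult quad_growth_block_error)

text \<open>By stationarity each \<open>ula_op \<gamma>\<close> disappears under the integral; only
  the geometric series of errors survives.\<close>

lemma integral_lower_value:
  assumes "quad_growth f"
  shows "(\<integral>x. lower_value r f n x \<partial>\<nu>) = (\<integral>x. f x \<partial>\<nu>) - (\<Sum>i<n. r ^ i) * (\<integral>x. block_error x \<partial>\<nu>)"
proof (induction n)
  case (Suc n)
  have i: "integrable \<nu> (lower_value r f n)" "integrable \<nu> block_error"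
    by (auto intro!: quad_growth_integrable_stationary quad_growth_lower_value quad_growth_block_error assms)
  show ?case
    using i integral_ula_op[OF i(1)] Suc by (simp add: algebra_simps)
qed simp

text \<open>With the drift frozen at the block's starting point \<open>x\<close>, N substeps compose
  to exactly one step of size \<gamma>, so \<open>ula_op \<gamma>\<close> reappears. Only the
  compared chain, started at \<open>z\<close>, has the step size \<eta>.\<close>

lemma coupling_blocks:
  assumes N: "N > 0" and \<eta>: "\<eta> = \<gamma> / real N" and l: "0 < l" "l < 1" and r: "l ^ N \<le> r"
    and contr: "\<And>x y. norm (x - y - \<eta> *\<^sub>R (gradU x - gradU y)) \<le> l * norm (x - y)"
    and f: "f \<in> borel_measurable borel" "\<And>x. \<bar>f x\<bar> \<le> B"
  shows "(penalty \<eta> l (n * N) = 0 \<Longrightarrow> x = z) \<Longrightarrow>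
    lower_value r f n x - (norm (x - z))\<^sup>2 / penalty \<eta> l (n * N) \<le> log_op \<eta> f (n * N) z"
proof (induction n arbitrary: x z)
  \<comment> \<open>The penalty is 0, so the premise gives \<open>x = z\<close>; division by 0 then
    leaves \<open>f x \<le> f x\<close>.\<close>
  case 0
  then show ?case by (simp add: log_op_def penalty_def)
next
  case (Suc n)
  have \<eta>_pos: "\<eta> > 0" and N\<eta>: "real N * \<eta> = \<gamma>" using \<gamma>_pos N \<eta> by auto
  have qf: "quad_growth f" by (rule quad_growth_bounded[OF f])
  let ?E = "\<lambda>y. (norm (gradU y - gradU x))\<^sup>2"
  let ?S = "\<Sum>i<N. heat (real i * \<eta>) ?E (x - (real i * \<eta>) *\<^sub>R gradU x)"
  have idx: "n * N + N = Suc n * N" by simp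
  have "heat (real N * \<eta>) (lower_value r f n) (x - (real N * \<eta>) *\<^sub>R gradU x) - l ^ (n * N) / 2 * \<eta> * ?S
    - (norm (x - z))\<^sup>2 / penalty \<eta> l (n * N + N) \<le> log_op \<eta> f (n * N + N) z"
    by (rule coupling_frozen_steps[OF \<eta>_pos l contr f quad_growth_lower_value[OF qf] Suc.IH])
       (use Suc.prems in \<open>simp_all add: add.commute\<close>)
  moreover have "l ^ (n * N) / 2 * \<eta> * ?S \<le> r ^ n * block_error x"
  proof -
    have "l ^ (n * N) = (l ^ N) ^ n" by (simp add: power_mult mult.commute)
    also have "\<dots> \<le> r ^ n" using l r by (intro power_mono) auto
    finally have ln: "l ^ (n * N) \<le> r ^ n" .
    have "\<eta> * ?S \<le> 2 * block_error x"
      using sum_frozen_error_le[OF \<eta>_pos, where N = N and x = x] unfolding N\<eta> by (simp add: block_error_def)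
    then have "l ^ (n * N) * (\<eta> * ?S) \<le> l ^ (n * N) * (2 * block_error x)"
      using l by (intro mult_left_mono) auto
    also have "\<dots> \<le> r ^ n * (2 * block_error x)"
      using ln block_error_nonneg by (intro mult_right_mono) auto
    finally show ?thesis by simp
  qed
  ultimately show ?case
    unfolding idx N\<eta> by (simp add: ula_op_def)
qed

end

section \<open>Bias of small steps under the Gibbs measure\<close>

lemma integrable_pair_fst:
  fixes f :: "'a \<Rightarrow> real"
  assumes "prob_space N" "integrable M f"
  shows "integrable (M \<Otimes>\<^sub>M N) (\<lambda>p. f (fst p))"
proof -
  have "integrable (distr (M \<Otimes>\<^sub>M N) M fst) f"
    unfolding prob_space.distr_pair_fst[OF assms(1)] by (rule assms(2))
  then show ?thesis by (rule integrable_distr[rotated]) simp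
qed

lemma integrable_pair_snd:
  fixes f :: "'b \<Rightarrow> real"
  assumes "prob_space M" "prob_space N" "integrable N f"
  shows "integrable (M \<Otimes>\<^sub>M N) (\<lambda>p. f (snd p))"
proof -
  interpret M: prob_space M by fact
  interpret N: prob_space N by fact
  interpret pair_sigma_finite N M ..
  show ?thesis
    using integrable_product_swap[OF integrable_pair_fst[OF assms(1,3)]] by (simp add: case_prod_unfold)
qed

text \<open>The sum of both exponentials, instead of their maximum, keeps the bound linear and
  symmetric: after exchanging the variables the two parts have equal integrals.\<close>

lemma abs_exp_diff_le: "\<bar>exp s - exp t\<bar> \<le> \<bar>s - t\<bar> * (exp s + exp (t::real))"
proof -
  have *: "exp b - exp a \<le> \<bar>b - a\<bar> * (exp b + exp a)" if "a \<le> b" for a b :: real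
  proof -
    have "exp b - exp a = exp b * (1 - exp (a - b))" by (simp add: exp_diff right_diff_distrib)
    also have "1 - exp (a - b) \<le> b - a"
      using exp_ge_add_one_self[of "a - b"] by linarith
    then have "exp b * (1 - exp (a - b)) \<le> exp b * (b - a)"
      by (intro mult_left_mono) auto
    also have "\<dots> \<le> (b - a) * (exp b + exp a)"
      using that by (simp add: algebra_simps)
    finally show ?thesis using that by simp
  qed
  show ?thesis
    using *[of s t] *[of t s] by (cases "s \<le> t") (auto simp: abs_minus_commute add.commute abs_if)
qed

lemma power3_sum_le:
  fixes a b c :: real
  assumes "a \<ge> 0" "b \<ge> 0" "c \<ge> 0"
  shows "(a + b + c) ^ 3 \<le> 27 * (a ^ 3 + b ^ 3 + c ^ 3)"
proof -
  define M where "M = max a (max b c)"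
  have "(a + b + c) ^ 3 \<le> (3 * M) ^ 3"
    using assms by (intro power_mono) (auto simp: M_def)
  also have "\<dots> = 27 * M ^ 3" by (simp add: power_mult_distrib)
  also have "M ^ 3 \<le> a ^ 3 + b ^ 3 + c ^ 3"
    using assms by (auto simp: M_def max_def)
  finally show ?thesis by simp
qed

context strongly_convex_potential
begin

definition gibbs_const :: real where
  "gibbs_const = (\<integral>x. exp (- U x) \<partial>lborel)"

definition gibbs :: "'a measure" where
  "gibbs = density lborel (\<lambda>x. ennreal (exp (- U x) / gibbs_const))"

lemma integrable_norm_power_gibbs_weight: "integrable lborel (\<lambda>x. norm x ^ k * exp (- U x))"
proof (rule Bochner_Integration.integrable_bound)
  let ?C = "exp ((norm (gradU 0))\<^sup>2 / m - U 0)"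
  show "integrable lborel (\<lambda>x::'a. ?C * (norm x ^ k * exp (- (m / 4) * (norm x)\<^sup>2)))"
    using m_pos by (intro integrable_mult_right integrable_norm_power_exp) simp
  show "AE x in lborel. norm (norm x ^ k * exp (- U x)) \<le> norm (?C * (norm x ^ k * exp (- (m / 4) * (norm x)\<^sup>2)))"
  proof (intro AE_I2)
    fix x
    have "exp (- U x) \<le> exp ((norm (gradU 0))\<^sup>2 / m - U 0 + - (m / 4) * (norm x)\<^sup>2)"
      using U_lower[of x] by simp
    also have "\<dots> = ?C * exp (- (m / 4) * (norm x)\<^sup>2)" by (rule exp_add)
    finally have "norm x ^ k * exp (- U x) \<le> norm x ^ k * (?C * exp (- (m / 4) * (norm x)\<^sup>2))"
      by (intro mult_left_mono) auto
    then show "norm (norm x ^ k * exp (- U x)) \<le> norm (?C * (norm x ^ k * exp (- (m / 4) * (norm x)\<^sup>2)))"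
      by (simp add: abs_mult mult.left_commute)
  qed
qed measurable

lemma integrable_gibbs_weight: "integrable lborel (\<lambda>x. exp (- U x))"
  using integrable_norm_power_gibbs_weight[of 0] by simp

lemma gibbs_const_pos: "gibbs_const > 0"
proof -
  have "gibbs_const \<ge> 0" unfolding gibbs_const_def by (intro integral_nonneg_AE) auto
  moreover have "gibbs_const \<noteq> 0"
  proof
    assume "gibbs_const = 0"
    then have "AE x in (lborel :: 'a measure). exp (- U x) = 0"
      unfolding gibbs_const_def by (subst (asm) integral_nonneg_eq_0_iff_AE[OF integrable_gibbs_weight]) auto
    then have "AE x in (lborel :: 'a measure). False" by simp
    then have "ae_filter (lborel :: 'a measure) = bot" by (simp add: trivial_limit_def[symmetric] eventually_False)
    then show False by (simp add: ae_filter_eq_bot_iff)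
  qed
  ultimately show ?thesis by simp
qed

lemma sets_gibbs [simp, measurable_cong]: "sets gibbs = sets borel"
  by (simp add: gibbs_def)

lemma space_gibbs [simp]: "space gibbs = UNIV"
  by (simp add: gibbs_def)

lemma nn_integral_gibbs_weight: "(\<integral>\<^sup>+x. ennreal (exp (- U x)) \<partial>lborel) = ennreal gibbs_const"
  unfolding gibbs_const_def by (intro nn_integral_eq_integral integrable_gibbs_weight) auto

lemma prob_space_gibbs: "prob_space gibbs"
proof
  have "emeasure gibbs (space gibbs) = (\<integral>\<^sup>+x. ennreal (1 / gibbs_const) * ennreal (exp (- U x)) \<partial>lborel)"
    unfolding gibbs_def using gibbs_const_pos
    by (subst emeasure_density) (auto simp: ennreal_mult[symmetric] intro!: nn_integral_cong)
  also have "\<dots> = ennreal (1 / gibbs_const) * ennreal gibbs_const"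
    by (subst nn_integral_cmult) (auto simp: nn_integral_gibbs_weight)
  also have "\<dots> = 1"
    using gibbs_const_pos by (simp add: ennreal_mult''[symmetric])
  finally show "emeasure gibbs (space gibbs) = 1" .
qed

sublocale gibbs: prob_space gibbs by (rule prob_space_gibbs)

sublocale gibbs_pair: pair_prob_space gibbs "std_gauss :: 'a measure" ..

lemma integrable_gibbs_norm_power: "integrable gibbs (\<lambda>x. norm x ^ k)"
proof -
  have "integrable lborel (\<lambda>x. (1 / gibbs_const) * (norm x ^ k * exp (- U x)))"
    by (intro integrable_mult_right integrable_norm_power_gibbs_weight)
  then show ?thesis
    unfolding gibbs_def using gibbs_const_pos
    by (subst integrable_density) (auto simp: mult.commute)
qed

text \<open>Logarithm, up to a constant, of the joint density of a point \<open>x\<close> from the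
  Gibbs measure and its successor \<open>y\<close>. Detailed balance would be symmetry in
  \<open>x\<close> and \<open>y\<close>.\<close>

definition energy :: "real \<Rightarrow> 'a \<Rightarrow> 'a \<Rightarrow> real" where
  "energy \<eta> x y = - U x - (norm (y - (x - \<eta> *\<^sub>R gradU x)))\<^sup>2 / (4 * \<eta>)"

definition joint_const :: "real \<Rightarrow> real" where
  "joint_const \<eta> = (1 / sqrt (2 * \<eta>)) ^ DIM('a) / (gibbs_const * sqrt ((2 * pi) ^ DIM('a)))"

definition joint_density :: "real \<Rightarrow> 'a \<times> 'a \<Rightarrow> real" where
  "joint_density \<eta> p = joint_const \<eta> * exp (energy \<eta> (fst p) (snd p))"

definition joint_map :: "real \<Rightarrow> 'a \<times> 'a \<Rightarrow> 'a \<times> 'a" where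
  "joint_map \<eta> p = (fst p, fst p - \<eta> *\<^sub>R gradU (fst p) + sqrt (2 * \<eta>) *\<^sub>R snd p)"

lemma joint_measurable [measurable]:
  "joint_density \<eta> \<in> borel_measurable (borel \<Otimes>\<^sub>M borel)"
  "joint_map \<eta> \<in> borel \<Otimes>\<^sub>M borel \<rightarrow>\<^sub>M borel \<Otimes>\<^sub>M borel"
  unfolding joint_density_def[abs_def] joint_map_def[abs_def] energy_def by measurable

lemma joint_const_pos: "\<eta> > 0 \<Longrightarrow> joint_const \<eta> > 0"
  using gibbs_const_pos by (simp add: joint_const_def)

lemma distr_joint:
  assumes \<eta>: "\<eta> > 0"
  shows "distr (gibbs \<Otimes>\<^sub>M std_gauss) (borel \<Otimes>\<^sub>M borel) (joint_map \<eta>) =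
    density (lborel \<Otimes>\<^sub>M lborel) (\<lambda>p. ennreal (joint_density \<eta> p))" (is "?L = ?R")
proof (rule measure_eqI)
  fix A assume "A \<in> sets ?L"
  then have [measurable]: "A \<in> sets (borel \<Otimes>\<^sub>M borel)" by simp
  let ?\<sigma> = "sqrt (2 * \<eta>)"
  have \<sigma>: "?\<sigma> > 0" using \<eta> by simp
  have dens: "exp (- U x) / gibbs_const * ((1 / ?\<sigma>) ^ DIM('a) * gauss_density ((1 / ?\<sigma>) *\<^sub>R (y - (x - \<eta> *\<^sub>R gradU x))))
     = joint_density \<eta> (x, y)" for x y
  proof -
    have "exp (energy \<eta> x y) = exp (- U x) * exp (- (norm (y - (x - \<eta> *\<^sub>R gradU x)))\<^sup>2 / (4 * \<eta>))"
      by (simp add: energy_def exp_add[symmetric])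
    moreover have "(norm ((1 / ?\<sigma>) *\<^sub>R (y - (x - \<eta> *\<^sub>R gradU x))))\<^sup>2 / 2 = (norm (y - (x - \<eta> *\<^sub>R gradU x)))\<^sup>2 / (4 * \<eta>)"
      using \<eta> by (simp add: power_divide)
    ultimately show ?thesis
      by (simp add: joint_density_def joint_const_def gauss_density_def del: norm_scaleR)
  qed
  have "emeasure ?L A = (\<integral>\<^sup>+p. indicator A (joint_map \<eta> p) \<partial>(gibbs \<Otimes>\<^sub>M std_gauss))"
    by (subst nn_integral_indicator[symmetric], simp, subst nn_integral_distr) auto
  also have "\<dots> = (\<integral>\<^sup>+x. \<integral>\<^sup>+w. indicator A (x, (x - \<eta> *\<^sub>R gradU x) + ?\<sigma> *\<^sub>R w) \<partial>std_gauss \<partial>gibbs)"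
    by (subst std_gauss.nn_integral_fst[symmetric]) (auto simp: joint_map_def)
  also have "\<dots> = (\<integral>\<^sup>+x. ennreal ((1 / ?\<sigma>) ^ DIM('a)) *
     (\<integral>\<^sup>+y. ennreal (gauss_density ((1 / ?\<sigma>) *\<^sub>R (y - (x - \<eta> *\<^sub>R gradU x)))) * indicator A (x, y) \<partial>lborel) \<partial>gibbs)"
    by (intro nn_integral_cong nn_integral_std_gauss_scaled[OF _ \<sigma>]) simp
  also have "\<dots> = (\<integral>\<^sup>+x. ennreal (exp (- U x) / gibbs_const) * (ennreal ((1 / ?\<sigma>) ^ DIM('a)) *
     (\<integral>\<^sup>+y. ennreal (gauss_density ((1 / ?\<sigma>) *\<^sub>R (y - (x - \<eta> *\<^sub>R gradU x)))) * indicator A (x, y) \<partial>lborel)) \<partial>lborel)"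
    unfolding gibbs_def by (subst nn_integral_density) auto
  also have "\<dots> = (\<integral>\<^sup>+x. \<integral>\<^sup>+y. ennreal (joint_density \<eta> (x, y)) * indicator A (x, y) \<partial>lborel \<partial>lborel)"
    using gibbs_const_pos \<sigma>
    by (intro nn_integral_cong)
       (simp add: nn_integral_cmult[symmetric] dens[symmetric] ennreal_mult[symmetric] mult.assoc[symmetric]
         less_imp_le[OF gauss_density_pos])
  also have "\<dots> = emeasure ?R A"
    by (subst emeasure_density, simp, simp, subst lborel.nn_integral_fst[symmetric]) auto
  finally show "emeasure ?L A = emeasure ?R A" .
qed simp

text \<open>The asymmetry is the error of the trapezoidal rule for \<open>U y - U x\<close>, plus
  \<eta> / 4 times the difference of the squared gradients. Convexity puts \<open>U y - U x\<close>
  between the two endpoint slopes, so the trapezoidal error is at most half their difference, hence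
  quadratic in \<open>y - x\<close>.\<close>

lemma energy_asym:
  assumes \<eta>: "\<eta> > 0"
  shows "\<bar>energy \<eta> x y - energy \<eta> y x\<bar> \<le> L / 2 * (norm (y - x))\<^sup>2
    + \<eta> / 4 * (L * norm (y - x) * (2 * norm (gradU x) + L * norm (y - x)))"
proof -
  define h where "h = y - x"
  define gx gy where "gx = gradU x" and "gy = gradU y"
  have lip: "norm (gy - gx) \<le> L * norm h" using lipschitz[of y x] by (simp add: h_def gx_def gy_def)
  have 1: "y - (x - \<eta> *\<^sub>R gradU x) = h + \<eta> *\<^sub>R gx" and 2: "x - (y - \<eta> *\<^sub>R gradU y) = \<eta> *\<^sub>R gy - h"
    by (simp_all add: h_def gx_def gy_def)
  have "(norm (h + \<eta> *\<^sub>R gx))\<^sup>2 - (norm (\<eta> *\<^sub>R gy - h))\<^sup>2 =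
      4 * \<eta> * (1 / 2 * (h \<bullet> (gx + gy)) + \<eta> / 4 * ((norm gx)\<^sup>2 - (norm gy)\<^sup>2))"
    unfolding power2_norm_eq_inner
    by (simp add: inner_add inner_diff inner_commute algebra_simps)
  then have "(norm (h + \<eta> *\<^sub>R gx))\<^sup>2 / (4 * \<eta>) - (norm (\<eta> *\<^sub>R gy - h))\<^sup>2 / (4 * \<eta>) =
      1 / 2 * (h \<bullet> (gx + gy)) + \<eta> / 4 * ((norm gx)\<^sup>2 - (norm gy)\<^sup>2)"
    unfolding diff_divide_distrib[symmetric] using \<eta> by simp
  then have e: "energy \<eta> x y - energy \<eta> y x =
      (U y - U x - 1 / 2 * (h \<bullet> (gx + gy))) + \<eta> / 4 * ((norm gy)\<^sup>2 - (norm gx)\<^sup>2)"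
    unfolding energy_def 1 2 by (simp add: algebra_simps)
  have "\<bar>U y - U x - 1 / 2 * (h \<bullet> (gx + gy))\<bar> \<le> 1 / 2 * ((gy - gx) \<bullet> h)"
  proof -
    have "0 \<le> m / 2 * (norm (x - y))\<^sup>2" "0 \<le> m / 2 * (norm (y - x))\<^sup>2" using m_pos by auto
    then have "gx \<bullet> h \<le> U y - U x" "U y - U x \<le> gy \<bullet> h"
      using strong_convex[of x y] strong_convex[of y x] unfolding h_def gx_def gy_def
      by (simp_all add: inner_diff_right)
    moreover have "h \<bullet> (gx + gy) = gx \<bullet> h + gy \<bullet> h" "(gy - gx) \<bullet> h = gy \<bullet> h - gx \<bullet> h"
      by (simp_all add: inner_commute[of h] inner_add_left inner_diff_left)
    ultimately show ?thesis by linarith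
  qed
  also have "(gy - gx) \<bullet> h \<le> norm (gy - gx) * norm h" by (rule norm_cauchy_schwarz)
  also have "\<dots> \<le> (L * norm h) * norm h" by (intro mult_right_mono lip) auto
  finally have A: "\<bar>U y - U x - 1 / 2 * (h \<bullet> (gx + gy))\<bar> \<le> L / 2 * (norm h)\<^sup>2"
    by (simp add: power2_eq_square)
  have "(norm gy)\<^sup>2 - (norm gx)\<^sup>2 = (norm gy - norm gx) * (norm gy + norm gx)"
    by (simp add: power2_eq_square algebra_simps)
  then have "\<bar>(norm gy)\<^sup>2 - (norm gx)\<^sup>2\<bar> = \<bar>norm gy - norm gx\<bar> * (norm gy + norm gx)"
    by (simp add: abs_mult)
  also have "\<dots> \<le> (L * norm h) * (2 * norm gx + L * norm h)"
  proof (rule mult_mono)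
    show d: "\<bar>norm gy - norm gx\<bar> \<le> L * norm h" using norm_triangle_ineq3[of gy gx] lip by linarith
    then show "norm gy + norm gx \<le> 2 * norm gx + L * norm h" by linarith
  qed (use L_pos in auto)
  finally have "\<eta> / 4 * \<bar>(norm gy)\<^sup>2 - (norm gx)\<^sup>2\<bar> \<le> \<eta> / 4 * ((L * norm h) * (2 * norm gx + L * norm h))"
    using \<eta> by (intro mult_left_mono) auto
  moreover have "\<bar>\<eta> / 4 * ((norm gy)\<^sup>2 - (norm gx)\<^sup>2)\<bar> = \<eta> / 4 * \<bar>(norm gy)\<^sup>2 - (norm gx)\<^sup>2\<bar>"
    using \<eta> by (simp add: abs_mult)
  ultimately show ?thesis
    unfolding e h_def[symmetric] gx_def[symmetric] using A by linarith
qed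

text \<open>For \<eta> <= 1 a step moves by at most sqrt \<eta> times this weight; the factor 2
  covers the sqrt 2 in front of the noise.\<close>

definition bias_weight :: "'a \<times> 'a \<Rightarrow> real" where
  "bias_weight p = norm (gradU (fst p)) + 2 * norm (snd p)"

lemma bias_weight_cube_integrable: "integrable (gibbs \<Otimes>\<^sub>M std_gauss) (\<lambda>p. bias_weight p ^ 3)"
proof (rule Bochner_Integration.integrable_bound)
  let ?F = "\<lambda>p :: 'a \<times> 'a. 27 * (norm (gradU 0) ^ 3 + L ^ 3 * norm (fst p) ^ 3 + 8 * norm (snd p) ^ 3)"
  show "integrable (gibbs \<Otimes>\<^sub>M std_gauss) ?F"
    by (intro integrable_mult_right Bochner_Integration.integrable_add gibbs_pair.integrable_const
       integrable_pair_fst integrable_pair_snd prob_space_gibbs prob_space_std_gauss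
       integrable_gibbs_norm_power integrable_std_gauss_norm_power)
  show "AE p in gibbs \<Otimes>\<^sub>M std_gauss. norm (bias_weight p ^ 3) \<le> norm (?F p)"
  proof (intro AE_I2)
    fix p :: "'a \<times> 'a"
    have "bias_weight p ^ 3 \<le> (norm (gradU 0) + L * norm (fst p) + 2 * norm (snd p)) ^ 3"
      unfolding bias_weight_def using norm_gradU_le[of "fst p"] by (intro power_mono) auto
    also have "\<dots> \<le> 27 * (norm (gradU 0) ^ 3 + (L * norm (fst p)) ^ 3 + (2 * norm (snd p)) ^ 3)"
      using L_pos by (intro power3_sum_le) auto
    also have "\<dots> = ?F p" by (simp add: power_mult_distrib)
    finally have "bias_weight p ^ 3 \<le> ?F p" .
    moreover have "bias_weight p ^ 3 \<ge> 0" by (simp add: bias_weight_def)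
    ultimately show "norm (bias_weight p ^ 3) \<le> norm (?F p)" by simp
  qed
qed (simp add: bias_weight_def[abs_def])

definition bias_const :: real where
  "bias_const = (L + L\<^sup>2 / 4) * (\<integral>p. bias_weight p ^ 3 \<partial>(gibbs \<Otimes>\<^sub>M std_gauss))"

text \<open>One factor sqrt \<eta> and one power of the weight come from the displacement, a factor
  \<eta> and two powers from the asymmetry. This explains the third moment in
  \<open>bias_const\<close>, which does not depend on \<eta>.\<close>

lemma joint_map_bound:
  fixes p :: "'a \<times> 'a"
  assumes \<eta>: "\<eta> > 0" "\<eta> \<le> 1"
  defines "x \<equiv> fst (joint_map \<eta> p)" and "y \<equiv> snd (joint_map \<eta> p)"
  shows "norm (y - x) * \<bar>energy \<eta> x y - energy \<eta> y x\<bar> \<le> \<eta> * sqrt \<eta> * ((L + L\<^sup>2 / 4) * bias_weight p ^ 3)"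
proof -
  define s q where "s = bias_weight p" and "q = sqrt \<eta>"
  have q: "0 < q" "q \<le> 1" "q\<^sup>2 = \<eta>" using \<eta> by (auto simp: q_def)
  have s: "s \<ge> 0" "norm (gradU x) \<le> s" by (auto simp: s_def bias_weight_def x_def joint_map_def)
  have yx: "y - x = sqrt (2 * \<eta>) *\<^sub>R snd p - \<eta> *\<^sub>R gradU x"
    by (simp add: x_def y_def joint_map_def)
  have "norm (y - x) \<le> sqrt (2 * \<eta>) * norm (snd p) + \<eta> * norm (gradU x)"
    unfolding yx using norm_triangle_ineq4[of "sqrt (2 * \<eta>) *\<^sub>R snd p" "\<eta> *\<^sub>R gradU x"] \<eta> by simp
  also have "\<dots> \<le> (2 * q) * norm (snd p) + q * norm (gradU x)"
  proof (intro add_mono mult_right_mono)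
    have "sqrt 2 \<le> 2" by (rule real_le_lsqrt) auto
    then show "sqrt (2 * \<eta>) \<le> 2 * q" using \<eta> by (simp add: real_sqrt_mult q_def)
    have "q * q \<le> q * 1" using q by (intro mult_left_mono) auto
    then show "\<eta> \<le> q" using q(3) by (simp add: power2_eq_square)
  qed auto
  also have "\<dots> = q * s" by (simp add: s_def bias_weight_def x_def joint_map_def algebra_simps)
  finally have h: "norm (y - x) \<le> q * s" .
  have hs: "norm (y - x) \<le> s"
    using h mult_right_mono[OF q(2) s(1)] by simp
  have "\<bar>energy \<eta> x y - energy \<eta> y x\<bar> \<le> L / 2 * (norm (y - x))\<^sup>2
    + \<eta> / 4 * (L * norm (y - x) * (2 * norm (gradU x) + L * norm (y - x)))"
    by (rule energy_asym[OF \<eta>(1)])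
  also have "\<dots> \<le> L / 2 * (q * s)\<^sup>2 + \<eta> / 4 * (L * s * (2 * s + L * s))"
    using L_pos \<eta> h hs s by (intro add_mono mult_left_mono mult_mono power_mono) auto
  also have "\<dots> = \<eta> * ((L + L\<^sup>2 / 4) * s\<^sup>2)"
    unfolding power_mult_distrib q(3) by (simp add: power2_eq_square field_simps)
  finally have "norm (y - x) * \<bar>energy \<eta> x y - energy \<eta> y x\<bar> \<le> (q * s) * (\<eta> * ((L + L\<^sup>2 / 4) * s\<^sup>2))"
    using h q s by (intro mult_mono) auto
  also have "\<dots> = \<eta> * q * ((L + L\<^sup>2 / 4) * s ^ 3)"
    by (simp add: power2_eq_square power3_eq_cube)
  finally show ?thesis unfolding s_def q_def .
qed

text \<open>Symmetrising in \<open>(x, y)\<close> leaves the defect of detailed balance, of order \<open>\<eta>\<close>,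
  times \<open>g y - g x\<close>, of order \<open>sqrt \<eta>\<close>: the bias of one step is \<open>o(\<eta>)\<close>.\<close>

lemma one_step_bias:
  assumes \<eta>: "\<eta> > 0" "\<eta> \<le> 1" and M: "M \<ge> 0"
    and g: "g \<in> borel_measurable borel" "\<And>x. \<bar>g x\<bar> \<le> B"
    and lip: "\<And>x y. \<bar>g x - g y\<bar> \<le> M * norm (x - y)"
  shows "\<bar>(\<integral>x. ula_op \<eta> g x \<partial>gibbs) - (\<integral>x. g x \<partial>gibbs)\<bar> \<le> M * bias_const * (\<eta> * sqrt \<eta>)"
proof -
  note [measurable] = g(1)
  let ?J = "density (lborel \<Otimes>\<^sub>M lborel) (\<lambda>p. ennreal (joint_density \<eta> p))"
  let ?P = "gibbs \<Otimes>\<^sub>M (std_gauss :: 'a measure)"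
  let ?k = "joint_density \<eta>"
  define D where "D p = g (snd p) - g (fst p)" for p :: "'a \<times> 'a"
  define W where "W p = norm (snd p - fst p) * \<bar>energy \<eta> (fst p) (snd p) - energy \<eta> (snd p) (fst p)\<bar>" for p :: "'a \<times> 'a"
  have [measurable]: "D \<in> borel_measurable (borel \<Otimes>\<^sub>M borel)" unfolding D_def[abs_def] by measurable
  have [measurable]: "W \<in> borel_measurable (borel \<Otimes>\<^sub>M borel)"
    unfolding W_def[abs_def] energy_def by measurable
  have k_nonneg: "?k p \<ge> 0" for p using joint_const_pos[OF \<eta>(1)] by (simp add: joint_density_def)
  have W_nonneg: "W p \<ge> 0" for p by (simp add: W_def)
  have gI: "integrable gibbs g" by (rule gibbs.integrable_const_bound[of _ B]) (use g(2) in auto)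
  have bd: "\<bar>D p\<bar> \<le> B + B" for p using g(2)[of "fst p"] g(2)[of "snd p"] unfolding D_def by linarith
  have DI: "integrable ?P (\<lambda>p. D (joint_map \<eta> p))"
    by (rule gibbs_pair.integrable_const_bound[of _ "B + B"]) (use bd in auto)
  have WI: "integrable ?P (\<lambda>p. W (joint_map \<eta> p))"
  proof (rule Bochner_Integration.integrable_bound)
    show "integrable ?P (\<lambda>p. \<eta> * sqrt \<eta> * ((L + L\<^sup>2 / 4) * bias_weight p ^ 3))"
      by (intro integrable_mult_right bias_weight_cube_integrable)
    show "AE p in ?P. norm (W (joint_map \<eta> p)) \<le> norm (\<eta> * sqrt \<eta> * ((L + L\<^sup>2 / 4) * bias_weight p ^ 3))"
      using joint_map_bound[OF \<eta>] W_nonneg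
      by (intro AE_I2) (simp only: real_norm_def abs_of_nonneg W_nonneg, unfold W_def, rule order_trans[OF _ abs_ge_self])
  qed simp
  \<comment> \<open>Integrals over starting point and noise become Lebesgue integrals over pairs (x,
    y), where exchanging the coordinates preserves the reference measure.\<close>
  have to_J: "integrable (lborel \<Otimes>\<^sub>M lborel) (\<lambda>p. ?k p * F p) \<and>
     (\<integral>p. F (joint_map \<eta> p) \<partial>?P) = (\<integral>p. ?k p * F p \<partial>(lborel \<Otimes>\<^sub>M lborel))"
    if [measurable]: "F \<in> borel_measurable (borel \<Otimes>\<^sub>M borel)" and "integrable ?P (\<lambda>p. F (joint_map \<eta> p))" for F :: "'a \<times> 'a \<Rightarrow> real"
  proof -
    have "integrable (distr ?P (borel \<Otimes>\<^sub>M borel) (joint_map \<eta>)) F"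
      by (subst integrable_distr_eq) (use that in auto)
    then have "integrable ?J F" unfolding distr_joint[OF \<eta>(1)] .
    then have "integrable (lborel \<Otimes>\<^sub>M lborel) (\<lambda>p. ?k p * F p)"
      by (subst (asm) integrable_density) (auto simp: k_nonneg)
    moreover have "(\<integral>p. F (joint_map \<eta> p) \<partial>?P) = integral\<^sup>L (distr ?P (borel \<Otimes>\<^sub>M borel) (joint_map \<eta>)) F"
      by (subst integral_distr) auto
    moreover have "\<dots> = (\<integral>p. ?k p * F p \<partial>(lborel \<Otimes>\<^sub>M lborel))"
      unfolding distr_joint[OF \<eta>(1)] by (subst integral_density) (auto simp: k_nonneg)
    ultimately show ?thesis by simp
  qed
  have swapI: "integrable (lborel \<Otimes>\<^sub>M lborel) (\<lambda>p. F (snd p, fst p))"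
    "(\<integral>p. F (snd p, fst p) \<partial>(lborel \<Otimes>\<^sub>M lborel)) = (\<integral>p. F p \<partial>(lborel \<Otimes>\<^sub>M lborel))"
    if "integrable (lborel \<Otimes>\<^sub>M lborel) F" for F :: "'a \<times> 'a \<Rightarrow> real"
    using lborel_pair.integrable_product_swap[OF that]
      lborel_pair.integral_product_swap[of F] borel_measurable_integrable[OF that]
    by (simp_all add: case_prod_unfold)
  let ?I = "(\<integral>x. ula_op \<eta> g x \<partial>gibbs) - (\<integral>x. g x \<partial>gibbs)"
  have "?I = (\<integral>p. D (joint_map \<eta> p) \<partial>?P)"
  proof -
    have i: "integrable ?P (\<lambda>p. g (snd (joint_map \<eta> p)))" "integrable ?P (\<lambda>p. g (fst p))"
      by (rule gibbs_pair.integrable_const_bound[of _ B]; use g(2) in auto)+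
    have "(\<integral>x. ula_op \<eta> g x \<partial>gibbs) = (\<integral>x. \<integral>w. g (snd (joint_map \<eta> (x, w))) \<partial>std_gauss \<partial>gibbs)"
      by (simp add: ula_op_def heat_def joint_map_def)
    also have "\<dots> = (\<integral>p. g (snd (joint_map \<eta> p)) \<partial>?P)" by (rule gibbs_pair.integral_fst'[OF i(1)])
    finally have 1: "(\<integral>x. ula_op \<eta> g x \<partial>gibbs) = (\<integral>p. g (snd (joint_map \<eta> p)) \<partial>?P)" .
    have "(\<integral>x. g x \<partial>gibbs) = (\<integral>x. \<integral>w. g (fst (x, w :: 'a)) \<partial>std_gauss \<partial>gibbs)" by simp
    also have "\<dots> = (\<integral>p. g (fst p) \<partial>?P)" by (rule gibbs_pair.integral_fst'[OF i(2)])
    finally have 2: "(\<integral>x. g x \<partial>gibbs) = (\<integral>p. g (fst p) \<partial>?P)" .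
    show ?thesis unfolding 1 2 D_def using i by (simp add: joint_map_def)
  qed
  also have "\<dots> = (\<integral>p. ?k p * D p \<partial>(lborel \<Otimes>\<^sub>M lborel))"
    using to_J[OF _ DI] by simp
  finally have I: "?I = (\<integral>p. ?k p * D p \<partial>(lborel \<Otimes>\<^sub>M lborel))" .
  have kD: "integrable (lborel \<Otimes>\<^sub>M lborel) (\<lambda>p. ?k p * D p)" using to_J[OF _ DI] by simp
  have kW: "integrable (lborel \<Otimes>\<^sub>M lborel) (\<lambda>p. ?k p * W p)" using to_J[OF _ WI] by simp
  let ?s = "\<lambda>p :: 'a \<times> 'a. (snd p, fst p)"
  \<comment> \<open>\<open>D\<close> is antisymmetric and \<open>W\<close> symmetric, so subtracting
    the exchanged integral doubles the bias and leaves only the difference of the two joint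
    densities.\<close>
  have D_swap: "D (?s p) = - D p" and W_swap: "W (?s p) = W p" for p
    by (simp_all add: D_def W_def norm_minus_commute abs_minus_commute)
  have kDs: "integrable (lborel \<Otimes>\<^sub>M lborel) (\<lambda>p. ?k (?s p) * D p)"
    "(\<integral>p. ?k (?s p) * D p \<partial>(lborel \<Otimes>\<^sub>M lborel)) = - ?I"
    using swapI[OF kD] unfolding D_swap I by simp_all
  have kWs: "integrable (lborel \<Otimes>\<^sub>M lborel) (\<lambda>p. ?k (?s p) * W p)"
    "(\<integral>p. ?k (?s p) * W p \<partial>(lborel \<Otimes>\<^sub>M lborel)) = (\<integral>p. ?k p * W p \<partial>(lborel \<Otimes>\<^sub>M lborel))"
    using swapI[OF kW] unfolding W_swap by simp_all
  have "2 * ?I = (\<integral>p. ?k p * D p - ?k (?s p) * D p \<partial>(lborel \<Otimes>\<^sub>M lborel))"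
    using I kDs kD by simp
  moreover have "2 * \<bar>?I\<bar> = \<bar>2 * ?I\<bar>" by (simp only: abs_mult abs_numeral)
  ultimately have "2 * \<bar>?I\<bar> = \<bar>\<integral>p. ?k p * D p - ?k (?s p) * D p \<partial>(lborel \<Otimes>\<^sub>M lborel)\<bar>"
    by (simp only:)
  also have "\<dots> \<le> (\<integral>p. \<bar>?k p * D p - ?k (?s p) * D p\<bar> \<partial>(lborel \<Otimes>\<^sub>M lborel))"
    by (rule integral_abs_bound)
  also have "\<dots> \<le> (\<integral>p. M * (?k p * W p + ?k (?s p) * W p) \<partial>(lborel \<Otimes>\<^sub>M lborel))"
  proof (rule integral_mono)
    fix p :: "'a \<times> 'a"
    let ?a = "energy \<eta> (fst p) (snd p)" and ?b = "energy \<eta> (snd p) (fst p)"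
    have "\<bar>?k p - ?k (?s p)\<bar> = joint_const \<eta> * \<bar>exp ?a - exp ?b\<bar>"
      using joint_const_pos[OF \<eta>(1)]
      by (simp add: joint_density_def right_diff_distrib[symmetric] abs_mult)
    also have "\<dots> \<le> joint_const \<eta> * (\<bar>?a - ?b\<bar> * (exp ?a + exp ?b))"
      using joint_const_pos[OF \<eta>(1)] by (intro mult_left_mono abs_exp_diff_le) auto
    also have "\<dots> = \<bar>?a - ?b\<bar> * (?k p + ?k (?s p))"
      by (simp add: joint_density_def algebra_simps)
    finally have 1: "\<bar>?k p - ?k (?s p)\<bar> \<le> \<bar>?a - ?b\<bar> * (?k p + ?k (?s p))" .
    have 2: "\<bar>D p\<bar> \<le> M * norm (snd p - fst p)" unfolding D_def by (rule lip)
    have "\<bar>?k p * D p - ?k (?s p) * D p\<bar> = \<bar>?k p - ?k (?s p)\<bar> * \<bar>D p\<bar>"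
      by (simp add: abs_mult[symmetric] left_diff_distrib)
    also have "\<dots> \<le> (\<bar>?a - ?b\<bar> * (?k p + ?k (?s p))) * (M * norm (snd p - fst p))"
      using k_nonneg by (intro mult_mono 1 2) auto
    also have "\<dots> = M * (?k p * W p + ?k (?s p) * W p)"
      by (simp add: W_def algebra_simps)
    finally show "\<bar>?k p * D p - ?k (?s p) * D p\<bar> \<le> M * (?k p * W p + ?k (?s p) * W p)" .
  qed (use kD kDs kW kWs in auto)
  also have "\<dots> = 2 * (M * (\<integral>p. ?k p * W p \<partial>(lborel \<Otimes>\<^sub>M lborel)))"
    using kW kWs by simp
  also have "(\<integral>p. ?k p * W p \<partial>(lborel \<Otimes>\<^sub>M lborel)) = (\<integral>p. W (joint_map \<eta> p) \<partial>?P)"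
    using to_J[OF _ WI] by simp
  also have "\<dots> \<le> (\<integral>p. \<eta> * sqrt \<eta> * ((L + L\<^sup>2 / 4) * bias_weight p ^ 3) \<partial>?P)"
    using joint_map_bound[OF \<eta>] unfolding W_def
    by (intro integral_mono WI[unfolded W_def] integrable_mult_right bias_weight_cube_integrable) auto
  also have "\<dots> = bias_const * (\<eta> * sqrt \<eta>)" by (simp add: bias_const_def)
  finally show ?thesis using M by (simp add: mult_left_mono mult.assoc)
qed

text \<open>Synchronous coupling: with the same noise in both chains, the distance changes only
  through the contracting gradient step.\<close>

lemma ula_op_lipschitz:
  assumes g: "quad_growth g" and lip: "\<And>x y. \<bar>g x - g y\<bar> \<le> M * norm (x - y)" and M: "M \<ge> 0"
    and contr: "\<And>x y. norm (x - y - \<eta> *\<^sub>R (gradU x - gradU y)) \<le> norm (x - y)"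
  shows "\<bar>ula_op \<eta> g x - ula_op \<eta> g y\<bar> \<le> M * norm (x - y)"
proof -
  let ?u = "x - \<eta> *\<^sub>R gradU x" and ?v = "y - \<eta> *\<^sub>R gradU y" and ?s = "sqrt (2 * \<eta>)"
  have i: "integrable std_gauss (\<lambda>w. g (z + ?s *\<^sub>R w))" for z by (rule quad_growth_integrable[OF g])
  have "\<bar>ula_op \<eta> g x - ula_op \<eta> g y\<bar> = \<bar>\<integral>w. g (?u + ?s *\<^sub>R w) - g (?v + ?s *\<^sub>R w) \<partial>std_gauss\<bar>"
    unfolding ula_op_def heat_def using i by simp
  also have "\<dots> \<le> (\<integral>w. \<bar>g (?u + ?s *\<^sub>R w) - g (?v + ?s *\<^sub>R w)\<bar> \<partial>std_gauss)"
    by (rule integral_abs_bound)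
  also have "\<dots> \<le> (\<integral>w. M * norm (?u - ?v) \<partial>(std_gauss :: 'a measure))"
  proof (rule integral_mono)
    show "\<bar>g (?u + ?s *\<^sub>R w) - g (?v + ?s *\<^sub>R w)\<bar> \<le> M * norm (?u - ?v)" for w
      using lip[of "?u + ?s *\<^sub>R w" "?v + ?s *\<^sub>R w"] by simp
  qed (use i in auto)
  also have "\<dots> = M * norm (?u - ?v)" by simp
  also have "?u - ?v = x - y - \<eta> *\<^sub>R (gradU x - gradU y)" by (simp add: algebra_simps)
  also have "M * norm \<dots> \<le> M * norm (x - y)" using M contr by (intro mult_left_mono)
  finally show ?thesis .
qed

text \<open>Telescoping: iterates keep the bound \<open>B\<close> and the Lipschitz constant
  \<open>M\<close>, so each step adds the same bias.\<close>

lemma many_steps_bias: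
  assumes \<eta>: "\<eta> > 0" "\<eta> \<le> 1" and M: "M \<ge> 0"
    and g: "g \<in> borel_measurable borel" "\<And>x. \<bar>g x\<bar> \<le> B"
    and lip: "\<And>x y. \<bar>g x - g y\<bar> \<le> M * norm (x - y)"
    and contr: "\<And>x y. norm (x - y - \<eta> *\<^sub>R (gradU x - gradU y)) \<le> norm (x - y)"
  shows "\<bar>(\<integral>x. (ula_op \<eta> ^^ j) g x \<partial>gibbs) - (\<integral>x. g x \<partial>gibbs)\<bar> \<le> real j * (M * bias_const * (\<eta> * sqrt \<eta>))"
proof -
  have bounds: "(ula_op \<eta> ^^ j) g \<in> borel_measurable borel" "\<bar>(ula_op \<eta> ^^ j) g x\<bar> \<le> B" for j x
  proof -
    have "- B \<le> g x" "g x \<le> B" for x using g(2)[of x] by linarith+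
    from ula_op_power_bounds[OF g(1) this, where \<eta> = \<eta> and j = j]
    show "(ula_op \<eta> ^^ j) g \<in> borel_measurable borel" "\<bar>(ula_op \<eta> ^^ j) g x\<bar> \<le> B"
      by (auto simp: abs_le_iff minus_le_iff)
  qed
  have lips: "\<bar>(ula_op \<eta> ^^ j) g x - (ula_op \<eta> ^^ j) g y\<bar> \<le> M * norm (x - y)" for j x y
  proof (induction j arbitrary: x y)
    case (Suc j)
    show ?case
      using ula_op_lipschitz[OF quad_growth_bounded[OF bounds] Suc M contr] by simp
  qed (use lip in simp)
  show ?thesis
  proof (induction j)
    case (Suc j)
    have "\<bar>(\<integral>x. ula_op \<eta> ((ula_op \<eta> ^^ j) g) x \<partial>gibbs) - (\<integral>x. (ula_op \<eta> ^^ j) g x \<partial>gibbs)\<bar>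
        \<le> M * bias_const * (\<eta> * sqrt \<eta>)"
      by (rule one_step_bias[OF \<eta> M bounds lips])
    with Suc show ?case by (simp add: algebra_simps)
  qed simp
qed

end

section \<open>The entropy bound\<close>

text \<open>Bernoulli's inequality yields linear growth in the elapsed time j \<eta>, independently
  of the fineness of the substeps. This suffices to make the initial gap free in the limit.\<close>

lemma penalty_ge:
  assumes "\<eta> > 0" "c > 0" "\<eta> * c < 1"
  shows "2 * (real j * \<eta>) \<le> penalty \<eta> (1 - \<eta> * c) j"
proof -
  define u where "u = \<eta> * c"
  have u: "0 < u" "u < 1" using assms by (auto simp: u_def)
  have "1 + real j * u \<le> (1 + u) ^ j"
    using Bernoulli_inequality[of u j] u by simp
  also have "\<dots> \<le> inverse (1 - u) ^ j"
  proof (rule power_mono)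
    have "(1 + u) * (1 - u) \<le> 1" using u by (simp add: algebra_simps)
    then show "1 + u \<le> inverse (1 - u)" using u by (simp add: inverse_eq_divide pos_le_divide_eq)
  qed (use u in simp)
  finally have 1: "real j * u \<le> inverse (1 - u) ^ j - 1" by simp
  have 2: "0 < 1 - (1 - u)\<^sup>2" "1 - (1 - u)\<^sup>2 \<le> 2 * u"
    using u by (auto simp: power2_eq_square algebra_simps mult_less_cancel_left1)
  have "2 * (real j * \<eta>) = 4 * \<eta> * (real j * u) / (2 * u)" using u by simp
  also have "\<dots> \<le> 4 * \<eta> * (inverse (1 - u) ^ j - 1) / (2 * u)"
    using 1 assms u by (intro divide_right_mono mult_left_mono) auto
  also have "\<dots> \<le> 4 * \<eta> * (inverse (1 - u) ^ j - 1) / (1 - (1 - u)\<^sup>2)"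
  proof (rule divide_left_mono)
    have "0 \<le> real j * u" using u by simp
    then show "0 \<le> 4 * \<eta> * (inverse (1 - u) ^ j - 1)" using 1 assms by simp
  qed (use 2 u in auto)
  finally show ?thesis by (simp add: penalty_def u_def)
qed

lemma power_one_minus_le_exp:
  assumes "x \<le> (1::real)"
  shows "(1 - x) ^ n \<le> exp (- (real n * x))"
proof -
  have "(1 - x) ^ n \<le> exp (- x) ^ n"
    using exp_ge_add_one_self[of "- x"] assms by (intro power_mono) auto
  then show ?thesis by (simp add: exp_of_nat_mult[symmetric])
qed

context strongly_convex_potential
begin

text \<open>The rate \<open>99 / 100 * m\<close> is smaller than \<open>m\<close> to absorb the second order term \<open>\<eta>\<^sup>2 * L\<^sup>2\<close>; the
  loss is small enough for the constants of the theorem.\<close>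

lemma step_contraction_linear:
  assumes \<eta>: "\<eta> > 0" "\<eta> * L\<^sup>2 \<le> m / 50" "\<eta> * (99 / 100 * m) < 1"
  shows "norm (x - y - \<eta> *\<^sub>R (gradU x - gradU y)) \<le> (1 - \<eta> * (99 / 100 * m)) * norm (x - y)"
proof (rule power2_le_imp_le)
  have "(norm (x - y - \<eta> *\<^sub>R (gradU x - gradU y)))\<^sup>2 \<le> (1 - 2 * \<eta> * m + \<eta>\<^sup>2 * L\<^sup>2) * (norm (x - y))\<^sup>2"
    using \<eta> by (intro step_contraction) simp
  also have "\<dots> \<le> (1 - \<eta> * (99 / 100 * m))\<^sup>2 * (norm (x - y))\<^sup>2"
  proof (rule mult_right_mono)
    \<comment> \<open>The first-order rate drops from 2 m to 2 (99 / 100) m, which frees \<eta> m /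
      50 for the second-order term; hence the bound imposed on
      \<open>\<eta> * L\<^sup>2\<close>.\<close>
    have "\<eta>\<^sup>2 * L\<^sup>2 = \<eta> * (\<eta> * L\<^sup>2)" by (simp add: power2_eq_square)
    also have "\<dots> \<le> \<eta> * (m / 50)" using \<eta> by (intro mult_left_mono) auto
    finally have "\<eta>\<^sup>2 * L\<^sup>2 \<le> \<eta> * (m / 50)" .
    moreover have "(1 - \<eta> * (99 / 100 * m))\<^sup>2 = 1 - 2 * \<eta> * m + \<eta> * (m / 50) + (\<eta> * (99 / 100 * m))\<^sup>2"
      by (simp add: power2_eq_square algebra_simps)
    moreover have "0 \<le> (\<eta> * (99 / 100 * m))\<^sup>2" by simp
    ultimately show "1 - 2 * \<eta> * m + \<eta>\<^sup>2 * L\<^sup>2 \<le> (1 - \<eta> * (99 / 100 * m))\<^sup>2" by linarith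
  qed simp
  finally show "(norm (x - y - \<eta> *\<^sub>R (gradU x - gradU y)))\<^sup>2 \<le> ((1 - \<eta> * (99 / 100 * m)) * norm (x - y))\<^sup>2"
    by (simp add: power_mult_distrib)
qed (use \<eta> in simp)

end

lemma lipschitz_measurable:
  fixes f :: "'a::euclidean_space \<Rightarrow> real"
  assumes "M \<ge> 0" and lip: "\<And>x y. \<bar>f x - f y\<bar> \<le> M * norm (x - y)"
  shows "f \<in> borel_measurable borel"
proof -
  have "M-lipschitz_on UNIV f"
    by (rule lipschitz_onI) (use assms in \<open>auto simp: dist_norm\<close>)
  then show ?thesis
    by (intro borel_measurable_continuous_onI lipschitz_on_continuous_on)
qed

context stationary_ula
begin

text \<open>The mean error of one block summed over infinitely many blocks, each discounted by the
  contraction over a time \<gamma>.\<close>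

definition entropy_const :: real where
  "entropy_const = (\<integral>x. block_error x \<partial>\<nu>) / (1 - exp (- (\<gamma> * (99 / 100 * m))))"

lemma mean_lower_value_ge:
  assumes "quad_growth f"
  shows "(\<integral>x. f x \<partial>\<nu>) - entropy_const \<le> (\<integral>x. lower_value (exp (- (\<gamma> * (99 / 100 * m)))) f n x \<partial>\<nu>)"
proof -
  let ?r = "exp (- (\<gamma> * (99 / 100 * m)))"
  have r: "?r < 1" using \<gamma>_pos m_pos by simp
  have "(\<Sum>i<n. ?r ^ i) = (1 - ?r ^ n) / (1 - ?r)"
    using \<gamma>_pos m_pos by (simp add: sum_gp_strict)
  also have "\<dots> \<le> 1 / (1 - ?r)" using r by (intro divide_right_mono) auto
  finally have "(\<Sum>i<n. ?r ^ i) * (\<integral>x. block_error x \<partial>\<nu>) \<le> 1 / (1 - ?r) * (\<integral>x. block_error x \<partial>\<nu>)"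
    by (intro mult_right_mono integral_nonneg_AE AE_I2 block_error_nonneg)
  then show ?thesis
    unfolding integral_lower_value[OF assms] entropy_const_def by simp
qed

text \<open>The pointwise comparison holds for all \<open>x\<close> and \<open>z\<close>, so they
  may be drawn independently from \<open>\<nu>\<close> and \<open>gibbs\<close>. Splitting |x - z|^2
  separates the variables, and a final Jensen inequality takes the exponential inside the Gibbs
  mean.\<close>

lemma exp_mean_le_many_steps:
  assumes n: "n > 0" and N: "N > 0" and \<eta>_def: "\<eta> = \<gamma> / real N"
    and \<eta>: "\<eta> * L\<^sup>2 \<le> m / 50" "\<eta> * (99 / 100 * m) < 1"
    and f: "f \<in> borel_measurable borel" "\<And>x. \<bar>f x\<bar> \<le> B"
  shows "exp ((\<integral>x. f x \<partial>\<nu>) - entropy_const - ((\<integral>x. (norm x)\<^sup>2 \<partial>\<nu>) + (\<integral>z. (norm z)\<^sup>2 \<partial>gibbs)) / (\<gamma> * real n))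
    \<le> (\<integral>z. (ula_op \<eta> ^^ (n * N)) (\<lambda>x. exp (f x)) z \<partial>gibbs)"
proof -
  have \<eta>_pos: "\<eta> > 0" and N\<eta>: "real N * \<eta> = \<gamma>" using \<gamma>_pos N by (auto simp: \<eta>_def)
  let ?c = "99 / 100 * m" and ?l = "1 - \<eta> * (99 / 100 * m)" and ?r = "exp (- (\<gamma> * (99 / 100 * m)))"
  let ?p = "penalty \<eta> ?l (n * N)" and ?V = "log_op \<eta> f (n * N)" and ?\<psi> = "lower_value ?r f n"
  let ?X = "\<integral>x. (norm x)\<^sup>2 \<partial>\<nu>" and ?Z = "\<integral>z. (norm z)\<^sup>2 \<partial>gibbs"
  have l: "0 < ?l" "?l < 1" using \<eta> \<eta>_pos m_pos by auto
  have lN: "?l ^ N \<le> ?r"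
    using power_one_minus_le_exp[of "\<eta> * ?c" N] \<eta>(2) N\<eta> by (simp add: mult.assoc[symmetric])
  have "2 * (real (n * N) * \<eta>) \<le> ?p" by (rule penalty_ge) (use \<eta> \<eta>_pos m_pos in auto)
  moreover have "real (n * N) * \<eta> = \<gamma> * real n" by (simp add: mult_ac flip: N\<eta>)
  ultimately have p: "2 * (\<gamma> * real n) \<le> ?p" by (simp only:)
  have \<gamma>n: "\<gamma> * real n > 0" using \<gamma>_pos n by simp
  have qf: "quad_growth f" by (rule quad_growth_bounded[OF f])
  have zI: "integrable gibbs (\<lambda>z. (norm z)\<^sup>2)" by (rule integrable_gibbs_norm_power)
  have VI: "integrable gibbs ?V"
    by (rule gibbs.integrable_const_bound[of _ B]) (use log_op[OF f] in auto)
  have pw: "?\<psi> x - ((norm x)\<^sup>2 + (norm z)\<^sup>2) / (\<gamma> * real n) \<le> ?V z" for x z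
  proof -
    have "?\<psi> x - (norm (x - z))\<^sup>2 / ?p \<le> ?V z"
      by (rule coupling_blocks[OF N \<eta>_def l lN step_contraction_linear[OF \<eta>_pos \<eta>] f])
         (use p \<gamma>n in simp)
    moreover have "(norm (x - z))\<^sup>2 / ?p \<le> (2 * (norm x)\<^sup>2 + 2 * (norm z)\<^sup>2) / (2 * (\<gamma> * real n))"
      using power2_norm_add_le[of x "- z"] p \<gamma>n by (intro frac_le) auto
    moreover have "(2 * (norm x)\<^sup>2 + 2 * (norm z)\<^sup>2) / (2 * (\<gamma> * real n)) = ((norm x)\<^sup>2 + (norm z)\<^sup>2) / (\<gamma> * real n)"
      unfolding distrib_left[symmetric] by (rule mult_divide_mult_cancel_left) simp
    ultimately show ?thesis by linarith
  qed
  have px: "?\<psi> x - (norm x)\<^sup>2 / (\<gamma> * real n) - ?Z / (\<gamma> * real n) \<le> (\<integral>z. ?V z \<partial>gibbs)" for x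
  proof -
    have "?\<psi> x - (norm x)\<^sup>2 / (\<gamma> * real n) - ?Z / (\<gamma> * real n) =
       (\<integral>z. (?\<psi> x - (norm x)\<^sup>2 / (\<gamma> * real n)) - (norm z)\<^sup>2 / (\<gamma> * real n) \<partial>gibbs)"
      using zI gibbs.prob_space by simp
    also have "\<dots> \<le> (\<integral>z. ?V z \<partial>gibbs)"
    proof (rule integral_mono)
      show "(?\<psi> x - (norm x)\<^sup>2 / (\<gamma> * real n)) - (norm z)\<^sup>2 / (\<gamma> * real n) \<le> ?V z" for z
        using pw[of x z] by (simp add: add_divide_distrib)
    qed (use zI VI in auto)
    finally show ?thesis .
  qed
  have \<psi>I: "integrable \<nu> ?\<psi>" by (intro quad_growth_integrable_stationary quad_growth_lower_value qf)
  have "(\<integral>x. f x \<partial>\<nu>) - entropy_const - (?X + ?Z) / (\<gamma> * real n) \<le>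
      (\<integral>x. ?\<psi> x \<partial>\<nu>) - ?X / (\<gamma> * real n) - ?Z / (\<gamma> * real n)"
    using mean_lower_value_ge[OF qf, of n] by (simp add: add_divide_distrib)
  also have "\<dots> = (\<integral>x. ?\<psi> x - (norm x)\<^sup>2 / (\<gamma> * real n) - ?Z / (\<gamma> * real n) \<partial>\<nu>)"
    using \<psi>I integrable_norm_sq \<nu>.prob_space by simp
  also have "\<dots> \<le> (\<integral>x. (\<integral>z. ?V z \<partial>gibbs) \<partial>\<nu>)"
    by (intro integral_mono px) (use \<psi>I integrable_norm_sq in auto)
  also have "\<dots> = (\<integral>z. ?V z \<partial>gibbs)" using \<nu>.prob_space by simp
  finally have "exp ((\<integral>x. f x \<partial>\<nu>) - entropy_const - (?X + ?Z) / (\<gamma> * real n)) \<le> exp (\<integral>z. ?V z \<partial>gibbs)"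
    by simp
  also have "\<dots> \<le> (\<integral>z. exp (?V z) \<partial>gibbs)"
  proof (rule gibbs.jensens_inequality[where I = UNIV])
    show "integrable gibbs (\<lambda>z. exp (?V z))"
      by (rule gibbs.integrable_const_bound[of _ "exp B"]) (use log_op(1,2)[OF f] in \<open>auto simp: abs_le_iff\<close>)
  qed (use VI in \<open>auto simp: exp_convex\<close>)
  also have "\<dots> = (\<integral>z. (ula_op \<eta> ^^ (n * N)) (\<lambda>x. exp (f x)) z \<partial>gibbs)"
    using log_op(3)[OF f] by simp
  finally show ?thesis .
qed

text \<open>By the Gibbs variational principle this says that the relative entropy of \<open>\<nu>\<close> with respect
  to \<open>gibbs\<close> is at most \<open>entropy_const\<close>.\<close>

lemma entropy_bound:
  assumes M: "M \<ge> 0" and lip: "\<And>x y. \<bar>f x - f y\<bar> \<le> M * norm (x - y)" and bd: "\<And>x. \<bar>f x\<bar> \<le> B"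
  shows "exp ((\<integral>x. f x \<partial>\<nu>) - entropy_const) \<le> (\<integral>x. exp (f x) \<partial>gibbs)"
proof -
  have fm: "f \<in> borel_measurable borel" by (rule lipschitz_measurable[OF M lip])
  let ?g = "\<lambda>x. exp (f x)"
  have gm: "?g \<in> borel_measurable borel" using fm by measurable
  have gb: "\<bar>?g x\<bar> \<le> exp B" for x using bd[of x] by (simp add: abs_le_iff)
  have glip: "\<bar>?g x - ?g y\<bar> \<le> 2 * exp B * M * norm (x - y)" for x y
  proof -
    have "\<bar>?g x - ?g y\<bar> \<le> \<bar>f x - f y\<bar> * (exp (f x) + exp (f y))" by (rule abs_exp_diff_le)
    also have "\<dots> \<le> (M * norm (x - y)) * (exp B + exp B)"
      using gb[of x] gb[of y] M by (intro mult_mono lip add_mono) auto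
    finally show ?thesis by (simp add: mult_ac)
  qed
  let ?K = "\<lambda>n. (\<integral>x. f x \<partial>\<nu>) - entropy_const - ((\<integral>x. (norm x)\<^sup>2 \<partial>\<nu>) + (\<integral>z. (norm z)\<^sup>2 \<partial>gibbs)) / (\<gamma> * real n)"
  have step: "exp (?K n) \<le> (\<integral>x. ?g x \<partial>gibbs)" if n: "n > 0" for n
  proof -
    \<comment> \<open>The n N steps have bias of order \<eta> sqrt \<eta> each, and N \<eta> =
      \<gamma>, so the total is \<open>C * sqrt \<eta>\<close> and vanishes as N grows with n
      fixed.\<close>
    define C where "C = \<gamma> * real n * (2 * exp B * M * bias_const)"
    have lim: "(\<lambda>N. (\<integral>x. ?g x \<partial>gibbs) + C * sqrt (\<gamma> / real N)) \<longlonglongrightarrow> (\<integral>x. ?g x \<partial>gibbs) + C * sqrt 0"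
      by (intro tendsto_intros lim_const_over_n)
    have ev1: "\<forall>\<^sub>F N in sequentially. \<gamma> / real N * c < e" if "e > 0" for c e :: real
    proof -
      have "(\<lambda>N. \<gamma> / real N * c) \<longlonglongrightarrow> 0 * c" by (intro tendsto_intros lim_const_over_n)
      then show ?thesis using that by (intro order_tendstoD(2)[of _ 0]) auto
    qed
    have e0: "0 < m / 50" using m_pos by simp
    have "\<forall>\<^sub>F N in sequentially. exp (?K n) \<le> (\<integral>x. ?g x \<partial>gibbs) + C * sqrt (\<gamma> / real N)"
      using ev1[OF e0, of "L\<^sup>2"] ev1[OF zero_less_one, of "99 / 100 * m"]
        ev1[OF zero_less_one, of 1] eventually_gt_at_top[of "0 :: nat"]
    proof eventually_elim
      case (elim N)
      define \<eta> where "\<eta> = \<gamma> / real N"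
      have \<eta>: "\<eta> > 0" "\<eta> \<le> 1" "\<eta> * L\<^sup>2 \<le> m / 50" "\<eta> * (99 / 100 * m) < 1"
        using elim m_pos \<gamma>_pos by (auto simp: \<eta>_def)
      have contr: "norm (x - y - \<eta> *\<^sub>R (gradU x - gradU y)) \<le> norm (x - y)" for x y
      proof -
        have "(1 - \<eta> * (99 / 100 * m)) * norm (x - y) \<le> 1 * norm (x - y)"
          using \<eta> m_pos by (intro mult_right_mono) auto
        then show ?thesis using step_contraction_linear[OF \<eta>(1,3,4), of x y] by simp
      qed
      have "exp (?K n) \<le> (\<integral>z. (ula_op \<eta> ^^ (n * N)) ?g z \<partial>gibbs)"
        using elim by (intro exp_mean_le_many_steps[OF n _ \<eta>_def \<eta>(3,4) fm bd]) auto
      also have "\<dots> \<le> (\<integral>x. ?g x \<partial>gibbs) + real (n * N) * (2 * exp B * M * bias_const * (\<eta> * sqrt \<eta>))"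
        using many_steps_bias[OF \<eta>(1,2) _ gm gb glip contr, of "n * N"] M by (simp add: abs_le_iff)
      also have "real (n * N) * (2 * exp B * M * bias_const * (\<eta> * sqrt \<eta>)) = C * sqrt \<eta>"
      proof -
        have "real N * \<eta> = \<gamma>" using elim by (simp add: \<eta>_def)
        then show ?thesis by (simp add: C_def mult_ac flip: \<open>real N * \<eta> = \<gamma>\<close>)
      qed
      finally show ?case unfolding \<eta>_def .
    qed
    from tendsto_lowerbound[OF lim this] show ?thesis by simp
  qed
  \<comment> \<open>Letting n grow removes the second moments paid for the initial gap. It has to
    come after the limit in N, because \<open>C\<close> grows with n.\<close>
  have "(\<lambda>n. exp (?K n)) \<longlonglongrightarrow> exp ((\<integral>x. f x \<partial>\<nu>) - entropy_const - 0)"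
  proof (intro tendsto_intros)
    have "(\<lambda>n. ((\<integral>x. (norm x)\<^sup>2 \<partial>\<nu>) + (\<integral>z. (norm z)\<^sup>2 \<partial>gibbs)) / \<gamma> / real n) \<longlonglongrightarrow> 0"
      by (rule lim_const_over_n)
    then show "(\<lambda>n. ((\<integral>x. (norm x)\<^sup>2 \<partial>\<nu>) + (\<integral>z. (norm z)\<^sup>2 \<partial>gibbs)) / (\<gamma> * real n)) \<longlonglongrightarrow> 0"
      by simp
  qed
  moreover have "\<forall>\<^sub>F n in sequentially. exp (?K n) \<le> (\<integral>x. ?g x \<partial>gibbs)"
    using eventually_gt_at_top[of 0] by eventually_elim (rule step)
  ultimately show ?thesis by (intro tendsto_upperbound[where F = sequentially]) auto
qed

end

section \<open>From relative entropy to total variation\<close>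

text \<open>The dual form of Pinsker's inequality tests the entropy bound with \<open>l\<close>
  times the indicator of \<open>A\<close> and controls the exponential moment by Hoeffding's lemma.
  The indicator is the limit of Lipschitz cut-offs of the distance to \<open>A\<close>; closedness
  makes that limit vanish off \<open>A\<close>.\<close>

lemma closed_set_pinsker:
  fixes \<mu> \<pi> :: "'a::euclidean_space measure"
  assumes "prob_space \<mu>" "prob_space \<pi>" and sets: "sets \<mu> = sets borel" "sets \<pi> = sets borel"
    and K: "K > 0"
    and ent: "\<And>f M B. M \<ge> 0 \<Longrightarrow> (\<And>x y. \<bar>f x - f y\<bar> \<le> M * norm (x - y)) \<Longrightarrow> (\<And>x. \<bar>f x\<bar> \<le> B) \<Longrightarrow>
       exp ((\<integral>x. f x \<partial>\<mu>) - K) \<le> (\<integral>x. exp (f x) \<partial>\<pi>)"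
    and A: "closed A"
  shows "measure \<mu> A - measure \<pi> A \<le> sqrt (K / 2)"
proof (cases "A = {}")
  case False
  interpret \<mu>: prob_space \<mu> by fact
  interpret \<pi>: prob_space \<pi> by fact
  note [measurable_cong] = sets
  have [measurable]: "A \<in> sets borel" using A by simp
  have sp: "space \<mu> = UNIV" "space \<pi> = UNIV" using sets[THEN sets_eq_imp_space_eq] by simp_all
  \<comment> \<open>The minimiser of (K + l^2 / 8) / l; at this value both summands equal
    \<open>K\<close>.\<close>
  define l where "l = sqrt (8 * K)"
  have l: "l > 0" "l\<^sup>2 = 8 * K" using K by (auto simp: l_def)
  define f where "f n x = l * max 0 (1 - real n * infdist x A)" for n x
  have f_lip: "\<bar>f n x - f n y\<bar> \<le> l * real n * norm (x - y)" for n x y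
  proof -
    have "\<bar>infdist x A - infdist y A\<bar> \<le> norm (x - y)"
      using infdist_triangle_abs[of x A y] by (simp add: dist_norm)
    then have "real n * \<bar>infdist x A - infdist y A\<bar> \<le> real n * norm (x - y)"
      by (intro mult_left_mono) auto
    moreover have "\<bar>max 0 (1 - real n * infdist x A) - max 0 (1 - real n * infdist y A)\<bar>
       \<le> \<bar>real n * infdist x A - real n * infdist y A\<bar>" by (simp add: max_def abs_if)
    moreover have "\<bar>real n * infdist x A - real n * infdist y A\<bar> = real n * \<bar>infdist x A - infdist y A\<bar>"
      by (simp add: right_diff_distrib[symmetric] abs_mult)
    ultimately have "\<bar>max 0 (1 - real n * infdist x A) - max 0 (1 - real n * infdist y A)\<bar> \<le> real n * norm (x - y)"
      by linarith
    then have "l * \<bar>max 0 (1 - real n * infdist x A) - max 0 (1 - real n * infdist y A)\<bar> \<le> l * (real n * norm (x - y))"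
      using l by (intro mult_left_mono) auto
    moreover have "\<bar>f n x - f n y\<bar> = l * \<bar>max 0 (1 - real n * infdist x A) - max 0 (1 - real n * infdist y A)\<bar>"
      using l by (simp add: f_def right_diff_distrib[symmetric] abs_mult)
    ultimately show ?thesis by simp
  qed
  have f_bd: "\<bar>f n x\<bar> \<le> l" "0 \<le> f n x" for n x
    using l infdist_nonneg[of x A] by (auto simp: f_def abs_mult max_def mult_left_le)
  have [measurable]: "f n \<in> borel_measurable borel" for n
    by (rule lipschitz_measurable[OF _ f_lip]) (use l in simp)
  have f_lim: "(\<lambda>n. f n x) \<longlonglongrightarrow> l * indicator A x" for x
  proof (cases "x \<in> A")
    case True
    then show ?thesis by (simp add: f_def)
  next
    case out: False
    then have pos: "infdist x A > 0"
      using in_closed_iff_infdist_zero[OF A False, of x] infdist_nonneg[of x A] by force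
    obtain k :: nat where k: "1 / infdist x A < real k" using reals_Archimedean2 by blast
    have "\<forall>\<^sub>F n in sequentially. f n x = l * indicator A x"
      using eventually_ge_at_top[of k]
    proof eventually_elim
      case (elim n)
      then have "1 / infdist x A \<le> real n" using k by linarith
      then have "1 \<le> real n * infdist x A" using pos by (simp add: pos_divide_le_eq)
      then show ?case using out by (simp add: f_def)
    qed
    then show ?thesis by (rule tendsto_eventually)
  qed
  have lim1: "(\<lambda>n. \<integral>x. f n x \<partial>\<mu>) \<longlonglongrightarrow> (\<integral>x. l * indicator A x \<partial>\<mu>)"
    by (rule integral_dominated_convergence[where w = "\<lambda>_. l"]) (use f_lim f_bd in auto)
  have lim2: "(\<lambda>n. \<integral>x. exp (f n x) \<partial>\<pi>) \<longlonglongrightarrow> (\<integral>x. exp (l * indicator A x) \<partial>\<pi>)"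
  proof (rule integral_dominated_convergence[where w = "\<lambda>_. exp l"])
    show "AE x in \<pi>. (\<lambda>n. exp (f n x)) \<longlonglongrightarrow> exp (l * indicator A x)"
      using f_lim by (intro AE_I2 tendsto_exp)
    show "AE x in \<pi>. norm (exp (f n x)) \<le> exp l" for n
      using f_bd by (intro AE_I2) (auto simp: abs_le_iff)
  qed auto
  have "exp ((\<integral>x. l * indicator A x \<partial>\<mu>) - K) \<le> (\<integral>x. exp (l * indicator A x) \<partial>\<pi>)"
  proof (rule LIMSEQ_le[OF _ lim2])
    show "(\<lambda>n. exp ((\<integral>x. f n x \<partial>\<mu>) - K)) \<longlonglongrightarrow> exp ((\<integral>x. l * indicator A x \<partial>\<mu>) - K)"
      by (intro tendsto_intros lim1)
    show "\<exists>N. \<forall>n\<ge>N. exp ((\<integral>x. f n x \<partial>\<mu>) - K) \<le> (\<integral>x. exp (f n x) \<partial>\<pi>)"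
      using ent[OF _ f_lip f_bd(1)] l by auto
  qed
  also have "(\<integral>x. exp (l * indicator A x) \<partial>\<pi>) = (\<integral>x. 1 + (exp l - 1) * indicator A x \<partial>\<pi>)"
    by (intro Bochner_Integration.integral_cong) (auto simp: indicator_def)
  also have "\<dots> = 1 + measure \<pi> A * (exp l - 1)"
    using \<pi>.prob_space by (simp add: sp \<pi>.emeasure_eq_measure)
  finally have e: "exp (l * measure \<mu> A - K) \<le> 1 + measure \<pi> A * (exp l - 1)"
    by (simp add: sp \<mu>.emeasure_eq_measure)
  then have "l * measure \<mu> A - K \<le> ln (1 + measure \<pi> A * (exp l - 1))"
    by (metis exp_gt_zero exp_le_cancel_iff exp_ln less_le_trans)
  moreover have "- l * measure \<pi> A + ln (1 + measure \<pi> A * (exp l - 1)) \<le> l\<^sup>2 / 8"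
    by (rule Hoeffdings_lemma_aux) (use l in auto)
  ultimately have "l * (measure \<mu> A - measure \<pi> A) \<le> 2 * K" using l by (simp add: algebra_simps)
  also have "2 * K = l * sqrt (K / 2)"
  proof -
    have "l * sqrt (K / 2) = sqrt ((2 * K)\<^sup>2)"
      unfolding l_def real_sqrt_mult[symmetric] by (simp add: power2_eq_square)
    also have "\<dots> = 2 * K" using K by (simp only: real_sqrt_abs)
    finally show ?thesis by simp
  qed
  finally show ?thesis using l by simp
qed (use K in simp)

text \<open>Inner regularity of \<open>\<mu>\<close> replaces a Borel set by a compact subset, which
  only lowers its \<open>\<pi>\<close>-measure. Passing to the complement gives the other
  sign.\<close>

lemma tv_dist_le_of_entropy:
  fixes \<mu> \<pi> :: "'a::euclidean_space measure"
  assumes prob: "prob_space \<mu>" "prob_space \<pi>" and sets: "sets \<mu> = sets borel" "sets \<pi> = sets borel"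
    and K: "K > 0"
    and ent: "\<And>f M B. M \<ge> 0 \<Longrightarrow> (\<And>x y. \<bar>f x - f y\<bar> \<le> M * norm (x - y)) \<Longrightarrow> (\<And>x. \<bar>f x\<bar> \<le> B) \<Longrightarrow>
       exp ((\<integral>x. f x \<partial>\<mu>) - K) \<le> (\<integral>x. exp (f x) \<partial>\<pi>)"
  shows "tv_dist \<mu> \<pi> \<le> sqrt (K / 2)"
proof -
  interpret \<mu>: prob_space \<mu> by fact
  interpret \<pi>: prob_space \<pi> by fact
  note [measurable_cong] = sets
  have sp: "space \<mu> = UNIV" "space \<pi> = UNIV" using sets[THEN sets_eq_imp_space_eq] by simp_all
  have one_sided: "measure \<mu> A - measure \<pi> A \<le> sqrt (K / 2)" if A: "A \<in> sets borel" for A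
  proof (rule field_le_epsilon)
    fix e :: real assume e: "e > 0"
    have "\<exists>C. C \<subseteq> A \<and> compact C \<and> measure \<mu> A < measure \<mu> C + e"
    proof (rule ccontr)
      assume "\<not> ?thesis"
      then have *: "measure \<mu> C \<le> measure \<mu> A - e" if "C \<subseteq> A" "compact C" for C
        using that by (auto simp: not_less algebra_simps)
      have "emeasure \<mu> A = (SUP C \<in> {C. C \<subseteq> A \<and> compact C}. emeasure \<mu> C)"
        by (rule inner_regular) (use sets A in auto)
      also have "\<dots> \<le> ennreal (measure \<mu> A - e)"
        using * by (intro SUP_least) (auto simp: \<mu>.emeasure_eq_measure intro!: ennreal_leI)
      finally have "measure \<mu> A \<le> max 0 (measure \<mu> A - e)"
        unfolding \<mu>.emeasure_eq_measure
        by (metis ennreal_le_iff ennreal_neg max.absorb1 max.cobounded1 max.cobounded2 max_def nle_le)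
      \<comment> \<open>The empty set is compact, so the assumed gap makes this difference
        nonnegative, and the truncation of \<open>ennreal\<close> at 0 loses nothing.\<close>
      moreover have "0 \<le> measure \<mu> A - e" using *[of "{}"] by simp
      ultimately show False using e by simp
    qed
    then obtain C where C: "C \<subseteq> A" "compact C" "measure \<mu> A < measure \<mu> C + e" by blast
    have "measure \<pi> C \<le> measure \<pi> A" using C A sets by (intro \<pi>.finite_measure_mono) auto
    moreover have "measure \<mu> C - measure \<pi> C \<le> sqrt (K / 2)"
      by (rule closed_set_pinsker[OF prob sets K ent compact_imp_closed[OF C(2)]])
    ultimately show "measure \<mu> A - measure \<pi> A \<le> sqrt (K / 2) + e" using C(3) by linarith
  qed
  show ?thesis
    unfolding tv_dist_def
  proof (rule cSUP_least)
    fix A :: "'a set" assume A: "A \<in> sets borel"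
    have "measure \<mu> (UNIV - A) = 1 - measure \<mu> A" "measure \<pi> (UNIV - A) = 1 - measure \<pi> A"
      using \<mu>.prob_compl[of A] \<pi>.prob_compl[of A] A sets by (auto simp: sp)
    then show "\<bar>measure \<mu> A - measure \<pi> A\<bar> \<le> sqrt (K / 2)"
      using one_sided[OF A] one_sided[of "UNIV - A"] A by auto
  qed auto
qed

section \<open>Passage from the kernel and measure of the statement to the locales\<close>

lemma invariant_of_stationary_distribution:
  fixes gradU :: "real^'n \<Rightarrow> real^'n"
  assumes \<gamma>: "\<gamma> > 0" and [measurable]: "gradU \<in> borel_measurable borel"
    and st: "stationary_distribution (ula_kernel gradU \<gamma>) \<nu>"
  shows "distr (\<nu> \<Otimes>\<^sub>M std_gauss) borel (\<lambda>(x, w). x - \<gamma> *\<^sub>R gradU x + sqrt (2 * \<gamma>) *\<^sub>R w) = \<nu>" (is "?L = \<nu>")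
proof (rule measure_eqI)
  have [measurable_cong]: "sets \<nu> = sets borel" using st by (simp add: stationary_distribution_def)
  then show "sets ?L = sets \<nu>" by simp
  fix A assume "A \<in> sets ?L"
  then have [measurable]: "A \<in> sets borel" by simp
  have "emeasure ?L A = (\<integral>\<^sup>+p. indicator A (fst p - \<gamma> *\<^sub>R gradU (fst p) + sqrt (2 * \<gamma>) *\<^sub>R snd p) \<partial>(\<nu> \<Otimes>\<^sub>M std_gauss))"
    by (subst nn_integral_indicator[symmetric], simp, subst nn_integral_distr) (auto simp: case_prod_unfold)
  also have "\<dots> = (\<integral>\<^sup>+x. \<integral>\<^sup>+w. indicator A (x - \<gamma> *\<^sub>R gradU x + sqrt (2 * \<gamma>) *\<^sub>R w) \<partial>std_gauss \<partial>\<nu>)"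
    by (subst std_gauss.nn_integral_fst[symmetric]) auto
  also have "\<dots> = (\<integral>\<^sup>+x. emeasure (ula_kernel gradU \<gamma> x) A \<partial>\<nu>)"
  proof (rule nn_integral_cong)
    fix x
    show "(\<integral>\<^sup>+w. indicator A (x - \<gamma> *\<^sub>R gradU x + sqrt (2 * \<gamma>) *\<^sub>R w) \<partial>std_gauss) = emeasure (ula_kernel gradU \<gamma> x) A"
      unfolding ula_kernel_eq_distr[OF \<gamma>]
      by (subst nn_integral_indicator[symmetric], simp, subst nn_integral_distr) auto
  qed
  also have "\<dots> = emeasure \<nu> A" using st by (auto simp: stationary_distribution_def)
  finally show "emeasure ?L A = emeasure \<nu> A" .
qed

lemma (in strongly_convex_potential) gibbs_eq:
  "gibbs = density lborel (\<lambda>x. ennreal (exp (- U x)) / (\<integral>\<^sup>+y. ennreal (exp (- U y)) \<partial>lborel))"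
  unfolding gibbs_def nn_integral_gibbs_weight using gibbs_const_pos by (simp add: divide_ennreal)

section \<open>Numerical estimates\<close>

text \<open>AM-GM in the form k <= 4 X Y <= (X + Y)^2, with \<open>a\<close> and \<open>b\<close> as
  simple lower bounds for the squares, so that no root remains to be compared.\<close>

lemma sqrt_le_add_of_square_le:
  fixes k X Y a b :: real
  assumes "X \<ge> 0" "Y \<ge> 0" "0 \<le> a" "0 \<le> b" "a \<le> X\<^sup>2" "b \<le> Y\<^sup>2" "k\<^sup>2 \<le> 16 * (a * b)"
  shows "sqrt k \<le> X + Y"
proof -
  have "a * b \<le> X\<^sup>2 * Y\<^sup>2" by (rule mult_mono[OF assms(5,6) _ assms(4)]) simp
  then have "k\<^sup>2 \<le> 16 * (X\<^sup>2 * Y\<^sup>2)" using assms(7) by linarith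
  also have "\<dots> = (4 * (X * Y))\<^sup>2" by (simp add: power_mult_distrib)
  finally have "k \<le> 4 * (X * Y)"
    by (rule power2_le_imp_le) (simp add: assms(1,2))
  moreover have "(X + Y)\<^sup>2 = (X - Y)\<^sup>2 + 4 * (X * Y)" by (simp add: power2_eq_square algebra_simps)
  ultimately have "k \<le> (X + Y)\<^sup>2" using zero_le_power2[of "X - Y"] by linarith
  then have "sqrt k \<le> sqrt ((X + Y)\<^sup>2)" by (rule real_sqrt_le_mono)
  also have "\<dots> = X + Y" by (rule real_sqrt_abs[THEN trans]) (use assms(1,2) in simp)
  finally show ?thesis .
qed

text \<open>The quadratic Taylor polynomials of exp x and exp (- x) have product 1 + x^4 / 4 >= 1.
  Since exp x dominates the first, exp (- x) is at most the second.\<close>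

lemma one_minus_exp_ge:
  fixes x :: real assumes "x \<ge> 0"
  shows "x * (1 - x / 2) \<le> 1 - exp (- x)"
proof -
  have "(1 + x + x\<^sup>2 / 2) * (1 - x + x\<^sup>2 / 2) = 1 + (x\<^sup>2)\<^sup>2 / 4"
    by (simp add: algebra_simps power2_eq_square)
  then have "1 \<le> (1 + x + x\<^sup>2 / 2) * (1 - x + x\<^sup>2 / 2)" by simp
  also have "\<dots> \<le> exp x * (1 - x + x\<^sup>2 / 2)"
  proof (rule mult_right_mono[OF exp_lower_Taylor_quadratic[OF assms]])
    have "0 \<le> (x - 1)\<^sup>2" by simp
    then show "0 \<le> 1 - x + x\<^sup>2 / 2" by (simp add: power2_eq_square algebra_simps)
  qed
  finally have "exp (- x) \<le> 1 - x + x\<^sup>2 / 2"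
    by (simp add: exp_minus inverse_eq_divide pos_divide_le_eq mult.commute)
  then show ?thesis by (simp add: power2_eq_square algebra_simps)
qed

text \<open>As \<gamma> L <= 1, the mean squared gradient is at most 2 L d, which bounds the mean
  block error by L^2 \<gamma>^2 d / 2 times 1 + 2 \<gamma> L / 3. The denominator is at least 99 /
  200 times \<gamma> \<kappa>, and the halved quotient has the factor 50 / 99.\<close>

lemma (in stationary_ula) entropy_const_bounds:
  assumes \<gamma>': "\<gamma> \<le> 1 / (m + L)"
  shows "0 < entropy_const"
    and "entropy_const / 2 \<le> 50 / 99 * (L\<^sup>2 * \<gamma> * real DIM('a) / kappa m L) * (1 + 2 / 3 * (\<gamma> * L))"
proof -
  let ?d = "real DIM('a)" and ?G = "\<integral>x. (norm (gradU x))\<^sup>2 \<partial>\<nu>" and ?x = "\<gamma> * (99 / 100 * m)"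
  have E: "(\<integral>x. block_error x \<partial>\<nu>) = L\<^sup>2 / 2 * (\<gamma> ^ 3 / 3 * ?G + \<gamma>\<^sup>2 * ?d)"
    unfolding block_error_def using gradU_sq_integrable \<nu>.prob_space by simp
  have G0: "?G \<ge> 0" by (intro integral_nonneg_AE) auto
  have "1 / 2 * ?G \<le> (1 - \<gamma> * L / 2) * ?G" using \<gamma>_le G0 by (intro mult_right_mono) auto
  then have G: "?G \<le> 2 * (L * ?d)" using gradU_sq_mean by linarith
  have E_pos: "(\<integral>x. block_error x \<partial>\<nu>) > 0"
    unfolding E using L_pos \<gamma>_pos G0 by (intro mult_pos_pos add_nonneg_pos) auto
  have "\<gamma> ^ 3 / 3 * ?G \<le> \<gamma> ^ 3 / 3 * (2 * (L * ?d))" using \<gamma>_pos G by (intro mult_left_mono) auto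
  then have "L\<^sup>2 / 2 * (\<gamma> ^ 3 / 3 * ?G + \<gamma>\<^sup>2 * ?d) \<le> L\<^sup>2 / 2 * (\<gamma> ^ 3 / 3 * (2 * (L * ?d)) + \<gamma>\<^sup>2 * ?d)"
    by (rule mult_left_mono[OF add_right_mono]) simp
  then have E_le: "(\<integral>x. block_error x \<partial>\<nu>) \<le> L\<^sup>2 / 2 * (\<gamma>\<^sup>2 * ?d * (1 + 2 / 3 * (\<gamma> * L)))"
    unfolding E by (simp add: power2_eq_square power3_eq_cube algebra_simps)
  have \<kappa>: "kappa m L > 0" using m_pos L_pos by (simp add: kappa_def)
  have "\<gamma> * m \<le> m / (m + L)" using mult_right_mono[OF \<gamma>', of m] m_pos by simp
  then have "?x \<le> m / (m + L)" using \<gamma>_pos m_pos mult_pos_pos[OF \<gamma>_pos m_pos] by linarith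
  then have "?x / 2 \<le> m / (m + L) / 2" by (rule divide_right_mono) simp
  then have "1 - m / (m + L) / 2 \<le> 1 - ?x / 2" by (rule diff_left_mono)
  moreover have "L / (m + L) \<le> 1 - m / (m + L) / 2" using m_pos L_pos by (simp add: field_simps)
  ultimately have "L / (m + L) \<le> 1 - ?x / 2" by (rule order_trans[rotated])
  then have "?x * (L / (m + L)) \<le> ?x * (1 - ?x / 2)"
    by (rule mult_left_mono) (use \<gamma>_pos m_pos in simp)
  also have "\<dots> \<le> 1 - exp (- ?x)" using \<gamma>_pos m_pos by (intro one_minus_exp_ge) auto
  \<comment> \<open>Here \<open>kappa\<close> replaces the rate m: the step size restriction gives 1
    - x / 2 >= L / (m + L), and m L / (m + L) is half of \<open>kappa\<close>.\<close>
  also have "?x * (L / (m + L)) = 99 / 200 * (\<gamma> * kappa m L)"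
    using m_pos L_pos by (simp add: kappa_def field_simps)
  finally have den: "99 / 200 * (\<gamma> * kappa m L) \<le> 1 - exp (- ?x)" .
  have den_pos: "99 / 200 * (\<gamma> * kappa m L) > 0" using \<gamma>_pos \<kappa> by simp
  show "0 < entropy_const" unfolding entropy_const_def
    by (rule divide_pos_pos[OF E_pos less_le_trans[OF den_pos den]])
  have "entropy_const \<le> (L\<^sup>2 / 2 * (\<gamma>\<^sup>2 * ?d * (1 + 2 / 3 * (\<gamma> * L)))) / (99 / 200 * (\<gamma> * kappa m L))"
    unfolding entropy_const_def using E_pos E_le den den_pos by (intro frac_le) auto
  also have "\<dots> = 2 * (50 / 99 * (L\<^sup>2 * \<gamma> * ?d / kappa m L) * (1 + 2 / 3 * (\<gamma> * L)))"
    using \<gamma>_pos \<kappa> by (simp add: power2_eq_square)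
  finally show "entropy_const / 2 \<le> 50 / 99 * (L\<^sup>2 * \<gamma> * ?d / kappa m L) * (1 + 2 / 3 * (\<gamma> * L))" by simp
qed

text \<open>With g = \<gamma> L and Q = L^2 \<gamma> d / \<kappa>, the two terms have squares at
  least L^2 d \<gamma> / 8 and (Q^2 / (\<gamma> d L^2)) (1 + g / 2) / pi when d > 0. By AM-GM it
  suffices that k^2 <= Q^2 (2 / pi) (1 + g / 2).\<close>

lemma bound_of_entropy:
  fixes L m \<gamma> k :: real and d :: nat
  assumes m: "0 < m" "m \<le> L" and \<gamma>: "0 < \<gamma>" "\<gamma> * L \<le> 1"
    and k: "0 \<le> k" "k \<le> 50 / 99 * (L\<^sup>2 * \<gamma> * real d / kappa m L) * (1 + 2 / 3 * (\<gamma> * L))"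
  shows "sqrt k \<le> 2 powr (- (3/2)) * L *
        sqrt (real d * \<gamma> * (1 + \<gamma>) +
              2 * (L\<^sup>2 * \<gamma> ^ 3 / 3) * (1 + \<gamma>) * inverse (kappa m L) * real d)
    + (4 * pi) powr (- (1/2)) *
        sqrt (\<gamma> * D1 m L \<gamma> d + 2 * real d * \<gamma>\<^sup>2 * D2 m L \<gamma> * inverse (kappa m L * m))"
    (is "_ \<le> 2 powr (- (3/2)) * L * sqrt ?A + (4 * pi) powr (- (1/2)) * sqrt ?B")
proof -
  define \<kappa> where "\<kappa> = kappa m L"
  define Q g where "Q = L\<^sup>2 * \<gamma> * real d / \<kappa>" and "g = \<gamma> * L"
  have L: "L > 0" using m by simp
  have \<kappa>: "\<kappa> > 0" using m L by (simp add: kappa_def \<kappa>_def)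
  have g: "0 \<le> g" "g \<le> 1" using \<gamma> L by (auto simp: g_def)
  have A0: "real d * \<gamma> \<le> ?A"
  proof -
    have "real d * \<gamma> * 1 \<le> real d * \<gamma> * (1 + \<gamma>)" using \<gamma> by (intro mult_left_mono) auto
    moreover have "0 \<le> 2 * (L\<^sup>2 * \<gamma> ^ 3 / 3) * (1 + \<gamma>) * inverse \<kappa> * real d" using \<gamma> \<kappa> by simp
    ultimately show ?thesis unfolding \<kappa>_def by linarith
  qed
  have D1: "4 * (L\<^sup>2 * real d / \<kappa>\<^sup>2) \<le> D1 m L \<gamma> d"
  proof -
    have "2 * L\<^sup>2 * inverse \<kappa> * inverse \<kappa> * (2 * real d) \<le>
        2 * L\<^sup>2 * inverse \<kappa> * (inverse \<kappa> + \<gamma>) * (2 * real d + L\<^sup>2 * \<gamma>\<^sup>2 / 6)"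
      using \<kappa> \<gamma> by (intro mult_mono mult_left_mono) auto
    moreover have "2 * L\<^sup>2 * inverse \<kappa> * inverse \<kappa> * (2 * real d) = 4 * (L\<^sup>2 * real d / \<kappa>\<^sup>2)"
      by (simp add: power2_eq_square inverse_eq_divide)
    ultimately show ?thesis unfolding D1_def \<kappa>_def by linarith
  qed
  \<comment> \<open>Bounding 1 / m below by 1 / L turns this summand into the factor 1 + g / 2 of
    \<open>B0\<close>. That factor matters: at g = 1 the bound on (k / Q)^2 is about 0.709, which
    exceeds 2 / pi.\<close>
  have D2: "2 * (L\<^sup>2 * real d / \<kappa>\<^sup>2) * (\<gamma> * g) \<le> 2 * real d * \<gamma>\<^sup>2 * D2 m L \<gamma> * inverse (\<kappa> * m)"
  proof -
    have "L ^ 4 * inverse \<kappa> \<le> D2 m L \<gamma>"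
      using \<gamma> unfolding D2_def \<kappa>_def by (intro mult_left_mono) auto
    then have "2 * real d * \<gamma>\<^sup>2 * (L ^ 4 * inverse \<kappa>) * inverse (\<kappa> * m) \<le>
        2 * real d * \<gamma>\<^sup>2 * D2 m L \<gamma> * inverse (\<kappa> * m)"
      using \<gamma> \<kappa> m by (intro mult_right_mono mult_left_mono) auto
    moreover have "2 * real d * \<gamma>\<^sup>2 * (L ^ 4 * inverse \<kappa>) * inverse (\<kappa> * L) \<le>
        2 * real d * \<gamma>\<^sup>2 * (L ^ 4 * inverse \<kappa>) * inverse (\<kappa> * m)"
      using \<gamma> \<kappa> m by (intro mult_left_mono le_imp_inverse_le) auto
    moreover have "2 * real d * \<gamma>\<^sup>2 * (L ^ 4 * inverse \<kappa>) * inverse (\<kappa> * L) = 2 * (L\<^sup>2 * real d / \<kappa>\<^sup>2) * (\<gamma> * g)"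
      using L \<kappa> by (simp add: g_def power2_eq_square power4_eq_xxxx inverse_eq_divide)
    ultimately show ?thesis by linarith
  qed
  have B0: "4 * (\<gamma> * L\<^sup>2 * real d / \<kappa>\<^sup>2) * (1 + g / 2) \<le> ?B"
  proof -
    have "\<gamma> * (4 * (L\<^sup>2 * real d / \<kappa>\<^sup>2)) \<le> \<gamma> * D1 m L \<gamma> d" using \<gamma> D1 by (intro mult_left_mono) auto
    moreover have "4 * (\<gamma> * L\<^sup>2 * real d / \<kappa>\<^sup>2) * (1 + g / 2) =
        \<gamma> * (4 * (L\<^sup>2 * real d / \<kappa>\<^sup>2)) + 2 * (L\<^sup>2 * real d / \<kappa>\<^sup>2) * (\<gamma> * g)"
      by (simp add: algebra_simps add_divide_distrib)
    ultimately show ?thesis using D2 unfolding \<kappa>_def[symmetric] by linarith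
  qed
  have p2: "(2 powr (- (3/2)))\<^sup>2 = (1 / 8 :: real)"
  proof -
    have "(2 powr (- (3/2)))\<^sup>2 = (2 :: real) powr (- 3)"
      unfolding power2_eq_square powr_add[symmetric] by simp
    then show ?thesis by (simp add: powr_minus powr_numeral)
  qed
  have p4: "((4 * pi) powr (- (1/2)))\<^sup>2 = 1 / (4 * pi)"
    by (simp add: powr_power powr_minus divide_simps)
  have "0 \<le> real d * \<gamma>" using \<gamma> by simp
  then have A: "?A \<ge> 0" using A0 by linarith
  have "0 \<le> 4 * (\<gamma> * L\<^sup>2 * real d / \<kappa>\<^sup>2) * (1 + g / 2)" using \<gamma> g by simp
  then have B: "?B \<ge> 0" using B0 by linarith
  show ?thesis
  proof (rule sqrt_le_add_of_square_le)
    show "0 \<le> 2 powr (- (3/2)) * L * sqrt ?A" "0 \<le> (4 * pi) powr (- (1/2)) * sqrt ?B"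
      by (rule mult_nonneg_nonneg mult_nonneg_nonneg[OF _ less_imp_le[OF L]] powr_ge_zero
          real_sqrt_ge_zero[OF A] real_sqrt_ge_zero[OF B])+
    show "0 \<le> L\<^sup>2 * (real d * \<gamma>) / 8" "0 \<le> (\<gamma> * L\<^sup>2 * real d / \<kappa>\<^sup>2) * (1 + g / 2) / pi"
      using \<gamma> g by auto
    have "L\<^sup>2 * (real d * \<gamma>) / 8 \<le> L\<^sup>2 * ?A / 8" using A0 by (intro divide_right_mono mult_left_mono) auto
    also have "\<dots> = (2 powr (- (3/2)) * L * sqrt ?A)\<^sup>2"
      using A by (simp only: power_mult_distrib p2 real_sqrt_pow2) simp
    finally show "L\<^sup>2 * (real d * \<gamma>) / 8 \<le> (2 powr (- (3/2)) * L * sqrt ?A)\<^sup>2" .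
    have "(\<gamma> * L\<^sup>2 * real d / \<kappa>\<^sup>2) * (1 + g / 2) / pi = (4 * (\<gamma> * L\<^sup>2 * real d / \<kappa>\<^sup>2) * (1 + g / 2)) / (4 * pi)"
      by simp
    also have "\<dots> \<le> ?B / (4 * pi)" using B0 by (intro divide_right_mono) auto
    also have "\<dots> = ((4 * pi) powr (- (1/2)) * sqrt ?B)\<^sup>2"
      using B by (simp only: power_mult_distrib p4 real_sqrt_pow2) simp
    finally show "(\<gamma> * L\<^sup>2 * real d / \<kappa>\<^sup>2) * (1 + g / 2) / pi \<le> ((4 * pi) powr (- (1/2)) * sqrt ?B)\<^sup>2" .
    have "k\<^sup>2 \<le> (50 / 99 * Q * (1 + 2 / 3 * g))\<^sup>2"
      using k by (intro power_mono) (auto simp: Q_def g_def \<kappa>_def)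
    also have "\<dots> = Q\<^sup>2 * ((50 / 99)\<^sup>2 * (1 + 2 / 3 * g)\<^sup>2)"
      by (simp only: power_mult_distrib mult_ac)
    also have "\<dots> \<le> Q\<^sup>2 * (2 / pi * (1 + g / 2))"
    proof (rule mult_left_mono)
      \<comment> \<open>Replacing g^2 by g makes the comparison linear on [0, 1]. There is room to
        weaken 2 / pi to 1 / 2, so pi < 4 is all that is used about pi.\<close>
      have "g\<^sup>2 \<le> g" using g by (simp add: power2_eq_square mult_left_le)
      then have "(50 / 99)\<^sup>2 * (1 + 2 / 3 * g)\<^sup>2 \<le> 1 / 2 * (1 + g / 2)"
        using g by (simp add: power2_eq_square algebra_simps)
      also have "1 / 2 \<le> 2 / pi" using pi_less_4 by (simp add: field_simps)
      then have "1 / 2 * (1 + g / 2) \<le> 2 / pi * (1 + g / 2)" using g by (intro mult_right_mono) auto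
      finally show "(50 / 99)\<^sup>2 * (1 + 2 / 3 * g)\<^sup>2 \<le> 2 / pi * (1 + g / 2)" .
    qed simp
    also have "\<dots> = 16 * (L\<^sup>2 * (real d * \<gamma>) / 8 * ((\<gamma> * L\<^sup>2 * real d / \<kappa>\<^sup>2) * (1 + g / 2) / pi))"
      using \<kappa> by (simp add: Q_def power2_eq_square field_simps)
    finally show "k\<^sup>2 \<le> 16 * (L\<^sup>2 * (real d * \<gamma>) / 8 * ((\<gamma> * L\<^sup>2 * real d / \<kappa>\<^sup>2) * (1 + g / 2) / pi))" .
  qed
qed

theorem corollary13:
  fixes U :: "real ^ 'n \<Rightarrow> real"
    and gradU :: "real ^ 'n \<Rightarrow> real ^ 'n"
    and L m \<gamma> :: real
    and \<pi>\<^sub>\<gamma> :: "(real ^ 'n) measure"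
  assumes "\<And>x. GDERIV U x :> gradU x"
    and "continuous_on UNIV gradU"
    and "L \<ge> 0" and "m > 0"
    and "\<And>x y. norm (gradU x - gradU y) \<le> L * norm (x - y)"
    and "\<And>x y. U y \<ge> U x + gradU x \<bullet> (y - x) + (m / 2) * (norm (x - y))\<^sup>2"
    and "0 < \<gamma>" and "\<gamma> \<le> 1 / (m + L)"
    and "stationary_distribution (ula_kernel gradU \<gamma>) \<pi>\<^sub>\<gamma>"
  shows "tv_dist \<pi>\<^sub>\<gamma> (gibbs_measure U) \<le>
      2 powr (- (3/2)) * L *
        sqrt (real CARD('n) * \<gamma> * (1 + \<gamma>) +
              2 * (L\<^sup>2 * \<gamma> ^ 3 / 3) * (1 + \<gamma>) * inverse (kappa m L) * real CARD('n))
    + (4 * pi) powr (- (1/2)) *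
        sqrt (\<gamma> * D1 m L \<gamma> CARD('n) +
              2 * real CARD('n) * \<gamma>\<^sup>2 * D2 m L \<gamma> * inverse (kappa m L * m))"
proof -
  interpret strongly_convex_potential U gradU L m
    by unfold_locales (rule assms(1,4,5,6))+
  have "\<gamma> * (m + L) \<le> 1"
    using assms(8) m_pos L_pos by (simp add: pos_le_divide_eq)
  moreover have "0 \<le> \<gamma> * m" using m_pos assms(7) by simp
  ultimately have \<gamma>L: "\<gamma> * L \<le> 1" unfolding distrib_left by linarith
  have st: "prob_space \<pi>\<^sub>\<gamma>" "sets \<pi>\<^sub>\<gamma> = sets borel"
    using assms(9) unfolding stationary_distribution_def by blast+
  interpret stationary_ula U gradU L m \<gamma> \<pi>\<^sub>\<gamma>
    by (intro stationary_ula.intro stationary_ula_axioms.intro strongly_convex_potential_axioms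
        assms(7) \<gamma>L st invariant_of_stationary_distribution measurable_gradU assms(9))
  have "tv_dist \<pi>\<^sub>\<gamma> (gibbs_measure U) = tv_dist \<pi>\<^sub>\<gamma> gibbs"
    unfolding gibbs_measure_def gibbs_eq ..
  also have "\<dots> \<le> sqrt (entropy_const / 2)"
    by (rule tv_dist_le_of_entropy[OF st(1) prob_space_gibbs st(2) sets_gibbs
          entropy_const_bounds(1)[OF assms(8)] entropy_bound])
  also have "\<dots> \<le> 2 powr (- (3/2)) * L *
        sqrt (real CARD('n) * \<gamma> * (1 + \<gamma>) +
              2 * (L\<^sup>2 * \<gamma> ^ 3 / 3) * (1 + \<gamma>) * inverse (kappa m L) * real CARD('n))
    + (4 * pi) powr (- (1/2)) *
        sqrt (\<gamma> * D1 m L \<gamma> CARD('n) +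
              2 * real CARD('n) * \<gamma>\<^sup>2 * D2 m L \<gamma> * inverse (kappa m L * m))"
  proof (rule bound_of_entropy[OF m_pos m_le_L assms(7) \<gamma>L])
    show "0 \<le> entropy_const / 2" using entropy_const_bounds(1)[OF assms(8)] by simp
    have "DIM(real^'n) = CARD('n)" by simp
    then show "entropy_const / 2 \<le> 50 / 99 * (L\<^sup>2 * \<gamma> * real CARD('n) / kappa m L) * (1 + 2 / 3 * (\<gamma> * L))"
      using entropy_const_bounds(2)[OF assms(8)] by (simp only:)
  qed
  finally show ?thesis .
qed

end
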